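(* Let $G\in\mathcal{F}_n$ and let $2b$ be the $(n-1)$-th invariant factor of $W(G)$. Suppose that for each odd prime factor $p$ of $b$, $$N(W^{\mathrm T}(G))\not\subset N(A(G)-\lambda_1(G)I)\quad\text{over } \mathbb{F}_p .$$ Then $G$ is DGS. In particular, every graph in $\mathcal{F}_n^*$ is DGS.
   Context: All graphs are simple with vertex set $\{1,\dots,n\}$; $A(G)$ is the adjacency matrix of $G$, $e$ the all-ones vector, and $W(G)=[e,A(G)e,\ldots,A^{n-1}(G)e]$ the walk matrix. Two graphs on $n$ vertices are generalized cospectral if their adjacency matrices have the same spectrum and the adjacency matrices of their complements have the same spectrum. $G$ is DGS (determined by its generalized spectrum) if every graph generalized cospectral with $G$ is isomorphic to $G$. $\mathcal{H}_n$ is the set of graphs on $n$ vertices with $\mathrm{rank}\,W(G)=n-1$. Vertices in the same orbit of $\mathrm{Aut}(G)$ have equal rows in $W(G)$, so each $G\in\mathcal{H}_n$ has $n-1$ or $n$ orbits; $\mathcal{H}_n^s$ is the set of $G\in\mathcal{H}_n$ with exactly $n-1$ orbits. Each $G\in\mathcal{H}_n^s$ has exactly one orbit $\{\tau,\tau'\}$ of size 2, whose elements are called the twins of $G$. For $G\in\mathcal{H}_n^s$, $\lambda_1(G)=-1$ if the twins are adjacent and $\lambda_1(G)=0$ otherwise. The Smith normal form (SNF) of an integral $n\times n$ matrix is the unimodularly equivalent diagonal matrix $\mathrm{diag}(d_1,\dots,d_n)$ with $d_i\ge 0$ and $d_i\mid d_{i+1}$; $d_i$ is the $i$-th invariant factor.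 $\mathcal{F}_n$ ($n\ge 4$) is the set of $G\in\mathcal{H}_n^s$ such that the SNF of $W(G)$ is $\mathrm{diag}[\underbrace{1,\ldots,1}_{\lceil n/2\rceil},\underbrace{2,\ldots,2,2b,0}_{\lfloor n/2\rfloor}]$ with $b$ odd and square-free; $\mathcal{F}_n^*$ is the subset with $b=1$. $N(M)$ over $\mathbb{F}_p$ denotes the nullspace in $\mathbb{F}_p^n$ of the reduction of the integer matrix $M$ modulo $p$. *)

theory Defs
  imports
    Complex_Main
    "HOL-Combinatorics.Permutations"
    "HOL-Computational_Algebra.Squarefree"
    "HOL-Number_Theory.Cong"
    "Jordan_Normal_Form.Char_Poly"
    "Jordan_Normal_Form.DL_Rank"
begin

text \<open>
  A simple graph on \<open>n\<close> vertices is given by its edge set, a set of two-element subsets of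
  the vertex set. The vertices are numbered \<open>0, \<dots>, n - 1\<close> rather than \<open>1, \<dots>, n\<close>, in
  accordance with the indexing of matrices.
\<close>

definition all_edges :: "nat \<Rightarrow> nat set set" where
  "all_edges n = {{u, v} | u v. u < n \<and> v < n \<and> u \<noteq> v}"

definition simple_graph :: "nat \<Rightarrow> nat set set \<Rightarrow> bool" where
  "simple_graph n E \<longleftrightarrow> E \<subseteq> all_edges n"

definition complement_graph :: "nat \<Rightarrow> nat set set \<Rightarrow> nat set set" where
  "complement_graph n E = all_edges n - E"

definition adjacency_mat :: "nat \<Rightarrow> nat set set \<Rightarrow> int mat" where
  "adjacency_mat n E = mat n n (\<lambda>(i, j). if {i, j} \<in> E then 1 else 0)"

definition all_ones :: "nat \<Rightarrow> int vec" where
  "all_ones n = vec n (\<lambda>_. 1)"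

definition walk_mat :: "nat \<Rightarrow> nat set set \<Rightarrow> int mat" where
  "walk_mat n E = mat_of_cols n (map (\<lambda>k. (adjacency_mat n E ^\<^sub>m k) *\<^sub>v all_ones n) [0..<n])"

text \<open>The spectrum is taken with algebraic multiplicities (the constant \<open>spectrum\<close> of
  \<open>Jordan_Normal_Form\<close> is only the set of eigenvalues).\<close>

definition spectrum_mset :: "int mat \<Rightarrow> complex multiset" where
  "spectrum_mset M = proots (char_poly (map_mat of_int M))"

definition gen_cospectral :: "nat \<Rightarrow> nat set set \<Rightarrow> nat set set \<Rightarrow> bool" where
  "gen_cospectral n E E' \<longleftrightarrow>
     spectrum_mset (adjacency_mat n E) = spectrum_mset (adjacency_mat n E') \<and>
     spectrum_mset (adjacency_mat n (complement_graph n E)) =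
       spectrum_mset (adjacency_mat n (complement_graph n E'))"

definition is_graph_iso :: "nat \<Rightarrow> nat set set \<Rightarrow> nat set set \<Rightarrow> (nat \<Rightarrow> nat) \<Rightarrow> bool" where
  "is_graph_iso n E E' f \<longleftrightarrow>
     f permutes {0..<n} \<and> (\<forall>u<n. \<forall>v<n. {u, v} \<in> E \<longleftrightarrow> {f u, f v} \<in> E')"

definition isomorphic :: "nat \<Rightarrow> nat set set \<Rightarrow> nat set set \<Rightarrow> bool" where
  "isomorphic n E E' \<longleftrightarrow> (\<exists>f. is_graph_iso n E E' f)"

definition DGS :: "nat \<Rightarrow> nat set set \<Rightarrow> bool" where
  "DGS n E \<longleftrightarrow>
     (\<forall>E'. simple_graph n E' \<and> gen_cospectral n E' E \<longrightarrow> isomorphic n E' E)"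

definition automorphisms :: "nat \<Rightarrow> nat set set \<Rightarrow> (nat \<Rightarrow> nat) set" where
  "automorphisms n E = {f. is_graph_iso n E E f}"

definition orbits :: "nat \<Rightarrow> nat set set \<Rightarrow> nat set set" where
  "orbits n E = (\<lambda>v. (\<lambda>f. f v) ` automorphisms n E) ` {0..<n}"

definition family_H :: "nat \<Rightarrow> nat set set set" where
  "family_H n = {E. simple_graph n E \<and>
     int (vec_space.rank n (map_mat rat_of_int (walk_mat n E))) = int n - 1}"

definition family_Hs :: "nat \<Rightarrow> nat set set set" where
  "family_Hs n = {E \<in> family_H n. int (card (orbits n E)) = int n - 1}"

definition twins :: "nat \<Rightarrow> nat set set \<Rightarrow> nat \<Rightarrow> nat \<Rightarrow> bool" where
  "twins n E t t' \<longleftrightarrow> t \<noteq> t' \<and> {t, t'} \<in> orbits n E"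

text \<open>For a graph in \<^term>\<open>family_Hs n\<close> the pair of twins is unique, so that the existential
  quantifier below just names it.\<close>

definition lambda1 :: "nat \<Rightarrow> nat set set \<Rightarrow> int" where
  "lambda1 n E = (if \<exists>t t'. twins n E t t' \<and> {t, t'} \<in> E then -1 else 0)"

definition unimodular :: "nat \<Rightarrow> int mat \<Rightarrow> bool" where
  "unimodular n U \<longleftrightarrow> U \<in> carrier_mat n n \<and> \<bar>det U\<bar> = 1"

definition is_SNF :: "nat \<Rightarrow> int mat \<Rightarrow> int mat \<Rightarrow> bool" where
  "is_SNF n M D \<longleftrightarrow>
     M \<in> carrier_mat n n \<and> D \<in> carrier_mat n n \<and>
     (\<exists>U V. unimodular n U \<and> unimodular n V \<and> D = U * M * V) \<and>
     diagonal_mat D \<and>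
     (\<forall>i<n. D $$ (i, i) \<ge> 0) \<and>
     (\<forall>i. Suc i < n \<longrightarrow> D $$ (i, i) dvd D $$ (Suc i, Suc i))"

text \<open>Invariant factors are counted from \<open>1\<close>. The Smith normal form is unique, so that this
  relation determines \<open>d\<close>.\<close>

definition is_invariant_factor :: "nat \<Rightarrow> int mat \<Rightarrow> nat \<Rightarrow> int \<Rightarrow> bool" where
  "is_invariant_factor n M i d \<longleftrightarrow>
     1 \<le> i \<and> i \<le> n \<and> (\<exists>D. is_SNF n M D \<and> d = D $$ (i - 1, i - 1))"

text \<open>\<open>(n + 1) div 2\<close> is the ceiling of \<open>n / 2\<close>; the last \<open>n div 2\<close> diagonal entries are
  \<open>2, \<dots>, 2, 2 b, 0\<close>.\<close>

definition SNF_shape :: "nat \<Rightarrow> int \<Rightarrow> int mat" where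
  "SNF_shape n b = mat_diag n
     (\<lambda>i. (replicate ((n + 1) div 2) 1 @ replicate (n div 2 - 2) 2 @ [2 * b, 0]) ! i)"

definition family_F :: "nat \<Rightarrow> nat set set set" where
  "family_F n = {E \<in> family_Hs n. 4 \<le> n \<and>
     (\<exists>b. odd b \<and> squarefree b \<and> is_SNF n (walk_mat n E) (SNF_shape n b))}"

definition family_F_star :: "nat \<Rightarrow> nat set set set" where
  "family_F_star n = {E \<in> family_Hs n. 4 \<le> n \<and> is_SNF n (walk_mat n E) (SNF_shape n 1)}"

text \<open>The null space over the field with \<open>p\<close> elements of the reduction of \<open>M\<close> modulo \<open>p\<close>.
  As \<open>p\<close> is not fixed, the elements of that field are represented by the residues
  \<open>0, \<dots>, p - 1\<close>.\<close>

definition nullspace_mod :: "int \<Rightarrow> int mat \<Rightarrow> int vec set" where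
  "nullspace_mod p M = {v \<in> carrier_vec (dim_col M).
     (\<forall>i < dim_col M. v $ i \<in> {0..<p}) \<and>
     (\<forall>i < dim_row M. [(M *\<^sub>v v) $ i = 0] (mod p))}"

end

theory Submission
  imports Defs
begin

text \<open>
  Let \<open>A\<close> be the adjacency matrix of \<open>G\<close>, let \<open>w k = A^k e\<close> be its walk vectors and let \<open>\<xi>\<close> be
  the difference of the unit vectors of the two twins. Exchanging the twins is an automorphism;
  hence \<open>\<xi>\<close> is an eigenvector of \<open>A\<close> for \<open>\<lambda>\<^sub>1(G)\<close>, it is orthogonal to all walk vectors, and
  together with \<open>w 0, \<dots>, w (n - 2)\<close> it is a basis of rational \<open>n\<close>-space.

  If \<open>H\<close> is generalized cospectral with \<open>G\<close>, then both graphs have the same numbers of walks of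
  each length (\<open>walks_determined\<close>), so sending the walk vectors of \<open>H\<close> to those of \<open>G\<close> is an
  isometry. It extends to the orthogonal complements by a rational isometry: comparing the
  determinants of the two bases shows that the squared lengths of integral vectors spanning the
  two complements differ by a rational square. As both adjacency matrices have trace \<open>0\<close>, the
  eigenvalues on the complements agree. This gives a rational orthogonal \<open>Q\<close> with \<open>Q e = e\<close> and
  \<open>A(G) Q = Q A(H)\<close> (\<open>rational_orthogonal_transfer\<close>).

  If \<open>Q\<close> is integral, it is a permutation matrix and \<open>H\<close> is isomorphic to \<open>G\<close>. Otherwise let \<open>l\<close> be
  the least positive integer with \<open>l Q\<close> integral and \<open>p\<close> a prime factor of \<open>l\<close>. Each column \<open>z\<close> of
  \<open>l Q\<close> satisfies \<open>W\<^sup>T z = 0\<close> modulo \<open>p\<close> and \<open>z\<^sup>T A^k z = 0\<close> modulo \<open>p\<^sup>2\<close> for all \<open>k\<close>. The heart of the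
  proof is that such a \<open>z\<close> vanishes modulo \<open>p\<close>; this contradicts the choice of \<open>l\<close>.

  If \<open>p\<close> is odd and does not divide \<open>b\<close>, then \<open>z\<close> is a multiple of \<open>\<xi>\<close> modulo \<open>p\<close>, and \<open>\<xi>\<close> is not
  isotropic because \<open>\<xi> \<bullet> \<xi> = 2\<close> (\<open>xi_multiple_isotropic\<close>).

  If \<open>p\<close> is odd and divides \<open>b\<close>, and \<open>z\<close> does not vanish modulo \<open>p\<close>, then the null space of \<open>W\<^sup>T\<close> is
  the plane spanned by \<open>\<xi>\<close> and \<open>z\<close>, and \<open>z\<close> is an eigenvector modulo \<open>p\<close>, whose eigenvalue is not
  \<open>\<lambda>\<^sub>1(G)\<close> by hypothesis. Consider \<open>R\<close>, the lattice spanned by the walk vectors, localized at \<open>p\<close>. It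
  is cyclic over the integer polynomials in \<open>A\<close>, and so is its dual; hence \<open>A\<close> cannot act as a
  scalar on two independent classes of the dual modulo \<open>R\<close>. But two such classes are provided
  by the integral vectors orthogonal to \<open>\<xi>\<close> and by \<open>x / p\<close> for the \<open>x\<close> in \<open>R\<close> congruent to \<open>z\<close>
  (\<open>null_mod_ramified\<close>).

  If \<open>p = 2\<close>, counting dimensions shows that \<open>z\<close> is congruent to \<open>q(A) e\<close> for a polynomial \<open>q\<close> of
  degree at most \<open>(n - 1) / 2\<close> with coefficients \<open>0\<close> and \<open>1\<close>. As the total number of
  walks of each positive length is even, the quadratic conditions modulo \<open>4\<close> become linear: they say that
  \<open>q(A\<^sup>2) e\<close> is orthogonal modulo \<open>4\<close> to all walk vectors. By the Smith normal form, an odd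
  multiple of \<open>q(A\<^sup>2) e\<close> lies in twice the walk lattice. As the relation between the walk vectors is
  monic of degree \<open>n - 1\<close>, this leaves only \<open>q = 0\<close> or, for odd \<open>n\<close>, one exceptional \<open>q\<close>; the latter
  is the one that belongs to \<open>\<xi>\<close>, and \<open>\<xi> \<bullet> \<xi> = 2\<close> excludes it (\<open>null_mod_2\<close>).
\<close>

(* Keeps n - 1 in the form in which the facts below mention it. *)
declare One_nat_def [simp del]

section \<open>Vectors, symmetric arrays and walks\<close>

text \<open>
  Vectors are functions of which only the values below \<open>n\<close> matter. In this form,
  linear combinations of walk vectors are ordinary sums, and no carrier conditions arise when
  passing between the integers, congruences and the rationals.
\<close>

definition dot :: "nat \<Rightarrow> (nat \<Rightarrow> 'a :: comm_ring_1) \<Rightarrow> (nat \<Rightarrow> 'a) \<Rightarrow> 'a" where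
  "dot n x y = (\<Sum>i<n. x i * y i)"

definition mat_app :: "nat \<Rightarrow> (nat \<Rightarrow> nat \<Rightarrow> 'a :: comm_ring_1) \<Rightarrow> (nat \<Rightarrow> 'a) \<Rightarrow> nat \<Rightarrow> 'a" where
  "mat_app n A x i = (\<Sum>j<n. A i j * x j)"

definition walk_vec :: "nat \<Rightarrow> (nat \<Rightarrow> nat \<Rightarrow> 'a :: comm_ring_1) \<Rightarrow> nat \<Rightarrow> nat \<Rightarrow> 'a" where
  "walk_vec n A k = (mat_app n A ^^ k) (\<lambda>_. 1)"

lemma walk_vec_0 [simp]: "walk_vec n A 0 = (\<lambda>_. 1)"
  by (simp add: walk_vec_def)

lemma walk_vec_Suc: "walk_vec n A (Suc k) = mat_app n A (walk_vec n A k)"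
  by (simp add: walk_vec_def)

lemma dot_commute: "dot n x y = dot n y x"
  by (simp add: dot_def mult.commute)

lemma dot_cong: "(\<And>i. i < n \<Longrightarrow> x i = x' i) \<Longrightarrow> (\<And>i. i < n \<Longrightarrow> y i = y' i) \<Longrightarrow> dot n x y = dot n x' y'"
  by (simp add: dot_def)

lemma dot_linear [simp]:
  "dot n (\<lambda>i. x i + y i) z = dot n x z + dot n y z"
  "dot n z (\<lambda>i. x i + y i) = dot n z x + dot n z y"
  "dot n (\<lambda>i. x i - y i) z = dot n x z - dot n y z"
  "dot n z (\<lambda>i. x i - y i) = dot n z x - dot n z y"
  "dot n (\<lambda>i. c * x i) z = c * dot n x z"
  "dot n z (\<lambda>i. c * x i) = c * dot n z x"
  "dot n (\<lambda>i. 0) z = 0"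
  "dot n z (\<lambda>i. 0) = 0"
  by (simp_all add: dot_def algebra_simps sum.distrib sum_subtractf sum_distrib_left)

lemma dot_sum:
  "dot n (\<lambda>i. \<Sum>k\<in>K. x k i) z = (\<Sum>k\<in>K. dot n (x k) z)"
  "dot n z (\<lambda>i. \<Sum>k\<in>K. x k i) = (\<Sum>k\<in>K. dot n z (x k))"
  unfolding dot_def sum_distrib_left sum_distrib_right by (rule sum.swap)+

lemma mat_app_cong: "(\<And>i. i < n \<Longrightarrow> x i = y i) \<Longrightarrow> mat_app n A x = mat_app n A y"
  by (auto simp: mat_app_def fun_eq_iff intro!: sum.cong)

lemma mat_app_linear [simp]:
  "mat_app n A (\<lambda>i. x i + y i) = (\<lambda>i. mat_app n A x i + mat_app n A y i)"
  "mat_app n A (\<lambda>i. x i - y i) = (\<lambda>i. mat_app n A x i - mat_app n A y i)"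
  "mat_app n A (\<lambda>i. c * x i) = (\<lambda>i. c * mat_app n A x i)"
  by (auto simp: mat_app_def fun_eq_iff algebra_simps sum.distrib sum_subtractf sum_distrib_left)

lemma mat_app_sum:
  "mat_app n A (\<lambda>i. \<Sum>k\<in>K. x k i) = (\<lambda>i. \<Sum>k\<in>K. mat_app n A (x k) i)"
  unfolding mat_app_def sum_distrib_left by (rule ext, rule sum.swap)

locale symmetric_array =
  fixes n :: nat and A :: "nat \<Rightarrow> nat \<Rightarrow> 'a :: comm_ring_1"
  assumes sym: "\<And>i j. i < n \<Longrightarrow> j < n \<Longrightarrow> A i j = A j i"
begin

abbreviation w where "w \<equiv> walk_vec n A"

text \<open>
  For an adjacency matrix, the number of all walks with \<open>k\<close> edges.
\<close>

definition walks :: "nat \<Rightarrow> 'a" where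
  "walks k = dot n (\<lambda>_. 1) (w k)"

lemma dot_mat_app: "dot n (mat_app n A x) y = dot n x (mat_app n A y)"
proof -
  have "dot n (mat_app n A x) y = (\<Sum>i<n. \<Sum>j<n. A i j * x j * y i)"
    by (simp add: dot_def mat_app_def sum_distrib_right)
  also have "\<dots> = (\<Sum>j<n. \<Sum>i<n. A i j * x j * y i)"
    by (rule sum.swap)
  also have "\<dots> = (\<Sum>j<n. \<Sum>i<n. x j * (A j i * y i))"
    by (intro sum.cong refl) (simp add: sym algebra_simps)
  also have "\<dots> = dot n x (mat_app n A y)"
    by (simp add: dot_def mat_app_def sum_distrib_left)
  finally show ?thesis .
qed

lemma dot_mat_app_funpow: "dot n ((mat_app n A ^^ k) x) y = dot n x ((mat_app n A ^^ k) y)"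
proof (induction k arbitrary: y)
  case (Suc k)
  have "dot n ((mat_app n A ^^ Suc k) x) y = dot n ((mat_app n A ^^ k) x) (mat_app n A y)"
    by (simp add: dot_mat_app)
  then show ?case
    by (simp add: Suc funpow_swap1)
qed simp

lemma mat_app_funpow_walk: "(mat_app n A ^^ k) (w j) = w (k + j)"
  by (simp add: walk_vec_def funpow_add)

lemma dot_walk_vec: "dot n (w j) (w k) = walks (j + k)"
  unfolding walks_def
  using dot_mat_app_funpow[of j "\<lambda>_. 1" "w k"] mat_app_funpow_walk[of j k]
  by (simp add: walk_vec_def)

lemma dot_walk_vec_Suc: "dot n (w (Suc k)) x = dot n (w k) (mat_app n A x)"
  by (simp add: walk_vec_Suc dot_mat_app)

lemma eigenvector_orth_walk:
  assumes "\<And>i. i < n \<Longrightarrow> mat_app n A x i = c * x i" and "dot n (\<lambda>_. 1) x = 0"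
  shows "dot n (w k) x = 0"
proof (induction k)
  case 0
  then show ?case using assms(2) by simp
next
  case (Suc k)
  have "dot n (w k) (mat_app n A x) = dot n (w k) (\<lambda>i. c * x i)"
    by (rule dot_cong) (auto simp: assms(1))
  then show ?case using Suc by (simp add: dot_walk_vec_Suc)
qed

end

section \<open>The lattice spanned by the walk vectors\<close>

lemma odd_prime_not_dvd_2: "prime (p :: int) \<Longrightarrow> odd p \<Longrightarrow> \<not> p dvd 2"
  using zdvd_imp_le[of p 2] prime_ge_2_int[of p] by auto

text \<open>
  What a Smith normal form \<open>U N V = diag d\<close> of the matrix \<open>N\<close> with
  columns \<open>M 0, \<dots>, M (n - 1)\<close> provides: the rows \<open>f\<close> of
  \<open>U\<close> and the columns \<open>g\<close> of its inverse are dual bases of the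
  integral lattice, and the vectors \<open>d j * g j\<close> span the same lattice as the
  \<open>M k\<close>.
\<close>

locale snf_basis =
  fixes n :: nat and M :: "nat \<Rightarrow> nat \<Rightarrow> int"
    and d :: "nat \<Rightarrow> int" and f g V V' :: "nat \<Rightarrow> nat \<Rightarrow> int"
  assumes expand_f: "\<And>x i. i < n \<Longrightarrow> x i = (\<Sum>j<n. dot n x (g j) * f j i)"
    and expand_g: "\<And>x i. i < n \<Longrightarrow> x i = (\<Sum>j<n. dot n x (f j) * g j i)"
    and dual: "\<And>i j. i < n \<Longrightarrow> j < n \<Longrightarrow> dot n (f i) (g j) = (if i = j then 1 else 0)"
    and g_walk: "\<And>j i. j < n \<Longrightarrow> i < n \<Longrightarrow> d j * g j i = (\<Sum>k<n. V k j * M k i)"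
    and walk_g: "\<And>k i. k < n \<Longrightarrow> i < n \<Longrightarrow> M k i = (\<Sum>j<n. d j * V' k j * g j i)"
begin

text \<open>
  This and the converse below turn congruences against the columns of the matrix into
  congruences on coordinates: the coordinates of \<open>x\<close> with respect to
  \<open>f\<close> are the \<open>dot n (g j) x\<close>.
\<close>

lemma dvd_g:
  assumes "\<And>k. k < n \<Longrightarrow> r dvd dot n (M k) x" and "j < n"
  shows "r dvd d j * dot n (g j) x"
proof -
  have "d j * dot n (g j) x = dot n (\<lambda>i. \<Sum>k<n. V k j * M k i) x"
    unfolding dot_linear(5)[symmetric] by (rule dot_cong) (auto simp: g_walk[OF assms(2)])
  also have "\<dots> = (\<Sum>k<n. V k j * dot n (M k) x)"
    by (simp add: dot_sum)
  finally show ?thesis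
    using assms(1) by (auto intro!: dvd_sum)
qed

lemma dvd_walk:
  assumes "\<And>j. j < n \<Longrightarrow> r dvd d j * dot n (g j) x" and "k < n"
  shows "r dvd dot n (M k) x"
proof -
  have "dot n (M k) x = dot n (\<lambda>i. \<Sum>j<n. (d j * V' k j) * g j i) x"
    by (rule dot_cong) (auto simp: walk_g[OF assms(2)])
  also have "\<dots> = (\<Sum>j<n. V' k j * (d j * dot n (g j) x))"
    by (simp add: dot_sum algebra_simps)
  finally show ?thesis
    using assms(1) by (auto intro!: dvd_sum)
qed

end

text \<open>
  Here \<open>\<xi>\<close> is the difference of the twins and \<open>\<tau>\<close> one of
  them; the coefficients \<open>m\<close> are, up to sign, those of the characteristic
  polynomial of \<open>A\<close> on the orthogonal complement of \<open>\<xi>\<close>.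
\<close>

locale walk_lattice = symmetric_array n A + snf_basis n "walk_vec n A" d f g V V'
  for n and A :: "nat \<Rightarrow> nat \<Rightarrow> int" and d f g V V' +
  fixes \<xi> :: "nat \<Rightarrow> int" and \<theta> :: int and \<tau> :: nat and m :: "nat \<Rightarrow> int"
  assumes n_ge_4: "4 \<le> n"
    and loop_free: "\<And>i. i < n \<Longrightarrow> A i i = 0"
    and xi_eigen: "\<And>i. i < n \<Longrightarrow> mat_app n A \<xi> i = \<theta> * \<xi> i"
    and xi_norm: "dot n \<xi> \<xi> = 2"
    and xi_one: "dot n (\<lambda>_. 1) \<xi> = 0"
    and xi_tau: "\<tau> < n" "\<xi> \<tau> = 1"
    and relation: "\<And>i. i < n \<Longrightarrow> walk_vec n A (n - 1) i = (\<Sum>k<n-1. m k * walk_vec n A k i)"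
    and d_last: "d (n - 1) = 0"
    and d_nonzero: "\<And>j. j < n - 1 \<Longrightarrow> d j \<noteq> 0"
begin

lemma xi_walk: "dot n (w k) \<xi> = 0"
  by (rule eigenvector_orth_walk[OF xi_eigen xi_one])

definition in_span :: "(nat \<Rightarrow> int) \<Rightarrow> bool" where
  "in_span x \<longleftrightarrow> (\<exists>q. \<forall>i<n. x i = (\<Sum>k<n-1. q k * w k i))"

lemma in_span_cong: "(\<And>i. i < n \<Longrightarrow> x i = y i) \<Longrightarrow> in_span x = in_span y"
  by (simp add: in_span_def)

lemma in_span_zero: "in_span (\<lambda>_. 0)"
  unfolding in_span_def by (rule exI[of _ "\<lambda>_. 0"]) simp

lemma in_span_add: "in_span x \<Longrightarrow> in_span y \<Longrightarrow> in_span (\<lambda>i. x i + y i)"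
  unfolding in_span_def
proof (elim exE)
  fix q r
  assume "\<forall>i<n. x i = (\<Sum>k<n-1. q k * w k i)" "\<forall>i<n. y i = (\<Sum>k<n-1. r k * w k i)"
  then show "\<exists>q. \<forall>i<n. x i + y i = (\<Sum>k<n-1. q k * w k i)"
    by (intro exI[of _ "\<lambda>k. q k + r k"]) (simp add: sum.distrib algebra_simps)
qed

lemma in_span_mult: "in_span x \<Longrightarrow> in_span (\<lambda>i. c * x i)"
  unfolding in_span_def
proof (elim exE)
  fix q
  assume "\<forall>i<n. x i = (\<Sum>k<n-1. q k * w k i)"
  then show "\<exists>q. \<forall>i<n. c * x i = (\<Sum>k<n-1. q k * w k i)"
    by (intro exI[of _ "\<lambda>k. c * q k"]) (simp add: sum_distrib_left algebra_simps)
qed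

lemma in_span_sum: "(\<And>j. j \<in> J \<Longrightarrow> in_span (x j)) \<Longrightarrow> in_span (\<lambda>i. \<Sum>j\<in>J. x j i)"
  by (induction J rule: infinite_finite_induct) (auto simp: in_span_zero intro: in_span_add)

text \<open>
  The action of \<open>A\<close> on the coefficients of a combination of walk vectors: they
  move up by one, and the top one comes back through the relation.
\<close>

lemma walk_shift:
  assumes "i < n"
  shows "(\<Sum>k<n-1. q k * w (Suc k) i)
       = (\<Sum>k<n-1. ((case k of 0 \<Rightarrow> 0 | Suc k' \<Rightarrow> q k') + q (n - 2) * m k) * w k i)"
proof -
  obtain N where N: "n = N + 2"
    using n_ge_4 by (metis add.commute le_Suc_ex add_leD1 numeral_Bit0)
  have "(\<Sum>k<n-1. q k * w (Suc k) i) = (\<Sum>k<N. q k * w (Suc k) i) + q N * w (n - 1) i"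
    by (simp add: N)
  also have "(\<Sum>k<N. q k * w (Suc k) i) = (\<Sum>k<n-1. (case k of 0 \<Rightarrow> 0 | Suc k' \<Rightarrow> q k') * w k i)"
    by (simp add: N sum.lessThan_Suc_shift del: sum.lessThan_Suc)
  also have "q N * w (n - 1) i = (\<Sum>k<n-1. q N * m k * w k i)"
    by (simp add: relation[OF assms] sum_distrib_left algebra_simps)
  finally show ?thesis
    by (simp add: N sum.distrib algebra_simps)
qed

lemma in_span_mat_app:
  assumes "in_span x"
  shows "in_span (mat_app n A x)"
proof -
  from assms obtain q where q: "\<And>i. i < n \<Longrightarrow> x i = (\<Sum>k<n-1. q k * w k i)"
    by (auto simp: in_span_def)
  have "mat_app n A x = mat_app n A (\<lambda>i. \<Sum>k<n-1. q k * w k i)"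
    by (rule mat_app_cong) (rule q)
  also have "\<dots> = (\<lambda>i. \<Sum>k<n-1. q k * w (Suc k) i)"
    by (simp add: mat_app_sum walk_vec_Suc)
  finally show ?thesis
    unfolding in_span_def using walk_shift[of _ q] by auto
qed

lemma in_span_walk: "in_span (w k)"
proof (induction k)
  case 0
  have "\<forall>i<n. w 0 i = (\<Sum>k<n-1. (if k = 0 then 1 else 0) * w k i)"
    using n_ge_4 by (subst sum.remove[of _ 0]) auto
  then show ?case
    unfolding in_span_def by (intro exI[of _ "\<lambda>k. if k = 0 then 1 else 0"])
next
  case (Suc k)
  then show ?case
    by (simp add: walk_vec_Suc in_span_mat_app)
qed

lemma in_span_orth_xi: "in_span x \<Longrightarrow> dot n x \<xi> = 0"
proof -
  assume "in_span x"
  then obtain q where q: "\<And>i. i < n \<Longrightarrow> x i = (\<Sum>k<n-1. q k * w k i)"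
    by (auto simp: in_span_def)
  have "dot n x \<xi> = dot n (\<lambda>i. \<Sum>k<n-1. q k * w k i) \<xi>"
    by (rule dot_cong) (auto simp: q)
  then show ?thesis
    by (simp add: dot_sum xi_walk)
qed

lemma in_span_g: "j < n \<Longrightarrow> in_span (\<lambda>i. d j * g j i)"
  by (subst in_span_cong[OF g_walk]) (auto intro!: in_span_sum in_span_mult in_span_walk)

lemma null_all:
  assumes "\<And>k. k < n \<Longrightarrow> r dvd dot n (w k) x"
  shows "r dvd dot n (w k) x"
proof -
  obtain q where q: "\<And>i. i < n \<Longrightarrow> w k i = (\<Sum>j<n-1. q j * w j i)"
    using in_span_walk[of k] by (auto simp: in_span_def)
  have "dot n (w k) x = dot n (\<lambda>i. \<Sum>j<n-1. q j * w j i) x"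
    by (rule dot_cong) (auto simp: q)
  then show ?thesis
    using assms by (auto simp: dot_sum intro!: dvd_sum)
qed

lemma g_orth_xi: "j < n - 1 \<Longrightarrow> dot n (g j) \<xi> = 0"
  using dvd_g[of 0 \<xi> j] xi_walk d_nonzero[of j] by simp

text \<open>
  As the last invariant factor is \<open>0\<close>, both \<open>f (n - 1)\<close> and
  \<open>\<xi>\<close> generate the integral vectors orthogonal to all walk vectors; the sign
  \<open>\<epsilon>\<close> relates them.
\<close>

definition \<epsilon> :: int where "\<epsilon> = f (n - 1) \<tau>"

lemma sum_split_last: "(\<Sum>j<n. h j) = (\<Sum>j<n-1. h j) + (h (n - 1) :: 'b :: comm_monoid_add)"
  using n_ge_4 by (cases n) auto

lemma xi_last: "i < n \<Longrightarrow> \<xi> i = dot n \<xi> (g (n - 1)) * f (n - 1) i"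
  by (subst expand_f[where x = \<xi>]) (simp_all add: sum_split_last dot_commute[of n \<xi>] g_orth_xi)

lemma eps_sq: "\<epsilon> * \<epsilon> = 1" and f_last: "i < n \<Longrightarrow> f (n - 1) i = \<epsilon> * \<xi> i"
proof -
  have "dot n \<xi> (g (n - 1)) * \<epsilon> = 1"
    using xi_last[OF xi_tau(1)] xi_tau(2) by (simp add: \<epsilon>_def)
  then have e: "dot n \<xi> (g (n - 1)) = \<epsilon> \<and> \<epsilon> * \<epsilon> = 1"
    by (metis zmult_eq_1_iff mult_1 mult_minus1_right minus_minus)
  then show "\<epsilon> * \<epsilon> = 1" by simp
  show "f (n - 1) i = \<epsilon> * \<xi> i" if "i < n"
    using xi_last[OF that] e by (simp add: mult.assoc[symmetric])
qed

lemma dot_f_last: "dot n x (f (n - 1)) = \<epsilon> * dot n x \<xi>"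
proof -
  have "dot n x (f (n - 1)) = dot n x (\<lambda>i. \<epsilon> * \<xi> i)"
    by (rule dot_cong) (auto simp: f_last)
  then show ?thesis by simp
qed

text \<open>
  A vector orthogonal to \<open>\<xi>\<close> is a combination of \<open>g 0, \<dots>, g (n -
  2)\<close> with coefficients \<open>dot n x (f j)\<close>, and \<open>d j * g j\<close> is a
  combination of walk vectors.
\<close>

lemma in_span_scaled:
  assumes x: "dot n x \<xi> = 0" and d: "\<And>j. j < n - 1 \<Longrightarrow> d j dvd c * dot n x (f j)"
  shows "in_span (\<lambda>i. c * x i)"
proof -
  have "\<exists>e. c * dot n x (f j) = e * d j" if "j < n - 1" for j
    using d[OF that] by (metis dvd_def mult.commute)
  then obtain e where e: "\<And>j. j < n - 1 \<Longrightarrow> c * dot n x (f j) = e j * d j"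
    by metis
  have eq: "c * x i = (\<Sum>j<n-1. e j * (d j * g j i))" if "i < n" for i
  proof -
    have "x i = (\<Sum>j<n-1. dot n x (f j) * g j i)"
      using expand_g[OF that, of x] unfolding sum_split_last by (simp add: x dot_f_last)
    then have "c * x i = c * (\<Sum>j<n-1. dot n x (f j) * g j i)"
      by (rule arg_cong[where f = "(*) c"])
    also have "\<dots> = (\<Sum>j<n-1. (c * dot n x (f j)) * g j i)"
      unfolding sum_distrib_left by (simp only: mult.assoc)
    also have "\<dots> = (\<Sum>j<n-1. e j * (d j * g j i))"
    proof (rule sum.cong[OF refl])
      fix j assume "j \<in> {..<n-1}"
      then have "c * dot n x (f j) = e j * d j" by (intro e) simp
      then show "c * dot n x (f j) * g j i = e j * (d j * g j i)" by (simp only: mult.assoc[symmetric])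
    qed
    finally show ?thesis .
  qed
  have "in_span (\<lambda>i. \<Sum>j<n-1. e j * (d j * g j i))"
    by (rule in_span_sum, rule in_span_mult, rule in_span_g) simp
  then show ?thesis
    using in_span_cong[of "\<lambda>i. c * x i" "\<lambda>i. \<Sum>j<n-1. e j * (d j * g j i)"] eq by blast
qed

text \<open>
  Modulo a prime that divides none of the nonzero invariant factors, the null space is the
  line of \<open>\<xi>\<close>.
\<close>

lemma null_mod_coprime:
  assumes p: "prime p" and d: "\<And>j. j < n - 1 \<Longrightarrow> \<not> p dvd d j"
    and x: "\<And>k. k < n \<Longrightarrow> p dvd dot n (w k) x"
  obtains c \<beta> where "\<And>i. i < n \<Longrightarrow> x i = c * \<xi> i + p * \<beta> i"
proof -
  have "p dvd dot n x (g j)" if "j < n - 1" for j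
    using dvd_g[OF x, of j] d[OF that] that p by (auto simp: prime_dvd_mult_iff dot_commute)
  then have y: "dot n x (g j) = p * (dot n x (g j) div p)" if "j < n - 1" for j
    using that by simp
  define y where "y j = dot n x (g j) div p" for j
  note y = y[folded y_def]
  have "x i = (dot n x (g (n - 1)) * \<epsilon>) * \<xi> i + p * (\<Sum>j<n-1. y j * f j i)" if "i < n" for i
  proof -
    have "x i = (\<Sum>j<n-1. dot n x (g j) * f j i) + dot n x (g (n - 1)) * f (n - 1) i"
      using expand_f[OF that, of x] by (simp only: sum_split_last)
    also have "(\<Sum>j<n-1. dot n x (g j) * f j i) = (\<Sum>j<n-1. p * (y j * f j i))"
      by (rule sum.cong) (use y in auto)
    finally show ?thesis
      by (simp add: f_last that sum_distrib_left)
  qed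
  then show ?thesis by (rule that)
qed

lemma xi_multiple_isotropic:
  assumes "prime p" "odd p" and x: "\<And>i. i < n \<Longrightarrow> x i = c * \<xi> i + p * \<beta> i"
    and iso: "p dvd dot n x x"
  shows "i < n \<Longrightarrow> p dvd x i"
proof -
  have "dot n x x = dot n (\<lambda>i. c * \<xi> i + p * \<beta> i) (\<lambda>i. c * \<xi> i + p * \<beta> i)"
    by (rule dot_cong) (auto simp: x)
  also have "\<dots> = 2 * c * c + p * (2 * c * dot n \<xi> \<beta> + p * dot n \<beta> \<beta>)"
    by (simp add: xi_norm dot_commute[of n \<beta> \<xi>] algebra_simps)
  finally have "p dvd 2 * c * c"
    using iso by (simp add: dvd_add_left_iff)
  moreover have "\<not> p dvd 2"
    using assms(1,2) by (rule odd_prime_not_dvd_2)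
  ultimately have "p dvd c"
    using assms(1) by (auto simp: prime_dvd_mult_iff)
  then show "i < n \<Longrightarrow> p dvd x i"
    by (simp add: x)
qed

end

section \<open>Independence of the walk vectors and the trace of the relation\<close>

lemma trace_commute:
  fixes X Y :: "'a :: comm_ring_1 mat"
  assumes "X \<in> carrier_mat n n" "Y \<in> carrier_mat n n"
  shows "(\<Sum>i<n. (X * Y) $$ (i, i)) = (\<Sum>i<n. (Y * X) $$ (i, i))"
proof -
  have "(\<Sum>i<n. (X * Y) $$ (i, i)) = (\<Sum>i<n. \<Sum>j<n. X $$ (i, j) * Y $$ (j, i))"
    using assms by (simp add: scalar_prod_def lessThan_atLeast0)
  also have "\<dots> = (\<Sum>j<n. \<Sum>i<n. X $$ (i, j) * Y $$ (j, i))"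
    by (rule sum.swap)
  also have "\<dots> = (\<Sum>j<n. (Y * X) $$ (j, j))"
    using assms by (simp add: scalar_prod_def lessThan_atLeast0 mult.commute)
  finally show ?thesis .
qed

text \<open>
  Multiplying by the adjugate of \<open>S\<close> instead of an inverse keeps this valid over
  the integers.
\<close>

lemma trace_intertwined:
  fixes A S B :: "'a :: idom mat"
  assumes A: "A \<in> carrier_mat n n" and S: "S \<in> carrier_mat n n" and B: "B \<in> carrier_mat n n"
    and AS: "A * S = S * B" and S0: "det S \<noteq> 0"
  shows "(\<Sum>i<n. A $$ (i, i)) = (\<Sum>i<n. B $$ (i, i))"
proof -
  note adj = adj_mat[OF S]
  have "A * (S * adj_mat S) = (S * B) * adj_mat S"
    using A S adj(1) by (simp add: AS[symmetric] assoc_mult_mat)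
  moreover have "A * (S * adj_mat S) = det S \<cdot>\<^sub>m A"
    using A unfolding adj(2) by (simp add: mult_smult_distrib[OF A one_carrier_mat])
  ultimately have "det S * (\<Sum>i<n. A $$ (i, i)) = (\<Sum>i<n. ((S * B) * adj_mat S) $$ (i, i))"
    using A by (simp add: sum_distrib_left flip: \<open>A * (S * adj_mat S) = (S * B) * adj_mat S\<close>)
  also have "\<dots> = (\<Sum>i<n. (adj_mat S * (S * B)) $$ (i, i))"
    using S B adj(1) by (intro trace_commute) auto
  also have "adj_mat S * (S * B) = (adj_mat S * S) * B"
    by (rule assoc_mult_mat[OF adj(1) S B, symmetric])
  also have "\<dots> = det S \<cdot>\<^sub>m B"
    using B unfolding adj(3) by (simp add: mult_smult_assoc_mat[OF one_carrier_mat B])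
  finally show ?thesis
    using S0 B by (simp add: sum_distrib_left[symmetric])
qed

text \<open>
  The basis that consists of \<open>n - 1\<close> walk vectors and one further vector, as a
  matrix.
\<close>

definition frame_mat :: "nat \<Rightarrow> (nat \<Rightarrow> nat \<Rightarrow> 'a :: comm_ring_1) \<Rightarrow> (nat \<Rightarrow> 'a) \<Rightarrow> 'a mat" where
  "frame_mat n A x = mat n n (\<lambda>(i, j). if j < n - 1 then walk_vec n A j i else x i)"

text \<open>
  The matrix of \<open>A\<close> with respect to the basis of \<open>frame_mat\<close>: a
  companion block and an eigenvalue.
\<close>

definition companion_mat :: "nat \<Rightarrow> (nat \<Rightarrow> 'a :: comm_ring_1) \<Rightarrow> 'a \<Rightarrow> 'a mat" where
  "companion_mat n m c = mat n n (\<lambda>(i, j). if j = n - 1 then (if i = n - 1 then c else 0)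
     else if j = n - 2 then (if i = n - 1 then 0 else m i) else (if i = Suc j then 1 else 0))"

lemma frame_mat_carrier [simp]: "frame_mat n A x \<in> carrier_mat n n"
  by (simp add: frame_mat_def)

lemma companion_mat_carrier [simp]: "companion_mat n m c \<in> carrier_mat n n"
  by (simp add: companion_mat_def)

lemma companion_mat_dim [simp]: "dim_row (companion_mat n m c) = n" "dim_col (companion_mat n m c) = n"
  by (simp_all add: companion_mat_def)

lemma mat_times_frame:
  assumes n: "2 \<le> n"
    and x: "\<And>i. i < n \<Longrightarrow> mat_app n A x i = c * x i"
    and rel: "\<And>i. i < n \<Longrightarrow> walk_vec n A (n - 1) i = (\<Sum>k<n-1. m k * walk_vec n A k i)"
  shows "mat n n (\<lambda>(i, j). A i j) * frame_mat n A x = frame_mat n A x * companion_mat n m c"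
proof (rule eq_matI)
  fix i j assume "i < dim_row (frame_mat n A x * companion_mat n m c)"
    and "j < dim_col (frame_mat n A x * companion_mat n m c)"
  then have i: "i < n" and j: "j < n" by (auto simp: frame_mat_def companion_mat_def)
  have L: "(mat n n (\<lambda>(i, j). A i j) * frame_mat n A x) $$ (i, j)
      = mat_app n A (\<lambda>l. if j < n - 1 then walk_vec n A j l else x l) i"
    using i j by (simp add: frame_mat_def scalar_prod_def mat_app_def lessThan_atLeast0)
  have R: "(frame_mat n A x * companion_mat n m c) $$ (i, j)
      = (\<Sum>l<n. (if l < n - 1 then walk_vec n A l i else x i) * companion_mat n m c $$ (l, j))"
    using i j by (simp add: frame_mat_def scalar_prod_def lessThan_atLeast0)
  consider "j = n - 1" | "j = n - 2" | "j < n - 2" using j by linarith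
  then show "(mat n n (\<lambda>(i, j). A i j) * frame_mat n A x) $$ (i, j) = (frame_mat n A x * companion_mat n m c) $$ (i, j)"
  proof cases
    case 1
    have "(\<Sum>l<n. (if l < n - 1 then walk_vec n A l i else x i) * companion_mat n m c $$ (l, j)) = c * x i"
      using n j 1 by (subst sum.remove[of _ "n - 1"]) (auto simp: companion_mat_def intro!: sum.neutral)
    then show ?thesis unfolding L R using 1 x[OF i] by simp
  next
    case 2
    have "(\<Sum>l<n. (if l < n - 1 then walk_vec n A l i else x i) * companion_mat n m c $$ (l, j))
        = (\<Sum>l<n-1. m l * walk_vec n A l i)"
    proof -
      obtain N where N: "n = Suc (Suc N)" using n by (intro that[of "n - 2"]) simp
      show ?thesis
        unfolding N using 2 by (simp add: N companion_mat_def mult.commute)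
    qed
    moreover have "mat_app n A (walk_vec n A j) i = walk_vec n A (n - 1) i"
    proof -
      have "n - 1 = Suc j" using 2 n by simp
      then show ?thesis by (simp only: walk_vec_Suc)
    qed
    moreover have "j < n - 1" using 2 n by simp
    ultimately show ?thesis unfolding L R using rel[OF i] by simp
  next
    case 3
    have "(\<Sum>l<n. (if l < n - 1 then walk_vec n A l i else x i) * companion_mat n m c $$ (l, j)) = walk_vec n A (Suc j) i"
      using n j 3 by (subst sum.remove[of _ "Suc j"]) (auto simp: companion_mat_def intro!: sum.neutral)
    moreover have "j < n - 1" using 3 by simp
    ultimately show ?thesis unfolding L R by (simp add: walk_vec_Suc)
  qed
qed (simp_all add: frame_mat_def companion_mat_def)

lemma trace_companion:
  assumes "2 \<le> n"
  shows "(\<Sum>i<n. companion_mat n m c $$ (i, i)) = m (n - 2) + c"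
proof -
  obtain N where N: "n = Suc (Suc N)" using assms by (intro that[of "n - 2"]) simp
  have "(\<Sum>i<N. companion_mat n m c $$ (i, i)) = 0"
    by (rule sum.neutral) (auto simp: N companion_mat_def)
  then show ?thesis by (simp add: N) (simp add: companion_mat_def)
qed

context walk_lattice begin

text \<open>
  All \<open>d j * g j\<close> with \<open>j < n - 1\<close> are combinations of the walk
  vectors, and together with \<open>\<xi>\<close> they are independent: expressed in the
  coordinates given by \<open>f\<close> they form a triangular matrix with diagonal \<open>d
  0, \<dots>, d (n - 2), \<plusminus>2\<close>.
\<close>

lemma det_frame: "det (frame_mat n A \<xi>) \<noteq> 0"
proof -
  define N where "N = n - 1"
  have "\<exists>q. \<forall>i<n. d j * g j i = (\<Sum>k<N. q k * w k i)" if "j < n" for j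
    using in_span_g[OF that] by (simp add: in_span_def N_def)
  then obtain X where X: "\<And>j i. j < n \<Longrightarrow> i < n \<Longrightarrow> d j * g j i = (\<Sum>k<N. X j k * w k i)"
    by metis
  define Xm where "Xm = mat n n (\<lambda>(k, j). if j < N then if k < N then X j k else 0 else if k = j then 1 else 0)"
  define G where "G = mat n n (\<lambda>(i, j). if j < N then d j * g j i else \<xi> i)"
  define U where "U = mat n n (\<lambda>(i, j). f i j)"
  have carr: "Xm \<in> carrier_mat n n" "G \<in> carrier_mat n n" "U \<in> carrier_mat n n"
    by (simp_all add: Xm_def G_def U_def)
  have n: "n = Suc N" using n_ge_4 by (simp add: N_def)
  have "frame_mat n A \<xi> * Xm = G"
  proof (rule eq_matI)
    fix i j assume "i < dim_row G" "j < dim_col G"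
    then have i: "i < n" and j: "j < n" by (simp_all add: G_def)
    have "(frame_mat n A \<xi> * Xm) $$ (i, j)
        = (\<Sum>k<n. (if k < N then w k i else \<xi> i) * (if j < N then if k < N then X j k else 0 else if k = j then 1 else 0))"
      using i j by (simp add: frame_mat_def Xm_def N_def scalar_prod_def lessThan_atLeast0)
    also have "\<dots> = G $$ (i, j)"
    proof (cases "j < N")
      case True
      then show ?thesis using i j X[OF j i] by (simp add: G_def n mult.commute)
    next
      case False
      then have "j = N" using j n by simp
      then show ?thesis using i j by (simp add: G_def n)
    qed
    finally show "(frame_mat n A \<xi> * Xm) $$ (i, j) = G $$ (i, j)" .
  qed (simp_all add: Xm_def G_def frame_mat_def)
  then have det_G: "det (frame_mat n A \<xi>) * det Xm = det G"
    using det_mult[OF frame_mat_carrier carr(1)] by metis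
  have UG: "(U * G) $$ (i, j) = (if j < N then if i = j then d j else 0 else dot n (f i) \<xi>)" if "i < n" "j < n" for i j
  proof -
    have "(U * G) $$ (i, j) = (\<Sum>l<n. f i l * (if j < N then d j * g j l else \<xi> l))"
      using that by (simp add: U_def G_def scalar_prod_def lessThan_atLeast0)
    also have "\<dots> = (if j < N then d j * dot n (f i) (g j) else dot n (f i) \<xi>)"
      by (simp add: dot_def sum_distrib_left mult.left_commute)
    finally show ?thesis using that by (simp add: dual)
  qed
  have "upper_triangular (U * G)"
    unfolding upper_triangular_def using UG n by (auto simp: U_def)
  then have "det (U * G) = prod_list (diag_mat (U * G))"
    using carr by (intro det_upper_triangular) auto
  also have "\<dots> = (\<Prod>i<n. (U * G) $$ (i, i))"
    using carr by (simp add: prod_list_diag_prod lessThan_atLeast0)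
  also have "\<dots> \<noteq> 0"
  proof -
    have "(U * G) $$ (i, i) \<noteq> 0" if "i < n" for i
    proof (cases "i < N")
      case True
      then show ?thesis using UG[OF that that] d_nonzero[of i] by (simp add: N_def)
    next
      case False
      then have "i = n - 1" using that n by simp
      then have "dot n (f i) \<xi> = 2 * \<epsilon>"
        using dot_f_last[of \<xi>] by (simp add: xi_norm dot_commute)
      then show ?thesis using UG[OF that that] False eps_sq by auto
    qed
    then show ?thesis by simp
  qed
  finally have "det G \<noteq> 0" using det_mult[OF carr(3,2)] by auto
  then show ?thesis using det_G by auto
qed

lemma walk_indep:
  assumes c: "\<And>i. i < n \<Longrightarrow> (\<Sum>k<n-1. c k * w k i) = 0" and k: "k < n - 1"
  shows "c k = 0"
proof (rule ccontr)
  assume "c k \<noteq> 0"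
  define y where "y = vec n (\<lambda>j. if j < n - 1 then c j else 0)"
  have "frame_mat n A \<xi> *\<^sub>v y = 0\<^sub>v n"
  proof (rule eq_vecI)
    fix i assume "i < dim_vec (0\<^sub>v n :: int vec)"
    then have i: "i < n" by simp
    have "(frame_mat n A \<xi> *\<^sub>v y) $ i
        = (\<Sum>j<n. (if j < n - 1 then w j i else \<xi> i) * (if j < n - 1 then c j else 0))"
      using i by (simp add: frame_mat_def y_def scalar_prod_def lessThan_atLeast0)
    also have "\<dots> = 0"
      unfolding sum_split_last using c[OF i] by (simp add: mult.commute)
    finally show "(frame_mat n A \<xi> *\<^sub>v y) $ i = (0\<^sub>v n) $ i" using i by simp
  qed (simp add: frame_mat_def)
  moreover have "y $ k \<noteq> 0" "y \<in> carrier_vec n" using \<open>c k \<noteq> 0\<close> k by (simp_all add: y_def)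
  moreover have "y \<noteq> 0\<^sub>v n" using \<open>y $ k \<noteq> 0\<close> k by auto
  ultimately show False
    using det_frame det_0_iff_vec_prod_zero[OF frame_mat_carrier] by blast
qed

text \<open>
  The trace of \<open>A\<close> is \<open>0\<close>, and in the basis of the frame it is
  \<open>m (n - 2) + \<theta>\<close>.
\<close>

lemma m_top: "m (n - 2) = - \<theta>"
proof -
  have n: "2 \<le> n" using n_ge_4 by simp
  have "(\<Sum>i<n. mat n n (\<lambda>(i, j). A i j) $$ (i, i)) = (\<Sum>i<n. companion_mat n m \<theta> $$ (i, i))"
    by (rule trace_intertwined[OF _ _ _ mat_times_frame[OF n xi_eigen relation] det_frame]) simp_all
  then show ?thesis
    using loop_free by (simp add: trace_companion[OF n])
qed

end

section \<open>Odd primes that divide the last nonzero invariant factor\<close>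

context walk_lattice begin

text \<open>
  A polynomial of degree at most \<open>n - 2\<close> whose product with the linear polynomial
  with root \<open>\<theta>0\<close> is a multiple of the monic relation of degree \<open>n -
  1\<close> is determined by its top coefficient. Modulo \<open>p\<close>, the vanishing of
  the latter passes down from each coefficient to the one below.
\<close>

lemma shift_recursion_zero:
  assumes "\<And>k. k < n - 1 \<Longrightarrow> (p::int) dvd (case k of 0 \<Rightarrow> 0 | Suc k' \<Rightarrow> q k') + q (n - 2) * m k - \<theta>0 * q k"
    and "p dvd q (n - 2)" and "k < n - 1"
  shows "p dvd q k"
  using assms(3)
proof (induction "n - 2 - k" arbitrary: k)
  case 0
  then have "k = n - 2" by linarith
  then show ?case using assms(2) by simp
next
  case (Suc j)
  have k: "Suc k < n - 1" using Suc(2) by simp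
  have "p dvd q (Suc k)" using Suc k by auto
  moreover have "p dvd q k + q (n - 2) * m (Suc k) - \<theta>0 * q (Suc k)"
    using assms(1)[OF k] by simp
  moreover have "q k = (q k + q (n - 2) * m (Suc k) - \<theta>0 * q (Suc k)) - q (n - 2) * m (Suc k) + \<theta>0 * q (Suc k)"
    by simp
  ultimately show ?case
    using assms(2) by (metis dvd_add dvd_diff dvd_mult dvd_mult2)
qed

text \<open>
  Suppose that \<open>z\<close> does not vanish modulo \<open>p\<close>, and let
  \<open>\<gamma> = g (n - 2)\<close>. Isotropy makes \<open>z\<close> an eigenvector modulo
  \<open>p\<close>, say for \<open>\<theta>0\<close>. An integral vector orthogonal to
  \<open>\<xi>\<close> lies in the walk lattice, up to a factor prime to \<open>p\<close>, as
  soon as \<open>p\<close> divides its product with \<open>z\<close> (\<open>lattice\<close>).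
  This applies to \<open>(A - \<theta>0) \<gamma>\<close>, and \<open>z\<close> itself is
  congruent to a vector \<open>x\<close> of the walk lattice for which it applies to \<open>(A
  - \<theta>0) x / p\<close>. Write \<open>d (n - 2) * \<gamma>\<close> and \<open>x\<close>
  as \<open>q0(A) e\<close> and \<open>q1(A) e\<close>. Multiplied by the linear polynomial
  with root \<open>\<theta>0\<close>, both \<open>q0\<close> and \<open>q1\<close> become
  multiples of the relation modulo \<open>p\<close>, so they are proportional modulo
  \<open>p\<close>. As \<open>p\<close> divides \<open>q0(A) e\<close> but not the top
  coefficient of \<open>q0\<close>, it divides \<open>x\<close> and hence \<open>z\<close>.
\<close>

lemma null_mod_ramified:
  assumes p: "prime p" "odd p" and b: "d (n - 2) = 2 * (p * b')" "\<not> p dvd b'"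
    and d: "\<And>j. j < n - 2 \<Longrightarrow> d j = 1 \<or> d j = 2"
    and y: "\<And>k. p dvd dot n (w k) y" "i0 < n" "\<not> p dvd mat_app n A y i0 - \<theta> * y i0"
    and z: "\<And>k. p dvd dot n (w k) z"
    and zz: "p\<^sup>2 dvd dot n z z" and zAz: "p\<^sup>2 dvd dot n z (mat_app n A z)"
    and zAAz: "p dvd dot n (mat_app n A z) (mat_app n A z)"
    and i: "i < n"
  shows "p dvd z i"
proof (rule ccontr)
  assume zi: "\<not> p dvd z i"
  have p2: "\<not> p dvd 2"
    using p by (rule odd_prime_not_dvd_2)
  have pzz: "p dvd dot n z z" and pzAz: "p dvd dot n z (mat_app n A z)"
    using zz zAz by (auto simp: power2_eq_square intro: dvd_mult_left)
  define h where "h = f (n - 2)"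
  define \<gamma> where "\<gamma> = g (n - 2)"
  have split: "(\<Sum>j<n. H j) = (\<Sum>j<n-2. H j) + H (n - 2) + H (n - 1)" for H :: "nat \<Rightarrow> int"
  proof -
    obtain N where "n = Suc (Suc N)" using n_ge_4 by (intro that[of "n - 2"]) simp
    then show ?thesis by simp
  qed
  have null_form: "\<exists>\<beta>. \<forall>i<n. x i = dot n x \<gamma> * h i + (dot n x (g (n - 1)) * \<epsilon>) * \<xi> i + p * \<beta> i"
    if x: "\<And>k. p dvd dot n (w k) x" for x
  proof -
    have "p dvd dot n x (g j)" if "j < n - 2" for j
    proof -
      have "p dvd d j * dot n (g j) x" using x that by (intro dvd_g) auto
      moreover have "\<not> p dvd d j" using d[OF that] p p2 by (auto simp: not_prime_unit)
      ultimately show ?thesis using p by (auto simp: prime_dvd_mult_iff dot_commute)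
    qed
    then have *: "dot n x (g j) = p * (dot n x (g j) div p)" if "j < n - 2" for j
      using that by simp
    define Y where "Y j = dot n x (g j) div p" for j
    note Y = *[folded Y_def]
    have "x i = dot n x \<gamma> * h i + (dot n x (g (n - 1)) * \<epsilon>) * \<xi> i + p * (\<Sum>j<n-2. Y j * f j i)"
      if "i < n" for i
    proof -
      have "x i = (\<Sum>j<n-2. dot n x (g j) * f j i) + dot n x \<gamma> * h i + dot n x (g (n - 1)) * f (n - 1) i"
        using expand_f[OF that, of x] by (simp only: split h_def \<gamma>_def)
      also have "(\<Sum>j<n-2. dot n x (g j) * f j i) = (\<Sum>j<n-2. p * (Y j * f j i))"
        by (rule sum.cong) (use Y in auto)
      finally show ?thesis
        by (simp add: f_last that sum_distrib_left)
    qed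
    then show ?thesis
      by (intro exI[of _ "\<lambda>i. \<Sum>j<n-2. Y j * f j i"]) blast
  qed
  define y2 where "y2 = dot n z \<gamma>"
  obtain c1 \<beta>0 where z_form: "\<And>i. i < n \<Longrightarrow> z i = y2 * h i + c1 * \<xi> i + p * \<beta>0 i"
    using null_form[OF z] unfolding y2_def by blast
  have y2: "\<not> p dvd y2"
  proof
    assume "p dvd y2"
    then obtain y2' where "y2 = p * y2'" by blast
    then have "z i = c1 * \<xi> i + p * (y2' * h i + \<beta>0 i)" if "i < n" for i
      using z_form[OF that] by (simp add: algebra_simps)
    from xi_multiple_isotropic[OF p this pzz i] zi show False by simp
  qed
  obtain r s where rs: "r * y2 = 1 + p * s"
  proof -
    have "coprime y2 p" using y2 p by (simp add: prime_imp_coprime coprime_commute)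
    then obtain u v where "u * y2 + v * p = 1"
      using bezout_int[of y2 p] by (auto simp: coprime_iff_gcd_eq_1)
    then show ?thesis by (intro that[of u "- v"]) (simp add: algebra_simps)
  qed
  have h_form: "h i = r * z i + (- (r * c1)) * \<xi> i + p * (- (r * \<beta>0 i) - s * h i)" if "i < n" for i
  proof -
    have "r * z i = (1 + p * s) * h i + r * c1 * \<xi> i + p * (r * \<beta>0 i)"
      unfolding rs[symmetric] z_form[OF that] by (simp add: algebra_simps)
    then show ?thesis by (simp add: algebra_simps)
  qed
  \<comment> \<open>The null space is spanned by \<open>\<xi>\<close> and \<open>z\<close>, because \<open>y2\<close> is invertible.\<close>
  have null_span: "\<exists>a c \<beta>. \<forall>i<n. x i = a * z i + c * \<xi> i + p * \<beta> i"
    if x: "\<And>k. p dvd dot n (w k) x" for x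
  proof -
    obtain a c \<beta> where x: "\<And>i. i < n \<Longrightarrow> x i = a * h i + c * \<xi> i + p * \<beta> i"
      using null_form[OF x] by blast
    have "x i = (a * r) * z i + (c - a * r * c1) * \<xi> i + p * (\<beta> i + a * (- (r * \<beta>0 i) - s * h i))"
      if "i < n" for i
    proof -
      have "a * h i = a * (r * z i + (- (r * c1)) * \<xi> i + p * (- (r * \<beta>0 i) - s * h i))"
        using h_form[OF that] by (rule arg_cong[where f = "(*) a"])
      show ?thesis
        by (simp only: x[OF that] \<open>a * h i = _\<close>) (simp add: algebra_simps)
    qed
    then show ?thesis
      by (intro exI[of _ "a * r"] exI[of _ "c - a * r * c1"]
          exI[of _ "\<lambda>i. \<beta> i + a * (- (r * \<beta>0 i) - s * h i)"]) simp
  qed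
  have "p dvd dot n (w k) (mat_app n A z)" for k
    using z[of "Suc k"] by (simp add: dot_walk_vec_Suc)
  from null_span[OF this] obtain \<theta>0 \<mu> \<beta>1 where
    Az: "\<And>i. i < n \<Longrightarrow> mat_app n A z i = \<theta>0 * z i + \<mu> * \<xi> i + p * \<beta>1 i"
    by blast
  have dot_Az: "dot n x (mat_app n A z) = \<theta>0 * dot n x z + \<mu> * dot n x \<xi> + p * dot n x \<beta>1" for x
  proof -
    have "dot n x (mat_app n A z) = dot n x (\<lambda>i. \<theta>0 * z i + \<mu> * \<xi> i + p * \<beta>1 i)"
      by (rule dot_cong) (auto simp: Az)
    then show ?thesis by simp
  qed
  have "p dvd \<mu> * dot n z \<xi>"
    using pzAz pzz unfolding dot_Az[of z] by (simp add: dvd_add_left_iff dvd_add_right_iff)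
  have "p dvd \<mu>"
  proof -
    have "dot n (mat_app n A z) (mat_app n A z)
        = \<theta>0 * dot n z (mat_app n A z) + \<mu> * dot n (mat_app n A z) \<xi> + p * dot n (mat_app n A z) \<beta>1"
      by (subst dot_Az) (simp add: dot_commute[of n z])
    also have "dot n (mat_app n A z) \<xi> = \<theta>0 * dot n z \<xi> + 2 * \<mu> + p * dot n \<xi> \<beta>1"
      by (subst dot_commute, subst dot_Az) (simp add: xi_norm dot_commute[of n \<xi> z])
    finally have "dot n (mat_app n A z) (mat_app n A z) = \<theta>0 * dot n z (mat_app n A z)
        + \<theta>0 * (\<mu> * dot n z \<xi>) + p * (\<mu> * dot n \<xi> \<beta>1 + dot n (mat_app n A z) \<beta>1) + 2 * \<mu> * \<mu>"
      by (simp add: algebra_simps)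
    with zAAz pzAz \<open>p dvd \<mu> * dot n z \<xi>\<close> have "p dvd 2 * \<mu> * \<mu>"
      by (metis dvd_add_right_iff dvd_add dvd_mult dvd_triv_left)
    then show ?thesis using p p2 by (auto simp: prime_dvd_mult_iff)
  qed
  then obtain \<mu>' where \<mu>': "\<mu> = p * \<mu>'" by blast
  define \<beta> where "\<beta> i = \<mu>' * \<xi> i + \<beta>1 i" for i
  have Az: "mat_app n A z i = \<theta>0 * z i + p * \<beta> i" if "i < n" for i
    using Az[OF that] by (simp add: \<mu>' \<beta>_def algebra_simps)
  have dot_Az: "dot n x (mat_app n A z) = \<theta>0 * dot n x z + p * dot n x \<beta>" for x
  proof -
    have "dot n x (mat_app n A z) = dot n x (\<lambda>i. \<theta>0 * z i + p * \<beta> i)"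
      by (rule dot_cong) (auto simp: Az)
    then show ?thesis by simp
  qed
  have dot_A_xi: "dot n (mat_app n A x) \<xi> = \<theta> * dot n x \<xi>" for x
  proof -
    have "dot n x (mat_app n A \<xi>) = dot n x (\<lambda>i. \<theta> * \<xi> i)"
      by (rule dot_cong) (auto simp: xi_eigen)
    then show ?thesis by (simp add: dot_mat_app)
  qed
  \<comment> \<open>Otherwise \<open>A - \<theta>\<close> would annihilate \<open>\<xi>\<close> and \<open>z\<close> modulo \<open>p\<close>, and with them the null space, contrary to the choice of \<open>y\<close>.\<close>
  have theta: "\<not> p dvd \<theta>0 - \<theta>"
  proof
    assume "p dvd \<theta>0 - \<theta>"
    then obtain t where t: "\<theta>0 - \<theta> = p * t" by blast
    obtain a c \<delta> where y_form: "\<And>i. i < n \<Longrightarrow> y i = a * z i + c * \<xi> i + p * \<delta> i"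
      using null_span[OF y(1)] by blast
    have "mat_app n A y = mat_app n A (\<lambda>i. a * z i + c * \<xi> i + p * \<delta> i)"
      by (rule mat_app_cong) (rule y_form)
    then have "mat_app n A y i0 = a * (\<theta>0 * z i0 + p * \<beta> i0) + c * (\<theta> * \<xi> i0) + p * mat_app n A \<delta> i0"
      by (simp add: Az y xi_eigen)
    then have "mat_app n A y i0 - \<theta> * y i0
        = (\<theta>0 - \<theta>) * (a * z i0) + p * (a * \<beta> i0 + mat_app n A \<delta> i0 - \<theta> * \<delta> i0)"
      by (simp add: y_form y algebra_simps)
    also have "\<dots> = p * (t * (a * z i0) + (a * \<beta> i0 + mat_app n A \<delta> i0 - \<theta> * \<delta> i0))"
      by (simp add: t algebra_simps)
    finally show False using y(3) by simp
  qed
  have zxi: "p dvd dot n z \<xi>"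
  proof -
    have "\<theta> * dot n z \<xi> = \<theta>0 * dot n z \<xi> + p * dot n \<xi> \<beta>"
      using dot_A_xi[of z] dot_Az[of \<xi>] by (simp add: dot_commute)
    then have "(\<theta>0 - \<theta>) * dot n z \<xi> = p * (- dot n \<xi> \<beta>)"
      by (simp add: algebra_simps)
    then have "p dvd (\<theta>0 - \<theta>) * dot n z \<xi>" by simp
    then show ?thesis using theta p by (simp add: prime_dvd_mult_iff)
  qed
  have z\<beta>: "p dvd dot n z \<beta>"
  proof -
    have "p\<^sup>2 dvd p * dot n z \<beta>"
      using zz zAz dot_Az[of z] by (metis dvd_add_right_iff dvd_mult)
    then show ?thesis using p by (simp add: power2_eq_square)
  qed
  have orth_h: "p dvd dot n x h" if "p dvd dot n x z" "p dvd dot n x \<xi>" for x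
  proof -
    have "dot n x h = dot n x (\<lambda>i. r * z i + (- (r * c1)) * \<xi> i + p * (- (r * \<beta>0 i) - s * h i))"
      by (rule dot_cong, rule refl, rule h_form)
    also have "\<dots> = r * dot n x z + (- (r * c1)) * dot n x \<xi> + p * dot n x (\<lambda>i. - (r * \<beta>0 i) - s * h i)"
      by (simp only: dot_linear)
    finally have eq: "dot n x h = \<dots>" .
    show ?thesis
      unfolding eq by (intro dvd_add dvd_mult that dvd_triv_left)
  qed
  have lattice: "in_span (\<lambda>i. 2 * b' * x i)" if x: "dot n x \<xi> = 0" "p dvd dot n x z" for x
  proof -
    have "d j dvd 2 * b' * dot n x (f j)" if "j < n - 1" for j
    proof (cases "j = n - 2")
      case True
      from orth_h[OF x(2)] x(1) obtain e where "dot n x h = p * e" by auto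
      then show ?thesis using True b(1) by (simp add: h_def)
    next
      case False
      then have "j < n - 2" using that by linarith
      then have "d j dvd 2" using d[of j] by auto
      then show ?thesis by (simp add: mult.assoc)
    qed
    then show ?thesis by (rule in_span_scaled[OF x(1)])
  qed
  have p2b: "\<not> p dvd 2 * b'"
    using p p2 b(2) by (simp add: prime_dvd_mult_iff)
  have recursion: "p dvd (case k of 0 \<Rightarrow> 0 | Suc k' \<Rightarrow> q k') + q (n - 2) * m k - \<theta>0 * q k"
    if q: "\<And>i. i < n \<Longrightarrow> u i = (\<Sum>k<n-1. q k * w k i)"
      and u: "\<And>i. i < n \<Longrightarrow> mat_app n A u i - \<theta>0 * u i = p * x i"
      and x: "dot n x z = p * x'" and k: "k < n - 1" for q u x x' k
  proof -
    have xxi: "dot n x \<xi> = 0"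
    proof -
      have "in_span u"
        unfolding in_span_def by (intro exI[of _ q]) (simp add: q)
      note in_span_orth_xi[OF this] in_span_orth_xi[OF in_span_mat_app[OF this]]
      moreover have "dot n (\<lambda>i. mat_app n A u i - \<theta>0 * u i) \<xi> = dot n (\<lambda>i. p * x i) \<xi>"
        by (rule dot_cong) (auto simp: u)
      ultimately show ?thesis using p by auto
    qed
    have "in_span (\<lambda>i. 2 * b' * x i)"
      using lattice[OF xxi] x by simp
    then obtain \<rho> where \<rho>: "\<And>i. i < n \<Longrightarrow> 2 * b' * x i = (\<Sum>k<n-1. \<rho> k * w k i)"
      by (auto simp: in_span_def)
    have Au: "mat_app n A u i = (\<Sum>k<n-1. ((case k of 0 \<Rightarrow> 0 | Suc k' \<Rightarrow> q k') + q (n - 2) * m k) * w k i)"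
      if "i < n" for i
    proof -
      have "mat_app n A u = mat_app n A (\<lambda>i. \<Sum>k<n-1. q k * w k i)"
        by (rule mat_app_cong) (rule q)
      then show ?thesis
        using walk_shift[OF that, of q] by (simp add: mat_app_sum walk_vec_Suc)
    qed
    have "(\<Sum>k<n-1. (2 * b' * ((case k of 0 \<Rightarrow> 0 | Suc k' \<Rightarrow> q k') + q (n - 2) * m k - \<theta>0 * q k) - p * \<rho> k) * w k i) = 0"
      if "i < n" for i
    proof -
      have "(\<Sum>k<n-1. (2 * b' * ((case k of 0 \<Rightarrow> 0 | Suc k' \<Rightarrow> q k') + q (n - 2) * m k - \<theta>0 * q k) - p * \<rho> k) * w k i)
        = 2 * b' * (mat_app n A u i - \<theta>0 * u i) - p * (2 * b' * x i)"
        unfolding Au[OF that] q[OF that] \<rho>[OF that]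
        by (simp add: sum_distrib_left sum_subtractf sum.distrib algebra_simps)
      also have "\<dots> = 0"
        by (simp add: u[OF that])
      finally show ?thesis .
    qed
    from walk_indep[OF this k]
    have "2 * b' * ((case k of 0 \<Rightarrow> 0 | Suc k' \<Rightarrow> q k') + q (n - 2) * m k - \<theta>0 * q k) = p * \<rho> k"
      by simp
    then have "p dvd 2 * b' * ((case k of 0 \<Rightarrow> 0 | Suc k' \<Rightarrow> q k') + q (n - 2) * m k - \<theta>0 * q k)"
      by simp
    then show ?thesis
      using p p2b prime_dvd_mult_iff by blast
  qed
  have gxi: "dot n \<gamma> \<xi> = 0" using g_orth_xi[of "n - 2"] n_ge_4 by (simp add: \<gamma>_def)
  obtain q0 where q0: "\<And>i. i < n \<Longrightarrow> 2 * (p * b') * \<gamma> i = (\<Sum>k<n-1. q0 k * w k i)"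
    using in_span_g[of "n - 2"] n_ge_4 by (auto simp: in_span_def b(1) \<gamma>_def)
  have q0_rec: "p dvd (case k of 0 \<Rightarrow> 0 | Suc k' \<Rightarrow> q0 k') + q0 (n - 2) * m k - \<theta>0 * q0 k"
    if "k < n - 1" for k
  proof (rule recursion[OF q0 _ _ that])
    show "mat_app n A (\<lambda>i. 2 * (p * b') * \<gamma> i) i - \<theta>0 * (2 * (p * b') * \<gamma> i)
      = p * (2 * b' * (mat_app n A \<gamma> i - \<theta>0 * \<gamma> i))" for i
      by (simp only: mat_app_linear) (simp add: algebra_simps)
    have "dot n (mat_app n A \<gamma>) z = \<theta>0 * dot n \<gamma> z + p * dot n \<gamma> \<beta>"
      by (simp add: dot_mat_app dot_Az)
    then show "dot n (\<lambda>i. 2 * b' * (mat_app n A \<gamma> i - \<theta>0 * \<gamma> i)) z = p * (2 * b' * dot n \<gamma> \<beta>)"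
      by (simp only: dot_linear) (simp add: algebra_simps)
  qed
  \<comment> \<open>As \<open>p + 1\<close> is even, \<open>(p + 1) * g j\<close> lies in the walk lattice for \<open>j < n - 2\<close>; and modulo \<open>p\<close> it is \<open>g j\<close>.\<close>
  obtain x \<beta>2 where x: "in_span x" and zx: "\<And>i. i < n \<Longrightarrow> z i = x i + p * \<beta>2 i"
  proof -
    obtain p' where p': "p + 1 = 2 * p'" using p(2) by (metis odd_one even_plus_one_iff evenE odd_even_add)
    obtain a1 where a1: "dot n z h = p * a1" using orth_h[OF pzz zxi] by blast
    have "p dvd dot n z (f (n - 1))" using zxi by (simp add: dot_f_last)
    then obtain a2 where a2: "dot n z (f (n - 1)) = p * a2" by blast
    define x where "x i = (\<Sum>j<n-2. (p + 1) * dot n z (f j) * g j i)" for i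
    have "in_span (\<lambda>i. (p + 1) * dot n z (f j) * g j i)" if "j < n - 2" for j
    proof -
      have "\<exists>e. p + 1 = e * d j" using d[OF that] p' by auto
      then obtain e where "p + 1 = e * d j" by blast
      then have "(\<lambda>i. (p + 1) * dot n z (f j) * g j i) = (\<lambda>i. (e * dot n z (f j)) * (d j * g j i))"
        by (simp add: fun_eq_iff)
      then show ?thesis using that by (simp only:) (intro in_span_mult in_span_g, simp)
    qed
    then have "in_span x" unfolding x_def by (intro in_span_sum) auto
    moreover have "z i = x i + p * ((p + 1) * (a1 * \<gamma> i + a2 * g (n - 1) i) - z i)" if "i < n" for i
    proof -
      have "(p + 1) * z i = (p + 1) * (\<Sum>j<n. dot n z (f j) * g j i)"
        using expand_g[OF that, of z] by simp
      also have "\<dots> = x i + (p + 1) * (p * a1 * \<gamma> i + p * a2 * g (n - 1) i)"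
        unfolding split a2 x_def \<gamma>_def using a1
        by (simp add: h_def sum_distrib_left algebra_simps)
      finally show ?thesis by (simp add: algebra_simps)
    qed
    ultimately show ?thesis by (rule that)
  qed
  from x obtain q1 where q1: "\<And>i. i < n \<Longrightarrow> x i = (\<Sum>k<n-1. q1 k * w k i)"
    by (auto simp: in_span_def)
  obtain \<zeta> where \<zeta>: "dot n z \<beta> = p * \<zeta>" using z\<beta> by blast
  have q1_rec: "p dvd (case k of 0 \<Rightarrow> 0 | Suc k' \<Rightarrow> q1 k') + q1 (n - 2) * m k - \<theta>0 * q1 k"
    if "k < n - 1" for k
  proof (rule recursion[OF q1 _ _ that])
    show "mat_app n A x i - \<theta>0 * x i = p * (\<beta> i - (mat_app n A \<beta>2 i - \<theta>0 * \<beta>2 i))" if "i < n" for i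
    proof -
      have "mat_app n A z = mat_app n A (\<lambda>i. x i + p * \<beta>2 i)"
        by (rule mat_app_cong) (rule zx)
      then have "mat_app n A x i = \<theta>0 * z i + p * \<beta> i - p * mat_app n A \<beta>2 i"
        using Az[OF that] by simp
      then show ?thesis by (simp add: zx[OF that] algebra_simps)
    qed
    have "dot n (mat_app n A \<beta>2) z = \<theta>0 * dot n \<beta>2 z + p * dot n \<beta>2 \<beta>"
      by (simp add: dot_mat_app dot_Az)
    then show "dot n (\<lambda>i. \<beta> i - (mat_app n A \<beta>2 i - \<theta>0 * \<beta>2 i)) z = p * (\<zeta> - dot n \<beta>2 \<beta>)"
      using \<zeta> by (simp add: dot_commute[of n \<beta> z] algebra_simps)
  qed
  \<comment> \<open>Otherwise \<open>p\<close> would divide \<open>q0\<close>, and \<open>p\<^sup>2\<close> would divide \<open>2 * (p * b') * dot n \<gamma> z\<close>.\<close>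
  have top: "\<not> p dvd q0 (n - 2)"
  proof
    assume "p dvd q0 (n - 2)"
    then have "p dvd q0 k" if "k < n - 1" for k
      using shift_recursion_zero[OF q0_rec] that by blast
    then have q: "q0 k = p * (q0 k div p)" if "k < n - 1" for k
      using that by simp
    have "2 * (p * b') * dot n \<gamma> z = dot n (\<lambda>i. \<Sum>k<n-1. q0 k * w k i) z"
      unfolding dot_linear(5)[symmetric] by (rule dot_cong) (auto simp: q0)
    also have "\<dots> = (\<Sum>k<n-1. q0 k * dot n (w k) z)"
      by (simp add: dot_sum)
    also have "p * p dvd \<dots>"
    proof (rule dvd_sum)
      fix k assume "k \<in> {..<n-1}"
      then show "p * p dvd q0 k * dot n (w k) z"
        using q[of k] z[of k] by (metis dvd_triv_left lessThan_iff mult_dvd_mono)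
    qed
    finally have "p dvd 2 * b' * y2"
      using p by (simp add: y2_def dot_commute[of n z] ac_simps)
    then show False using p2b y2 p by (simp add: prime_dvd_mult_iff)
  qed
  \<comment> \<open>This combination of \<open>q0\<close> and \<open>q1\<close> has top coefficient \<open>0\<close>.\<close>
  have cross: "p dvd q1 (n - 2) * q0 k - q0 (n - 2) * q1 k" if "k < n - 1" for k
  proof (rule shift_recursion_zero[OF _ _ that])
    fix k assume k: "k < n - 1"
    show "p dvd (case k of 0 \<Rightarrow> 0 | Suc k' \<Rightarrow> q1 (n - 2) * q0 k' - q0 (n - 2) * q1 k')
      + (q1 (n - 2) * q0 (n - 2) - q0 (n - 2) * q1 (n - 2)) * m k
      - \<theta>0 * (q1 (n - 2) * q0 k - q0 (n - 2) * q1 k)"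
      using dvd_diff[OF dvd_mult[OF q0_rec[OF k], of "q1 (n - 2)"] dvd_mult[OF q1_rec[OF k], of "q0 (n - 2)"]]
      by (cases k) (simp_all add: algebra_simps)
  qed simp
  have "p dvd q0 (n - 2) * x i"
  proof -
    have "q0 (n - 2) * x i = q1 (n - 2) * (2 * (p * b') * \<gamma> i)
        - (\<Sum>k<n-1. (q1 (n - 2) * q0 k - q0 (n - 2) * q1 k) * w k i)"
      unfolding q0[OF i] q1[OF i]
      by (simp add: sum_distrib_left sum_subtractf algebra_simps)
    moreover have "p dvd (\<Sum>k<n-1. (q1 (n - 2) * q0 k - q0 (n - 2) * q1 k) * w k i)"
      using cross by (auto intro!: dvd_sum)
    ultimately show ?thesis by simp
  qed
  then have "p dvd x i" using p top by (simp add: prime_dvd_mult_iff)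
  then show False using zi zx[OF i] by simp
qed

end

section \<open>Linear algebra modulo 2\<close>

text \<open>
  More unknowns than equations over the field with two elements: by the pigeonhole principle
  two different \<open>0\<close>-\<open>1\<close> vectors have the same image, and their sum
  is a solution.
\<close>

lemma mod_2_dependence:
  fixes t :: "'i \<Rightarrow> 'j \<Rightarrow> int"
  assumes "finite I" "finite J" "card J < card I"
  shows "\<exists>q. (\<forall>i. q i \<in> {0, 1}) \<and> (\<exists>i\<in>I. q i = 1) \<and> (\<forall>j\<in>J. even (\<Sum>i\<in>I. q i * t i j))"
proof -
  let ?Q = "I \<rightarrow>\<^sub>E {0, 1 :: int}" and ?R = "J \<rightarrow>\<^sub>E {0, 1 :: int}"
  define \<Phi> where "\<Phi> q = restrict (\<lambda>j. (\<Sum>i\<in>I. q i * t i j) mod 2) J" for q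
  have "\<Phi> ` ?Q \<subseteq> ?R"
    by (auto simp: \<Phi>_def)
  moreover have "card ?R < card ?Q"
    using assms by (simp add: card_PiE)
  moreover have "finite ?R"
    using assms by (intro finite_PiE) auto
  ultimately have "\<not> inj_on \<Phi> ?Q"
    by (metis card_inj_on_le linorder_not_less)
  then obtain q q' where q: "q \<in> ?Q" "q' \<in> ?Q" "\<Phi> q = \<Phi> q'" "q \<noteq> q'"
    by (auto simp: inj_on_def)
  then obtain i where i: "i \<in> I" "q i \<noteq> q' i"
    by (meson PiE_ext)
  show ?thesis
  proof (intro exI[of _ "\<lambda>i. (q i + q' i) mod 2"] conjI allI ballI)
    show "(q i + q' i) mod 2 \<in> {0, 1}" for i by auto
    have "q i \<in> {0, 1}" "q' i \<in> {0, 1}"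
      using q i by (auto simp: PiE_iff)
    then show "\<exists>i\<in>I. (q i + q' i) mod 2 = 1"
      using i by (intro bexI[of _ i]) auto
    fix j assume j: "j \<in> J"
    then have "(\<Sum>i\<in>I. q i * t i j) mod 2 = (\<Sum>i\<in>I. q' i * t i j) mod 2"
      using fun_cong[OF q(3), of j] by (simp add: \<Phi>_def)
    then have "even ((\<Sum>i\<in>I. q i * t i j) + (\<Sum>i\<in>I. q' i * t i j))"
      by presburger
    then have "even (\<Sum>i\<in>I. (q i + q' i) * t i j)"
      by (simp add: sum.distrib algebra_simps)
    moreover have "even ((\<Sum>i\<in>I. (q i + q' i) * t i j) - (\<Sum>i\<in>I. (q i + q' i) mod 2 * t i j))"
      unfolding sum_subtractf[symmetric] left_diff_distrib[symmetric]
      by (intro dvd_sum dvd_mult2) (simp add: minus_mod_eq_mult_div)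
    ultimately show "even (\<Sum>i\<in>I. (q i + q' i) mod 2 * t i j)"
      by simp
  qed
qed

lemma sum_symmetric:
  fixes F :: "nat \<Rightarrow> nat \<Rightarrow> 'a :: comm_ring_1"
  assumes "\<And>i j. i < n \<Longrightarrow> j < n \<Longrightarrow> F i j = F j i"
  shows "(\<Sum>i<n. \<Sum>j<n. F i j) = (\<Sum>i<n. F i i) + 2 * (\<Sum>i<n. \<Sum>j<i. F i j)"
  using assms
proof (induction n)
  case (Suc n)
  have "(\<Sum>i<Suc n. \<Sum>j<Suc n. F i j)
      = (\<Sum>i<n. \<Sum>j<n. F i j) + (\<Sum>i<n. F i n) + (\<Sum>j<n. F n j) + F n n"
    by (simp add: sum.distrib)
  also have "(\<Sum>i<n. F i n) = (\<Sum>j<n. F n j)"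
    by (rule sum.cong) (auto intro: Suc.prems)
  finally show ?case
    using Suc by (simp add: algebra_simps)
qed simp

context walk_lattice begin

text \<open>
  For odd length, \<open>x\<^sup>T A x\<close> is even as \<open>A\<close> is symmetric
  without loops; for even length \<open>2 j\<close> the number is \<open>w j \<bullet> w
  j\<close>, which has the parity of the number of walks of length \<open>j\<close>.
\<close>

lemma walks_even: "0 < k \<Longrightarrow> even (walks k)"
proof (induction k rule: less_induct)
  case (less k)
  show ?case
  proof (cases "even k")
    case True
    then obtain j where k: "k = j + j" "0 < j" "j < k"
      using less.prems by (metis add_0 evenE gr0I less_add_same_cancel1 mult_2)
    have "walks k = (\<Sum>i<n. w j i * w j i)"
      unfolding k(1) dot_walk_vec[symmetric] by (simp add: dot_def)
    moreover have "walks j = (\<Sum>i<n. w j i)"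
      by (simp add: walks_def dot_def)
    ultimately have "walks k - walks j = (\<Sum>i<n. w j i * w j i - w j i)"
      by (simp add: sum_subtractf)
    moreover have "even \<dots>"
      by (intro dvd_sum) auto
    ultimately show ?thesis
      using less.IH[OF k(3,2)] by presburger
  next
    case False
    then obtain j where k: "k = j + Suc j"
      by (metis add_Suc_right mult_2 oddE Suc_eq_plus1)
    have "walks k = (\<Sum>i<n. \<Sum>l<n. w j i * A i l * w j l)"
      unfolding k dot_walk_vec[symmetric]
      by (simp add: walk_vec_Suc dot_def mat_app_def sum_distrib_left mult.assoc)
    also have "\<dots> = (\<Sum>i<n. w j i * A i i * w j i) + 2 * (\<Sum>i<n. \<Sum>l<i. w j i * A i l * w j l)"
      by (rule sum_symmetric) (simp add: sym algebra_simps)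
    finally show ?thesis
      by (simp add: loop_free)
  qed
qed

lemma walks_0: "walks 0 = int n"
  by (simp add: walks_def dot_def)

text \<open>
  If \<open>w D\<close> with \<open>D < K\<close> depended on its predecessors modulo
  \<open>2\<close>, these would span all walk vectors, and hence also the \<open>K\<close>
  vectors \<open>g 0, \<dots>, g (K - 1)\<close>, which are independent modulo
  \<open>2\<close>.
\<close>

lemma walk_independent_mod_2:
  assumes d: "\<And>j. j < K \<Longrightarrow> d j = 1" and K: "K \<le> n"
    and q: "\<And>i. i < n \<Longrightarrow> even (\<Sum>k<K. q k * w k i)" and k: "k < K"
  shows "even (q k)"
proof (rule ccontr)
  have parity: "even (x - S)" if "even (S + a * x + T)" "even T" "odd a" for S a x T :: int
    using that by auto
  assume odd: "odd (q k)"
  \<comment> \<open>The last index with an odd coefficient expresses \<open>w D\<close> through its predecessors modulo \<open>2\<close>.\<close>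
  define D where "D = (GREATEST k. k < K \<and> odd (q k))"
  have D: "D < K" "odd (q D)"
    using GreatestI_nat[of "\<lambda>k. k < K \<and> odd (q k)" k K] odd k by (auto simp: D_def)
  have D_max: "even (q j)" if "D < j" "j < K" for j
    using Greatest_le_nat[of "\<lambda>k. k < K \<and> odd (q k)" j K] that by (auto simp: D_def)
  define P where "P x \<longleftrightarrow> (\<exists>s. \<forall>i<n. even (x i - (\<Sum>j<D. s j * w j i)))" for x
  have P_add: "P (\<lambda>i. x i + y i)" if x: "P x" and y: "P y" for x y
  proof -
    from x y obtain s s' where "\<forall>i<n. even (x i - (\<Sum>j<D. s j * w j i))" "\<forall>i<n. even (y i - (\<Sum>j<D. s' j * w j i))"
      by (auto simp: P_def)
    then have "\<forall>i<n. even ((x i + y i) - (\<Sum>j<D. (s j + s' j) * w j i))"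
      by (auto simp: sum.distrib algebra_simps)
    then show ?thesis unfolding P_def by (intro exI[of _ "\<lambda>j. s j + s' j"])
  qed
  have P_mult: "P (\<lambda>i. c * x i)" if x: "P x" for c x
  proof -
    from x obtain s where "\<forall>i<n. even (x i - (\<Sum>j<D. s j * w j i))"
      by (auto simp: P_def)
    then have "\<forall>i<n. even (c * (x i - (\<Sum>j<D. s j * w j i)))"
      by auto
    then have "\<forall>i<n. even (c * x i - (\<Sum>j<D. (c * s j) * w j i))"
      by (simp only: right_diff_distrib sum_distrib_left mult.assoc)
    then show ?thesis unfolding P_def by (intro exI[of _ "\<lambda>j. c * s j"])
  qed
  have P_zero: "P (\<lambda>_. 0)"
    unfolding P_def by (intro exI[of _ "\<lambda>_. 0"]) simp
  have P_sum: "P (\<lambda>i. \<Sum>j\<in>J. c j * x j i)" if "\<And>j. j \<in> J \<Longrightarrow> P (x j)" for J :: "nat set" and c x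
    using that
  proof (induction J rule: infinite_finite_induct)
    case (insert a J)
    then have "P (\<lambda>i. c a * x a i)" "P (\<lambda>i. \<Sum>j\<in>J. c j * x j i)"
      by (auto intro: P_mult)
    then show ?case
      using insert by (simp add: P_add)
  qed (simp_all add: P_zero)
  have P_mod: "P x" if y: "P y" and xy: "\<And>i. i < n \<Longrightarrow> even (x i - y i)" for x y
  proof -
    from y obtain s where s: "\<forall>i<n. even (y i - (\<Sum>j<D. s j * w j i))"
      by (auto simp: P_def)
    have "even (x i - (\<Sum>j<D. s j * w j i))" if i: "i < n" for i
      using xy[OF i] s i by fastforce
    then show ?thesis unfolding P_def by (intro exI[of _ s]) blast
  qed
  have P_less: "P (w j)" if "j < D" for j
  proof -
    have "(\<Sum>l<D. (if l = j then 1 else 0) * w l i) = w j i" for i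
      using that by (subst sum.remove[of _ j]) auto
    then show ?thesis
      unfolding P_def by (intro exI[of _ "\<lambda>l. if l = j then 1 else 0"]) simp
  qed
  have P_D: "P (w D)"
  proof (rule P_mod[OF P_sum[of "{..<D}" w q]])
    fix i assume i: "i < n"
    have K_split: "{..<K} = {..<D} \<union> {D} \<union> {D<..<K}"
      using D(1) by auto
    have "(\<Sum>k<K. q k * w k i) = (\<Sum>k\<in>{..<D} \<union> {D}. q k * w k i) + (\<Sum>k\<in>{D<..<K}. q k * w k i)"
      unfolding K_split by (rule sum.union_disjoint) auto
    also have "(\<Sum>k\<in>{..<D} \<union> {D}. q k * w k i) = (\<Sum>k<D. q k * w k i) + q D * w D i"
      by (subst sum.union_disjoint) auto
    finally have eq: "(\<Sum>k<K. q k * w k i) = (\<Sum>k<D. q k * w k i) + q D * w D i + (\<Sum>k\<in>{D<..<K}. q k * w k i)" .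
    have "even (\<Sum>k\<in>{D<..<K}. q k * w k i)"
      using D_max by (auto intro!: dvd_sum)
    then show "even (w D i - (\<Sum>k<D. q k * w k i))"
      by (rule parity[OF q[OF i, unfolded eq] _ D(2)])
  qed (use P_less in auto)
  have P_app: "P (mat_app n A x)" if x: "P x" for x
  proof -
    from x obtain s where s: "\<forall>i<n. even (x i - (\<Sum>j<D. s j * w j i))"
      by (auto simp: P_def)
    show ?thesis
    proof (rule P_mod[OF P_sum[of "{..<D}" "\<lambda>j. w (Suc j)" s]])
      show "P (w (Suc j))" if "j \<in> {..<D}" for j
        using that P_less[of "Suc j"] P_D by (cases "Suc j = D") auto
      fix i assume "i < n"
      have "mat_app n A x i - (\<Sum>j<D. s j * w (Suc j) i) = mat_app n A (\<lambda>i. x i - (\<Sum>j<D. s j * w j i)) i"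
        by (simp add: mat_app_sum walk_vec_Suc)
      also have "even \<dots>"
        unfolding mat_app_def using s by (auto intro!: dvd_sum)
      finally show "even (mat_app n A x i - (\<Sum>j<D. s j * w (Suc j) i))" .
    qed
  qed
  have P_w: "P (w j)" for j
  proof (induction j)
    case 0
    show ?case using P_less[of 0] P_D by (cases "D = 0") auto
  next
    case (Suc j)
    then show ?case by (simp add: walk_vec_Suc P_app)
  qed
  have "P (g j)" if "j < K" for j
  proof (rule P_mod[OF P_sum[of "{..<n}" w "\<lambda>k. V k j"]])
    show "even (g j i - (\<Sum>k<n. V k j * w k i))" if "i < n" for i
      using g_walk[of j i] d[of j] that \<open>j < K\<close> K by simp
  qed (rule P_w)
  then have "\<forall>j. \<exists>s. j < K \<longrightarrow> (\<forall>i<n. even (g j i - (\<Sum>l<D. s l * w l i)))"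
    unfolding P_def by blast
  then obtain \<sigma> where "\<forall>j. j < K \<longrightarrow> (\<forall>i<n. even (g j i - (\<Sum>l<D. \<sigma> j l * w l i)))"
    unfolding choice_iff by (elim exE)
  then have \<sigma>: "\<And>j i. j < K \<Longrightarrow> i < n \<Longrightarrow> even (g j i - (\<Sum>l<D. \<sigma> j l * w l i))"
    by blast
  have "\<exists>r. (\<forall>i. r i \<in> {0, 1}) \<and> (\<exists>i\<in>{..<K}. r i = 1) \<and> (\<forall>j\<in>{..<D}. even (\<Sum>i<K. r i * \<sigma> i j))"
    by (rule mod_2_dependence) (use D(1) in simp_all)
  then obtain r where r: "\<exists>i\<in>{..<K}. r i = 1" "\<forall>j\<in>{..<D}. even (\<Sum>i<K. r i * \<sigma> i j)"
    by (elim exE conjE)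
  from r(1) obtain i0 where i0: "i0 < K" "r i0 = 1" by auto
  have ev: "even (\<Sum>j<K. r j * g j i)" if "i < n" for i
  proof -
    have "even (\<Sum>j<K. r j * (g j i - (\<Sum>l<D. \<sigma> j l * w l i)))"
      using \<sigma> that by (auto intro!: dvd_sum)
    moreover have "(\<Sum>j<K. r j * (g j i - (\<Sum>l<D. \<sigma> j l * w l i)))
      = (\<Sum>j<K. r j * g j i) - (\<Sum>l<D. (\<Sum>j<K. r j * \<sigma> j l) * w l i)"
    proof -
      have "(\<Sum>j<K. r j * (\<Sum>l<D. \<sigma> j l * w l i)) = (\<Sum>l<D. (\<Sum>j<K. r j * \<sigma> j l) * w l i)"
        unfolding sum_distrib_left sum_distrib_right mult.assoc by (rule sum.swap)
      then show ?thesis by (simp add: right_diff_distrib sum_subtractf)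
    qed
    moreover have "even (\<Sum>l<D. (\<Sum>j<K. r j * \<sigma> j l) * w l i)"
      using r(2) by (auto intro!: dvd_sum)
    ultimately show ?thesis by simp
  qed
  have "even (dot n (f i0) (\<lambda>i. \<Sum>j<K. r j * g j i))"
    unfolding dot_def using ev by (auto intro!: dvd_sum)
  also have "dot n (f i0) (\<lambda>i. \<Sum>j<K. r j * g j i) = (\<Sum>j<K. r j * dot n (f i0) (g j))"
    by (simp add: dot_sum)
  also have "\<dots> = (\<Sum>j<K. if i0 = j then r j else 0)"
    using i0(1) K by (intro sum.cong) (auto simp: dual)
  also have "\<dots> = 1"
    using i0 by simp
  finally show False by simp
qed

end

section \<open>Vectors that are null modulo 2\<close>

text \<open>
  The shape of the Smith normal form as far as the prime \<open>2\<close> is concerned: half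
  of the invariant factors are \<open>1\<close>, and the others are twice an odd number or
  \<open>0\<close>.
\<close>

locale halved_walk_lattice = walk_lattice +
  fixes b :: int
  assumes d_low: "\<And>j. j < (n + 1) div 2 \<Longrightarrow> d j = 1"
    and d_high: "\<And>j. (n + 1) div 2 \<le> j \<Longrightarrow> j < n - 1 \<Longrightarrow> \<exists>c. odd c \<and> c dvd b \<and> d j = 2 * c"
    and odd_b: "odd b"
    and theta_cases: "\<theta> = 0 \<or> \<theta> = -1"
begin

text \<open>
  The indices of walk vectors that form a basis of the null space modulo \<open>2\<close>. For
  odd \<open>n\<close> the index \<open>0\<close> has to be left out, because \<open>e
  \<bullet> e = n\<close> is odd.
\<close>

definition half_range :: "nat set" where
  "half_range = {i. i < (n + 1) div 2 \<and> (even n \<or> i \<noteq> 0)}"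

lemma half_range: "finite half_range" "card half_range = n div 2" "half_range \<subseteq> {..<(n + 1) div 2}"
  "i \<in> half_range \<Longrightarrow> 2 * i < n"
proof -
  show "finite half_range" "half_range \<subseteq> {..<(n + 1) div 2}"
    by (auto simp: half_range_def)
  show "i \<in> half_range \<Longrightarrow> 2 * i < n"
    by (auto simp: half_range_def)
  have "half_range = (if even n then {..<n div 2} else {1..<(n + 1) div 2})"
    by (auto simp: half_range_def)
  then show "card half_range = n div 2"
    by (auto elim: oddE)
qed

definition even_null :: "(nat \<Rightarrow> int) \<Rightarrow> bool" where
  "even_null u \<longleftrightarrow> (\<forall>k. even (dot n (w k) u))"

definition half_coeffs :: "(nat \<Rightarrow> int) \<Rightarrow> bool" where
  "half_coeffs q \<longleftrightarrow> (\<forall>i. q i \<in> {0, 1}) \<and> (\<forall>i. i \<notin> half_range \<longrightarrow> q i = 0)"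

lemma even_null_walk: "i \<in> half_range \<Longrightarrow> even_null (w i)"
  unfolding even_null_def dot_walk_vec
proof
  fix k assume i: "i \<in> half_range"
  show "even (walks (k + i))"
  proof (cases "k + i = 0")
    case True
    then show ?thesis using i by (auto simp: half_range_def walks_0)
  next
    case False
    then show ?thesis by (intro walks_even) simp
  qed
qed

text \<open>
  The walk vectors with index in \<open>half_range\<close> are independent and null modulo
  \<open>2\<close>, and there are as many of them as the dimension \<open>n div 2\<close> of
  the null space, which is the number of even invariant factors.
\<close>

lemma even_null_span:
  assumes u: "even_null u"
  shows "\<exists>q \<beta>. half_coeffs q \<and> (\<forall>i<n. u i = (\<Sum>k<n. q k * w k i) + 2 * \<beta> i)"
proof -
  define K where "K = (n + 1) div 2"
  have K: "K \<le> n" using n_ge_4 by (simp add: K_def)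
  have fin: "finite half_range" and sub: "half_range \<subseteq> {..<K}" and notin: "n \<notin> half_range"
    using half_range half_range(4)[of n] by (auto simp: K_def)
  \<comment> \<open>The vector \<open>u\<close> is appended to the family with index \<open>n\<close>.\<close>
  define X where "X i = (if i = n then u else w i)" for i
  have null: "even (dot n (X i) (g j))" if "i \<in> insert n half_range" "j < K" for i j
  proof -
    have "even_null (X i)"
      using that(1) u even_null_walk by (auto simp: X_def)
    then have "even (d j * dot n (g j) (X i))"
      using that(2) K by (intro dvd_g) (auto simp: even_null_def)
    then show ?thesis
      using d_low[of j] that(2) by (simp add: K_def dot_commute)
  qed
  have "\<exists>r. (\<forall>i. r i \<in> {0, 1}) \<and> (\<exists>i\<in>insert n half_range. r i = 1)
      \<and> (\<forall>j\<in>{K..<n}. even (\<Sum>i\<in>insert n half_range. r i * dot n (X i) (g j)))"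
  proof (rule mod_2_dependence)
    show "card {K..<n} < card (insert n half_range)"
      using fin notin half_range(2) by (simp add: K_def)
  qed (use fin in auto)
  then obtain r where r: "\<forall>i. r i \<in> {0, 1}" "\<exists>i\<in>insert n half_range. r i = 1"
    "\<forall>j\<in>{K..<n}. even (\<Sum>i\<in>insert n half_range. r i * dot n (X i) (g j))"
    by (elim exE conjE)
  define y where "y i = (\<Sum>l\<in>insert n half_range. r l * X l i)" for i
  have dot_y: "dot n y (g j) = (\<Sum>l\<in>insert n half_range. r l * dot n (X l) (g j))" for j
    unfolding y_def by (simp only: dot_sum dot_linear)
  have "even (dot n y (g j))" if "j < n" for j
  proof (cases "j < K")
    case True
    then show ?thesis unfolding dot_y by (intro dvd_sum dvd_mult null)
  next
    case False
    then show ?thesis unfolding dot_y using r(3) that by simp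
  qed
  then have y_even: "even (y i)" if "i < n" for i
    using expand_f[OF that, of y] by (auto intro!: dvd_sum)
  have y_split: "y i = r n * u i + (\<Sum>l\<in>half_range. r l * w l i)" for i
  proof -
    have "(\<Sum>l\<in>half_range. r l * X l i) = (\<Sum>l\<in>half_range. r l * w l i)"
      by (rule sum.cong) (use notin in \<open>auto simp: X_def\<close>)
    then show ?thesis
      unfolding y_def using fin notin by (simp add: X_def)
  qed
  define q where "q l = (if l \<in> half_range then r l else 0)" for l
  have q_sum: "(\<Sum>l<N. q l * w l i) = (\<Sum>l\<in>half_range. r l * w l i)" if "K \<le> N" for N i
  proof -
    have "(\<Sum>l<N. q l * w l i) = (\<Sum>l\<in>half_range. q l * w l i)"
      using sub that fin by (intro sum.mono_neutral_right) (auto simp: q_def)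
    then show ?thesis by (simp add: q_def)
  qed
  have "r n = 1"
  proof (rule ccontr)
    assume "r n \<noteq> 1"
    then have rn: "r n = 0" using r(1) by auto
    then obtain l where l: "l \<in> half_range" "r l = 1"
      using r(2) by auto
    have "even (q l)"
    proof (rule walk_independent_mod_2[OF _ K])
      show "even (\<Sum>k<K. q k * w k i)" if "i < n" for i
        using y_even[OF that] y_split[of i] rn q_sum[of K] by simp
      show "l < K" using l sub by auto
    qed (use d_low in \<open>simp add: K_def\<close>)
    then show False using l by (simp add: q_def)
  qed
  define \<beta> where "\<beta> i = (u i - (\<Sum>k<n. q k * w k i)) div 2" for i
  have "u i = (\<Sum>k<n. q k * w k i) + 2 * \<beta> i" if "i < n" for i
  proof -
    have "even (u i - (\<Sum>k<n. q k * w k i))"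
      using y_even[OF that] \<open>r n = 1\<close> q_sum[OF K, of i] by (simp add: y_split)
    then show ?thesis by (simp add: \<beta>_def)
  qed
  moreover have "half_coeffs q"
    using r(1) by (simp add: half_coeffs_def q_def)
  ultimately have "half_coeffs q \<and> (\<forall>i<n. u i = (\<Sum>k<n. q k * w k i) + 2 * \<beta> i)"
    by simp
  then show ?thesis
    by (intro exI)
qed

lemma funpow_walk_sum:
  "(mat_app n A ^^ k) (\<lambda>i. \<Sum>j<n. q j * w j i) = (\<lambda>i. \<Sum>j<n. q j * w (j + k) i)"
proof (induction k)
  case (Suc k)
  have "(mat_app n A ^^ Suc k) (\<lambda>i. \<Sum>j<n. q j * w j i) = mat_app n A (\<lambda>i. \<Sum>j<n. q j * w (j + k) i)"
    by (simp only: funpow.simps(2) o_apply Suc)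
  also have "\<dots> = (\<lambda>i. \<Sum>j<n. q j * w (j + Suc k) i)"
    by (simp only: mat_app_sum mat_app_linear add_Suc_right walk_vec_Suc)
  finally show ?case .
qed (simp only: funpow_0 add_0_right)

text \<open>
  The mixed terms of the quadratic form carry a factor \<open>2\<close> and an even number of
  walks, so that only the squares remain; and \<open>q i * q i = q i\<close> makes the result
  linear in \<open>q\<close>.
\<close>

lemma quadratic_form_mod_4:
  assumes q: "half_coeffs q" and u: "\<And>i. i < n \<Longrightarrow> u i = (\<Sum>k<n. q k * w k i) + 2 * \<beta> i"
  shows "4 dvd dot n u ((mat_app n A ^^ k) u) - (\<Sum>i<n. q i * walks (2 * i + k))"
proof -
  define x where "x = (\<lambda>i. \<Sum>j<n. q j * w j i)"
  have lin: "(mat_app n A ^^ k) (\<lambda>i. a i + c * b i) = (\<lambda>i. (mat_app n A ^^ k) a i + c * (mat_app n A ^^ k) b i)" for a b c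
    by (induction k) simp_all
  have cong: "(mat_app n A ^^ k) u i = (mat_app n A ^^ k) (\<lambda>i. x i + 2 * \<beta> i) i" if "i < n" for i
  proof (cases k)
    case 0
    then show ?thesis using u[OF that] by (simp add: x_def)
  next
    case (Suc k')
    have "mat_app n A u = mat_app n A (\<lambda>i. x i + 2 * \<beta> i)"
      by (rule mat_app_cong) (simp add: u x_def)
    then show ?thesis by (simp only: Suc funpow_Suc_right o_apply)
  qed
  have "dot n u ((mat_app n A ^^ k) u)
      = dot n (\<lambda>i. x i + 2 * \<beta> i) ((mat_app n A ^^ k) (\<lambda>i. x i + 2 * \<beta> i))"
    by (rule dot_cong) (simp add: u x_def, rule cong)
  also have "\<dots> = dot n x ((mat_app n A ^^ k) x) + 4 * (dot n \<beta> ((mat_app n A ^^ k) x) + dot n \<beta> ((mat_app n A ^^ k) \<beta>))"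
  proof -
    have "dot n x ((mat_app n A ^^ k) \<beta>) = dot n \<beta> ((mat_app n A ^^ k) x)"
      using dot_mat_app_funpow[of k x \<beta>] by (simp add: dot_commute)
    then show ?thesis unfolding lin dot_linear by simp
  qed
  also have "dot n x ((mat_app n A ^^ k) x) = (\<Sum>i<n. \<Sum>j<n. q i * q j * walks (i + j + k))"
    unfolding x_def funpow_walk_sum
    by (simp only: dot_sum dot_linear dot_walk_vec sum_distrib_left add.assoc mult.assoc)
  also have "\<dots> = (\<Sum>i<n. q i * q i * walks (i + i + k)) + 2 * (\<Sum>i<n. \<Sum>j<i. q i * q j * walks (i + j + k))"
    by (rule sum_symmetric) (simp add: algebra_simps)
  also have "(\<Sum>i<n. q i * q i * walks (i + i + k)) = (\<Sum>i<n. q i * walks (2 * i + k))"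
  proof (rule sum.cong[OF refl])
    fix i
    have "q i * q i = q i" using q by (auto simp: half_coeffs_def)
    then show "q i * q i * walks (i + i + k) = q i * walks (2 * i + k)"
      by (simp add: mult_2)
  qed
  finally have eq: "dot n u ((mat_app n A ^^ k) u) - (\<Sum>i<n. q i * walks (2 * i + k))
    = 2 * (\<Sum>i<n. \<Sum>j<i. q i * q j * walks (i + j + k))
      + 4 * (dot n \<beta> ((mat_app n A ^^ k) x) + dot n \<beta> ((mat_app n A ^^ k) \<beta>))"
    by simp
  have "even (\<Sum>i<n. \<Sum>j<i. q i * q j * walks (i + j + k))"
  proof (intro dvd_sum)
    fix i j :: nat assume "j \<in> {..<i}"
    then have "even (walks (i + j + k))"
      by (intro walks_even) auto
    then show "even (q i * q j * walks (i + j + k))" by simp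
  qed
  then obtain s where "(\<Sum>i<n. \<Sum>j<i. q i * q j * walks (i + j + k)) = 2 * s" by blast
  then show ?thesis unfolding eq by simp
qed

end

section \<open>The prime 2\<close>

context halved_walk_lattice begin

lemma in_span_sum_walks: "in_span (\<lambda>i. \<Sum>k<n. q k * w k i)"
  by (rule in_span_sum, rule in_span_mult, rule in_span_walk)

text \<open>
  In coordinates, orthogonality modulo \<open>4\<close> says that \<open>v = 2 * x\<close> up
  to a multiple of \<open>\<xi>\<close>, where \<open>x\<close> is null modulo
  \<open>2\<close>. Null vectors have an even product with \<open>\<xi>\<close>, so the
  multiple of \<open>\<xi>\<close> can be absorbed into \<open>x\<close>. Finally, a null
  vector orthogonal to \<open>\<xi>\<close> is, up to an element of the walk lattice, twice an
  integral vector orthogonal to \<open>\<xi>\<close>, and \<open>2 * b\<close> annihilates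
  such vectors modulo the walk lattice.
\<close>

lemma divisible_by_4_halves:
  assumes v: "in_span v" and v4: "\<And>k. 4 dvd dot n (w k) v"
  shows "\<exists>x. in_span x \<and> (\<forall>i<n. b * v i = 2 * x i)"
proof -
  have dvd_b: "d j dvd 2 * b" if "j < n - 1" for j
    using d_low[of j] d_high[of j] that by (cases "j < (n + 1) div 2") auto
  have vxi: "dot n v \<xi> = 0" using v by (rule in_span_orth_xi)
  define Y where "Y j = dot n v (g j) div 2" for j
  have dY: "even (dot n v (g j)) \<and> even (d j * Y j)" if j: "j < n - 1" for j
  proof -
    have "4 dvd d j * dot n v (g j)"
      using dvd_g[OF v4, of j] j by (simp add: dot_commute)
    show ?thesis
    proof (cases "j < (n + 1) div 2")
      case True
      then show ?thesis using \<open>4 dvd d j * dot n v (g j)\<close> d_low[of j] by (auto simp: Y_def)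
    next
      case False
      then obtain c where c: "odd c" "d j = 2 * c" using d_high[of j] j by auto
      then have "even (c * dot n v (g j))"
        using \<open>4 dvd d j * dot n v (g j)\<close> by (auto simp: mult.assoc dvd_def)
      then show ?thesis using c by auto
    qed
  qed
  define x where "x i = (\<Sum>j<n-1. Y j * f j i)" for i
  define \<kappa> where "\<kappa> = dot n v (g (n - 1)) * \<epsilon>"
  have v_eq: "v i = 2 * x i + \<kappa> * \<xi> i" if "i < n" for i
  proof -
    have "v i = (\<Sum>j<n-1. dot n v (g j) * f j i) + \<kappa> * \<xi> i"
      using expand_f[OF that, of v] f_last[OF that] unfolding sum_split_last by (simp add: \<kappa>_def)
    also have "(\<Sum>j<n-1. dot n v (g j) * f j i) = 2 * x i"
      unfolding x_def sum_distrib_left by (rule sum.cong) (use dY in \<open>auto simp: Y_def\<close>)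
    finally show ?thesis .
  qed
  have gx: "dot n (g l) x = (if l < n - 1 then Y l else 0)" if "l < n" for l
  proof -
    have "dot n (g l) x = (\<Sum>j<n-1. Y j * dot n (f j) (g l))"
      unfolding x_def by (simp add: dot_sum dot_commute[of n "g l"])
    also have "\<dots> = (\<Sum>j<n-1. if j = l then Y j else 0)"
      using that by (intro sum.cong) (auto simp: dual)
    finally show ?thesis by simp
  qed
  have x_null: "even_null x"
    unfolding even_null_def
  proof
    fix k
    have "even (d j * dot n (g j) x)" if "j < n" for j
      using gx[OF that] dY[of j] by simp
    then show "even (dot n (w k) x)"
      by (rule null_all[OF dvd_walk])
  qed
  have even_xi: "even (dot n y \<xi>) \<and> (dot n y \<xi> = 0 \<longrightarrow> in_span (\<lambda>i. b * y i))" if y: "even_null y" for y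
  proof -
    obtain q \<beta> where q: "\<forall>i<n. y i = (\<Sum>k<n. q k * w k i) + 2 * \<beta> i"
      using even_null_span[OF y] by (elim exE conjE)
    have "dot n y \<xi> = dot n (\<lambda>i. (\<Sum>k<n. q k * w k i) + 2 * \<beta> i) \<xi>"
      by (rule dot_cong) (simp_all add: q)
    also have "\<dots> = 2 * dot n \<beta> \<xi>"
      using in_span_orth_xi[OF in_span_sum_walks, of q] by simp
    finally have eq: "dot n y \<xi> = 2 * dot n \<beta> \<xi>" .
    have "in_span (\<lambda>i. b * y i)" if "dot n \<beta> \<xi> = 0"
    proof -
      have "in_span (\<lambda>i. (2 * b) * \<beta> i)"
        by (rule in_span_scaled[OF that]) (simp add: dvd_b)
      then have "in_span (\<lambda>i. b * (\<Sum>k<n. q k * w k i) + (2 * b) * \<beta> i)"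
        by (rule in_span_add[OF in_span_mult[OF in_span_sum_walks]])
      moreover have "b * y i = b * (\<Sum>k<n. q k * w k i) + (2 * b) * \<beta> i" if "i < n" for i
        using q that by (simp add: algebra_simps)
      ultimately show ?thesis
        using in_span_cong[of "\<lambda>i. b * y i" "\<lambda>i. b * (\<Sum>k<n. q k * w k i) + (2 * b) * \<beta> i"] by blast
    qed
    then show ?thesis using eq by simp
  qed
  obtain c where c: "dot n x \<xi> = 2 * c"
    using even_xi[OF x_null] by blast
  have "dot n v \<xi> = dot n (\<lambda>i. 2 * x i + \<kappa> * \<xi> i) \<xi>"
    by (rule dot_cong) (auto simp: v_eq)
  then have \<kappa>: "\<kappa> = - (2 * c)"
    using vxi c by (simp add: xi_norm)
  define x' where "x' i = x i - c * \<xi> i" for i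
  have "even_null x'"
    using x_null unfolding even_null_def x'_def by (simp add: xi_walk)
  moreover have "dot n x' \<xi> = 0"
    unfolding x'_def by (simp add: c xi_norm)
  ultimately have "in_span (\<lambda>i. b * x' i)"
    using even_xi by blast
  moreover have "b * v i = 2 * (b * x' i)" if "i < n" for i
    unfolding v_eq[OF that] by (simp add: x'_def \<kappa> algebra_simps)
  ultimately show ?thesis by (intro exI[of _ "\<lambda>i. b * x' i"]) simp
qed

text \<open>
  The coefficients of \<open>q(x\<^sup>2)\<close>.
\<close>

definition spread :: "(nat \<Rightarrow> int) \<Rightarrow> nat \<Rightarrow> int" where
  "spread q k = (if even k then q (k div 2) else 0)"

lemma sum_spread:
  assumes "half_coeffs q"
  shows "(\<Sum>j<n. q j * w (2 * j) i) = (\<Sum>k<n. spread q k * w k i)"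
proof -
  have q0: "q j = 0" if "\<not> 2 * j < n" for j
    using assms half_range(4)[of j] that by (auto simp: half_coeffs_def)
  have "(\<Sum>j<n. q j * w (2 * j) i) = (\<Sum>j\<in>{j. 2 * j < n}. q j * w (2 * j) i)"
    by (rule sum.mono_neutral_right) (auto simp: q0)
  also have "\<dots> = (\<Sum>k\<in>{k. k < n \<and> even k}. spread q k * w k i)"
    by (rule sum.reindex_bij_witness[of _ "\<lambda>k. k div 2" "\<lambda>j. 2 * j"]) (auto simp: spread_def)
  also have "\<dots> = (\<Sum>k<n. spread q k * w k i)"
    by (rule sum.mono_neutral_left) (auto simp: spread_def)
  finally show ?thesis .
qed

text \<open>
  The vector \<open>v = q(A\<^sup>2) e - \<gamma> e\<close> satisfies \<open>b v = 2 x\<close>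
  with \<open>x\<close> in the walk lattice. Rewriting \<open>v\<close> in terms of the
  independent vectors \<open>w 0, \<dots>, w (n - 2)\<close> shows that its coefficients are
  even; only the coefficient of \<open>w (n - 1)\<close>, which occurs for odd
  \<open>n\<close>, needs the relation. The term with \<open>\<gamma>\<close> serves the
  application to \<open>\<xi>\<close>, whose norm is \<open>2\<close> instead of a multiple of
  \<open>4\<close>.
\<close>

lemma half_coeffs_parity:
  assumes q: "half_coeffs q" and \<gamma>: "even \<gamma>"
    and div4: "\<And>k. 4 dvd (\<Sum>i<n. q i * walks (2 * i + k)) - \<gamma> * walks k"
    and k: "k < n - 1"
  shows "even (spread q k + spread q (n - 1) * m k)"
proof -
  define v where "v i = (\<Sum>j<n. q j * w (2 * j) i) - \<gamma> * w 0 i" for i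
  have "in_span (\<lambda>i. (\<Sum>j<n. q j * w (2 * j) i) + (- \<gamma>) * w 0 i)"
    by (intro in_span_add in_span_sum in_span_mult in_span_walk)
  then have "in_span v"
    unfolding v_def by simp
  moreover have "4 dvd dot n (w k) v" for k
  proof -
    have "dot n (w k) v = (\<Sum>i<n. q i * walks (2 * i + k)) - \<gamma> * walks k"
      unfolding v_def by (simp add: dot_sum dot_walk_vec add.commute del: walk_vec_0)
    then show ?thesis using div4 by simp
  qed
  ultimately have "\<exists>x. in_span x \<and> (\<forall>i<n. b * v i = 2 * x i)"
    by (rule divisible_by_4_halves)
  then obtain x where x: "in_span x" "\<forall>i<n. b * v i = 2 * x i"
    by (elim exE conjE)
  from x(1) obtain r where r: "\<And>i. i < n \<Longrightarrow> x i = (\<Sum>k<n-1. r k * w k i)"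
    by (auto simp: in_span_def)
  define h where "h k = spread q k + spread q (n - 1) * m k - (if k = 0 then \<gamma> else 0)" for k
  have v_h: "v i = (\<Sum>k<n-1. h k * w k i)" if "i < n" for i
  proof -
    have "(\<Sum>k<n-1. (if k = 0 then \<gamma> else 0) * w k i) = \<gamma> * w 0 i"
      using n_ge_4 by (subst sum.remove[of _ 0]) auto
    then have "(\<Sum>k<n-1. h k * w k i)
      = (\<Sum>k<n-1. spread q k * w k i) + spread q (n - 1) * (\<Sum>k<n-1. m k * w k i) - \<gamma> * w 0 i"
      by (simp add: h_def left_diff_distrib distrib_right sum.distrib sum_subtractf sum_distrib_left mult.assoc)
    also have "\<dots> = (\<Sum>k<n. spread q k * w k i) - \<gamma> * w 0 i"
      unfolding sum_split_last relation[OF that] by simp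
    finally show ?thesis
      by (simp add: v_def sum_spread[OF q])
  qed
  have "(\<Sum>k<n-1. (b * h k - 2 * r k) * w k i) = 0" if "i < n" for i
  proof -
    have "(\<Sum>k<n-1. (b * h k - 2 * r k) * w k i) = b * (\<Sum>k<n-1. h k * w k i) - 2 * (\<Sum>k<n-1. r k * w k i)"
      by (simp add: left_diff_distrib sum_subtractf sum_distrib_left mult.assoc)
    then show ?thesis
      using x(2) that by (simp add: v_h[symmetric] r[symmetric])
  qed
  from walk_indep[OF this k] have "b * h k = 2 * r k" by simp
  then have "even (b * h k)" by simp
  then have "even (h k)" using odd_b by simp
  then show ?thesis using \<gamma> by (auto simp: h_def split: if_splits)
qed

text \<open>
  By \<open>half_coeffs_parity\<close>, a nonzero \<open>q\<close> has top coefficient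
  \<open>1\<close> and is then determined by \<open>m\<close>. In this case \<open>m (n -
  2)\<close> is even, which leaves only \<open>\<theta> = 0\<close>. Then \<open>\<xi>\<close>
  satisfies the same conditions up to the term with \<open>\<gamma> = 2\<close>, so it belongs
  to the same \<open>q\<close>. Hence \<open>u\<close> and \<open>\<xi>\<close> agree modulo
  \<open>2\<close>, and their norms agree modulo \<open>4\<close>, although \<open>4\<close>
  divides one and not the other.
\<close>

lemma null_mod_2:
  assumes u: "\<And>k. even (dot n (w k) u)" and u4: "\<And>k. 4 dvd dot n u ((mat_app n A ^^ k) u)"
    and i: "i < n"
  shows "even (u i)"
proof (rule ccontr)
  assume odd: "odd (u i)"
  note parity = half_coeffs_parity
  have determined: "q j = 0" if "half_coeffs q" "\<And>k. k < n - 1 \<Longrightarrow> even (spread q k)" "spread q (n - 1) = 0" for q j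
  proof (cases "2 * j < n")
    case True
    then have "even (spread q (2 * j))"
      using that(2)[of "2 * j"] that(3) by (cases "2 * j = n - 1") auto
    then have "even (q j)" by (simp add: spread_def)
    then show ?thesis using that(1) by (auto simp: half_coeffs_def dest!: spec[of _ j])
  next
    case False
    then show ?thesis using that(1) half_range(4)[of j] by (auto simp: half_coeffs_def)
  qed
  have spread01: "spread q k \<in> {0, 1}" if "half_coeffs q" for q k
    using that by (auto simp: half_coeffs_def spread_def)
  have nonzero: "spread q (n - 1) = 1"
    if q: "half_coeffs q" and x: "\<forall>i<n. x i = (\<Sum>k<n. q k * w k i) + 2 * \<beta> i"
      and par: "\<And>k. k < n - 1 \<Longrightarrow> even (spread q k + spread q (n - 1) * m k)"
      and odd: "odd (x i)" and i: "i < n" for q x \<beta> i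
  proof (rule ccontr)
    assume "spread q (n - 1) \<noteq> 1"
    then have "spread q (n - 1) = 0" using spread01[OF q] by auto
    then have "q j = 0" for j
      using determined[OF q] par by simp
    then show False using odd x i by simp
  qed
  have null: "even_null u" "even_null \<xi>"
    using u by (auto simp: even_null_def xi_walk)
  obtain q \<beta> where q: "half_coeffs q" and q_u: "\<forall>i<n. u i = (\<Sum>k<n. q k * w k i) + 2 * \<beta> i"
    using even_null_span[OF null(1)] by (elim exE conjE)
  have "4 dvd (\<Sum>i<n. q i * walks (2 * i + k)) - 0 * walks k" for k
    using dvd_diff[OF u4[of k] quadratic_form_mod_4[OF q q_u[rule_format], of k]] by simp
  then have q_par: "even (spread q k + spread q (n - 1) * m k)" if "k < n - 1" for k
    using parity[OF q _ _ that, of 0] by simp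
  have q_top: "spread q (n - 1) = 1"
    by (rule nonzero[OF q q_u q_par odd i])
  then have n_odd: "odd n" using n_ge_4 by (auto simp: spread_def split: if_splits)
  have "even (m (n - 2))"
    using q_par[of "n - 2"] n_odd n_ge_4 q_top by (simp add: spread_def)
  then have \<theta>0: "\<theta> = 0" using theta_cases by (auto simp: m_top)
  have A_xi: "dot n \<xi> ((mat_app n A ^^ k) \<xi>) = (if k = 0 then 2 else 0)" for k
  proof (cases k)
    case (Suc k')
    have "dot n \<xi> ((mat_app n A ^^ k) \<xi>) = dot n (mat_app n A \<xi>) ((mat_app n A ^^ k') \<xi>)"
      by (simp add: Suc dot_mat_app)
    also have "\<dots> = dot n (\<lambda>_. 0) ((mat_app n A ^^ k') \<xi>)"
      by (rule dot_cong) (auto simp: xi_eigen \<theta>0)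
    finally show ?thesis by (simp add: Suc)
  qed (simp add: xi_norm)
  obtain q' \<beta>' where q': "half_coeffs q'" and q_xi: "\<forall>i<n. \<xi> i = (\<Sum>k<n. q' k * w k i) + 2 * \<beta>' i"
    using even_null_span[OF null(2)] by (elim exE conjE)
  have "4 dvd (\<Sum>i<n. q' i * walks (2 * i + k)) - 2 * walks k" for k
  proof -
    have "4 dvd dot n \<xi> ((mat_app n A ^^ k) \<xi>) - 2 * walks k"
    proof (cases "k = 0")
      case True
      have "4 dvd 2 - 2 * int n" using n_odd by presburger
      then show ?thesis using True A_xi[of 0] by (simp add: walks_0)
    next
      case False
      then have "even (walks k)" by (intro walks_even) simp
      then show ?thesis using False by (auto simp: A_xi elim!: evenE)
    qed
    from dvd_diff[OF this quadratic_form_mod_4[OF q' q_xi[rule_format], of k]]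
    show ?thesis by (simp add: algebra_simps)
  qed
  then have q'_par: "even (spread q' k + spread q' (n - 1) * m k)" if "k < n - 1" for k
    using parity[OF q' _ _ that, of 2] by simp
  have q'_top: "spread q' (n - 1) = 1"
    by (rule nonzero[OF q' q_xi q'_par _ xi_tau(1)]) (simp_all add: xi_tau(2))
  have "q j = q' j" for j
  proof (cases "2 * j < n")
    case True
    have "even (q j - q' j)"
    proof (cases "2 * j = n - 1")
      case True
      then show ?thesis using q_top q'_top by (simp add: spread_def flip: True)
    next
      case False
      then have "2 * j < n - 1" using True by simp
      from q_par[OF this] q'_par[OF this] show ?thesis
        unfolding q_top q'_top by (auto simp: spread_def)
    qed
    moreover have "q j \<in> {0, 1}" "q' j \<in> {0, 1}" using q q' by (auto simp: half_coeffs_def)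
    ultimately show ?thesis by auto
  next
    case False
    then have "j \<notin> half_range" using half_range(4)[of j] by blast
    then show ?thesis using q q' by (simp add: half_coeffs_def)
  qed
  moreover define \<delta> where "\<delta> i = \<beta> i - \<beta>' i" for i
  ultimately have u_xi: "u i = \<xi> i + 2 * \<delta> i" if "i < n" for i
    using q_u q_xi that by simp
  have "dot n u u = dot n (\<lambda>i. \<xi> i + 2 * \<delta> i) (\<lambda>i. \<xi> i + 2 * \<delta> i)"
    by (rule dot_cong) (auto simp: u_xi)
  also have "\<dots> = 2 + 4 * (dot n \<xi> \<delta> + dot n \<delta> \<delta>)"
    by (simp add: xi_norm dot_commute[of n \<delta> \<xi>])
  finally have "4 dvd 2 + 4 * (dot n \<xi> \<delta> + dot n \<delta> \<delta>)"
    using u4[of 0] by simp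
  then have "(4 :: int) dvd 2"
    by (simp only: dvd_add_left_iff dvd_triv_left)
  then show False by simp
qed

end

section \<open>Characteristic polynomials and walk vectors\<close>

text \<open>
  The bordered matrix with rows \<open>(1, v)\<close> and \<open>(- u, M)\<close> is a product
  of two block triangular matrices, the second of which contains \<open>M + u v\<close>; on
  the other hand, adding multiples of the columns that contain \<open>M\<close> to \<open>det
  M\<close> times its first column makes it block triangular itself. Comparing determinants
  and cancelling \<open>det M\<close> gives the claim.
\<close>

lemma det_add_rank_one:
  fixes M :: "'a :: idom mat"
  assumes M: "M \<in> carrier_mat n n" and u: "u \<in> carrier_mat n 1" and v: "v \<in> carrier_mat 1 n"
    and nz: "det M \<noteq> 0"
  shows "det (M + u * v) = det M + (v * (adj_mat M * u)) $$ (0, 0)"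
proof -
  note adj = adj_mat[OF M]
  define s where "s = (v * (adj_mat M * u)) $$ (0, 0)"
  have au: "adj_mat M * u \<in> carrier_mat n 1" using adj(1) u by simp
  define B where "B = four_block_mat (1\<^sub>m 1) v (- u) M"
  have B: "B \<in> carrier_mat (1 + n) (1 + n)"
    unfolding B_def by (rule four_block_carrier_mat[OF one_carrier_mat M])
  have uv: "M + u * v \<in> carrier_mat n n" using M u v by auto
  have "four_block_mat (1\<^sub>m 1) (0\<^sub>m 1 n) (- u) (1\<^sub>m n) * four_block_mat (1\<^sub>m 1) v (0\<^sub>m n 1) (M + u * v)
    = four_block_mat (1\<^sub>m 1 * 1\<^sub>m 1 + 0\<^sub>m 1 n * 0\<^sub>m n 1) (1\<^sub>m 1 * v + 0\<^sub>m 1 n * (M + u * v))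
       ((- u) * 1\<^sub>m 1 + 1\<^sub>m n * 0\<^sub>m n 1) ((- u) * v + 1\<^sub>m n * (M + u * v))"
    by (rule mult_four_block_mat) (use u v uv in auto)
  also have "\<dots> = B"
  proof -
    have "(- u) * v + (M + u * v) = M"
      by (rule eq_matI) (use M u v in \<open>auto simp: scalar_prod_def\<close>)
    then show ?thesis using u v uv unfolding B_def by auto
  qed
  finally have "det B = det (four_block_mat (1\<^sub>m 1) (0\<^sub>m 1 n) (- u) (1\<^sub>m n))
      * det (four_block_mat (1\<^sub>m 1) v (0\<^sub>m n 1) (M + u * v))"
    using det_mult[of "four_block_mat (1\<^sub>m 1) (0\<^sub>m 1 n) (- u) (1\<^sub>m n)" "1 + n"
        "four_block_mat (1\<^sub>m 1) v (0\<^sub>m n 1) (M + u * v)"] uv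
    by (metis four_block_carrier_mat one_carrier_mat)
  also have "det (four_block_mat (1\<^sub>m 1) (0\<^sub>m 1 n) (- u) (1\<^sub>m n)) = det (1\<^sub>m 1 :: 'a mat) * det (1\<^sub>m n :: 'a mat)"
    by (rule det_four_block_mat_upper_right_zero) (use u in auto)
  also have "det (four_block_mat (1\<^sub>m 1) v (0\<^sub>m n 1) (M + u * v)) = det (1\<^sub>m 1 :: 'a mat) * det (M + u * v)"
    by (rule det_four_block_mat_lower_left_zero) (use v uv in auto)
  finally have det_B: "det B = det (M + u * v)" by simp
  have "B * four_block_mat (det M \<cdot>\<^sub>m 1\<^sub>m 1) (0\<^sub>m 1 n) (adj_mat M * u) (1\<^sub>m n)
    = four_block_mat (1\<^sub>m 1 * (det M \<cdot>\<^sub>m 1\<^sub>m 1) + v * (adj_mat M * u)) (1\<^sub>m 1 * 0\<^sub>m 1 n + v * 1\<^sub>m n)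
       ((- u) * (det M \<cdot>\<^sub>m 1\<^sub>m 1) + M * (adj_mat M * u)) ((- u) * 0\<^sub>m 1 n + M * 1\<^sub>m n)"
    unfolding B_def by (rule mult_four_block_mat) (use u v au M in auto)
  also have "\<dots> = four_block_mat ((det M + s) \<cdot>\<^sub>m 1\<^sub>m 1) v (0\<^sub>m n 1) M"
  proof (rule arg_cong4[where f = four_block_mat])
    have "M * (adj_mat M * u) = det M \<cdot>\<^sub>m u"
      using assoc_mult_mat[OF M adj(1) u] u unfolding adj(2) by (simp add: mult_smult_assoc_mat[OF one_carrier_mat u])
    moreover have "(- u) * (det M \<cdot>\<^sub>m 1\<^sub>m 1) = - (det M \<cdot>\<^sub>m u)"
      by (rule eq_matI) (use u in \<open>auto simp: scalar_prod_def One_nat_def\<close>)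
    ultimately show "(- u) * (det M \<cdot>\<^sub>m 1\<^sub>m 1) + M * (adj_mat M * u) = 0\<^sub>m n 1"
      using u by auto
    show "1\<^sub>m 1 * (det M \<cdot>\<^sub>m 1\<^sub>m 1) + v * (adj_mat M * u) = (det M + s) \<cdot>\<^sub>m 1\<^sub>m 1"
      by (rule eq_matI) (use v au in \<open>auto simp: s_def\<close>)
  qed (use u v M in auto)
  finally have "det B * det (four_block_mat (det M \<cdot>\<^sub>m 1\<^sub>m 1) (0\<^sub>m 1 n) (adj_mat M * u) (1\<^sub>m n))
    = det (four_block_mat ((det M + s) \<cdot>\<^sub>m 1\<^sub>m 1) v (0\<^sub>m n 1) M)"
    using det_mult[OF B, of "four_block_mat (det M \<cdot>\<^sub>m 1\<^sub>m 1) (0\<^sub>m 1 n) (adj_mat M * u) (1\<^sub>m n)"]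
    by (metis four_block_carrier_mat one_carrier_mat smult_carrier_mat)
  also have "det (four_block_mat ((det M + s) \<cdot>\<^sub>m 1\<^sub>m 1) v (0\<^sub>m n 1) M) = det ((det M + s) \<cdot>\<^sub>m (1\<^sub>m 1 :: 'a mat)) * det M"
    by (rule det_four_block_mat_lower_left_zero) (use v M in auto)
  also have "det (four_block_mat (det M \<cdot>\<^sub>m 1\<^sub>m 1) (0\<^sub>m 1 n) (adj_mat M * u) (1\<^sub>m n))
    = det (det M \<cdot>\<^sub>m (1\<^sub>m 1 :: 'a mat)) * det (1\<^sub>m n :: 'a mat)"
    by (rule det_four_block_mat_upper_right_zero) (use au in auto)
  finally have "det B * det M = (det M + s) * det M"
    by simp
  then show ?thesis
    using nz det_B by (simp add: s_def)
qed

definition array_mat :: "nat \<Rightarrow> (nat \<Rightarrow> nat \<Rightarrow> 'a) \<Rightarrow> 'a mat" where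
  "array_mat n A = mat n n (\<lambda>(i, j). A i j)"

lemma array_mat_carrier [simp]: "array_mat n A \<in> carrier_mat n n"
  by (simp add: array_mat_def)

text \<open>
  The \<open>i\<close>-th entry of \<open>adj(x I - A) e\<close>.
\<close>

definition resolvent_poly :: "nat \<Rightarrow> (nat \<Rightarrow> nat \<Rightarrow> int) \<Rightarrow> nat \<Rightarrow> int poly" where
  "resolvent_poly n A i = (\<Sum>j<n. adj_mat (char_poly_matrix (array_mat n A)) $$ (i, j))"

text \<open>
  Row \<open>i\<close> of \<open>(x I - A) adj(x I - A) e = \<chi>(x) e\<close>.
\<close>

lemma resolvent_poly_eq:
  assumes "i < n"
  shows "[:0, 1:] * resolvent_poly n A i - (\<Sum>l<n. [:A i l:] * resolvent_poly n A l) = char_poly (array_mat n A)"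
proof -
  define C where "C = char_poly_matrix (array_mat n A)"
  have C: "C \<in> carrier_mat n n" by (simp add: C_def)
  note adj = adj_mat[OF C]
  have entry: "(\<Sum>l<n. C $$ (i, l) * adj_mat C $$ (l, j)) = (if i = j then det C else 0)" if "j < n" for j
  proof -
    have "(C * adj_mat C) $$ (i, j) = (det C \<cdot>\<^sub>m 1\<^sub>m n) $$ (i, j)"
      by (simp add: adj(2))
    then show ?thesis
      using C adj(1) assms that by (simp add: scalar_prod_def lessThan_atLeast0)
  qed
  have "(\<Sum>l<n. C $$ (i, l) * resolvent_poly n A l) = (\<Sum>l<n. \<Sum>j<n. C $$ (i, l) * adj_mat C $$ (l, j))"
    by (simp add: resolvent_poly_def C_def sum_distrib_left)
  also have "\<dots> = (\<Sum>j<n. \<Sum>l<n. C $$ (i, l) * adj_mat C $$ (l, j))"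
    by (rule sum.swap)
  also have "\<dots> = (\<Sum>j<n. if i = j then det C else 0)"
    by (rule sum.cong) (simp_all add: entry)
  also have "\<dots> = det C"
    using assms by simp
  finally have "(\<Sum>l<n. C $$ (i, l) * resolvent_poly n A l) = char_poly (array_mat n A)"
    by (simp add: char_poly_def C_def)
  moreover have "C $$ (i, l) * resolvent_poly n A l
      = (if l = i then [:0, 1:] * resolvent_poly n A l else 0) - [:A i l:] * resolvent_poly n A l" if "l < n" for l
    using assms that by (simp add: C_def char_poly_matrix_def array_mat_def algebra_simps)
  ultimately show ?thesis
    using assms by (simp add: sum_subtractf)
qed

lemma resolvent_coeff:
  assumes "i < n"
  shows "coeff (resolvent_poly n A i) j = mat_app n A (\<lambda>l. coeff (resolvent_poly n A l) (Suc j)) i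
      + coeff (char_poly (array_mat n A)) (Suc j)"
    and "mat_app n A (\<lambda>l. coeff (resolvent_poly n A l) 0) i + coeff (char_poly (array_mat n A)) 0 = 0"
proof -
  have eq: "coeff (char_poly (array_mat n A)) k
    = (case k of 0 \<Rightarrow> 0 | Suc k' \<Rightarrow> coeff (resolvent_poly n A i) k') - mat_app n A (\<lambda>l. coeff (resolvent_poly n A l) k) i" for k
    unfolding resolvent_poly_eq[OF assms, symmetric]
    by (simp add: coeff_sum mat_app_def coeff_pCons split: nat.split)
  show "coeff (resolvent_poly n A i) j = mat_app n A (\<lambda>l. coeff (resolvent_poly n A l) (Suc j)) i
      + coeff (char_poly (array_mat n A)) (Suc j)"
    using eq[of "Suc j"] by simp
  show "mat_app n A (\<lambda>l. coeff (resolvent_poly n A l) 0) i + coeff (char_poly (array_mat n A)) 0 = 0"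
    using eq[of 0] by simp
qed

lemma char_poly_array_mat: "degree (char_poly (array_mat n A)) = n" "coeff (char_poly (array_mat n A)) n = 1"
  for A :: "nat \<Rightarrow> nat \<Rightarrow> int"
  using degree_monic_char_poly[OF array_mat_carrier] by auto

text \<open>
  The recursion \<open>resolvent_coeff\<close> runs downwards from a degree at which all
  coefficients vanish.
\<close>

lemma resolvent_coeff_walk:
  assumes "i < n"
  shows "coeff (resolvent_poly n A i) j = (\<Sum>l<n-j. coeff (char_poly (array_mat n A)) (Suc j + l) * walk_vec n A l i)"
  using assms
proof -
  define D where "D = n + j + (\<Sum>i<n. Suc (degree (resolvent_poly n A i)))"
  have "j \<le> D" by (simp add: D_def)
  have zero: "coeff (resolvent_poly n A i) D = 0" if "i < n" for i
  proof (rule coeff_eq_0)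
    have "Suc (degree (resolvent_poly n A i)) \<le> (\<Sum>i<n. Suc (degree (resolvent_poly n A i)))"
      using that by (intro member_le_sum) auto
    then show "degree (resolvent_poly n A i) < D" by (simp add: D_def)
  qed
  have "\<forall>i<n. coeff (resolvent_poly n A i) j = (\<Sum>l<n-j. coeff (char_poly (array_mat n A)) (Suc j + l) * walk_vec n A l i)"
    using \<open>j \<le> D\<close>
  proof (induction rule: inc_induct)
    case base
    then show ?case using zero by (simp add: D_def)
  next
    case (step j)
    show ?case
    proof (intro allI impI)
      fix i assume i: "i < n"
      let ?\<chi> = "coeff (char_poly (array_mat n A))"
      have "coeff (resolvent_poly n A i) j
        = mat_app n A (\<lambda>i. \<Sum>l<n-Suc j. ?\<chi> (Suc (Suc j) + l) * walk_vec n A l i) i + ?\<chi> (Suc j)"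
        unfolding resolvent_coeff(1)[OF i, of A j]
        using step.IH by (intro arg_cong2[where f = "(+)"] fun_cong[OF mat_app_cong]) auto
      also have "mat_app n A (\<lambda>i. \<Sum>l<n-Suc j. ?\<chi> (Suc (Suc j) + l) * walk_vec n A l i) i
        = (\<Sum>l<n-Suc j. ?\<chi> (Suc j + Suc l) * walk_vec n A (Suc l) i)"
        by (simp add: mat_app_sum walk_vec_Suc)
      also have "\<dots> + ?\<chi> (Suc j) = (\<Sum>l<n-j. ?\<chi> (Suc j + l) * walk_vec n A l i)"
      proof (cases "j < n")
        case True
        then have "n - j = Suc (n - Suc j)" by simp
        then show ?thesis by (simp add: sum.lessThan_Suc_shift del: sum.lessThan_Suc)
      next
        case False
        then have "?\<chi> (Suc j) = 0" by (intro coeff_eq_0) (simp add: char_poly_array_mat)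
        then show ?thesis using False by simp
      qed
      finally show "coeff (resolvent_poly n A i) j = (\<Sum>l<n-j. ?\<chi> (Suc j + l) * walk_vec n A l i)" .
    qed
  qed
  then show ?thesis using assms by blast
qed

text \<open>
  The Cayley-Hamilton theorem applied to \<open>e\<close>; it is the end of the recursion for
  the coefficients of the resolvent.
\<close>

lemma char_poly_walk:
  assumes "i < n"
  shows "(\<Sum>l\<le>n. coeff (char_poly (array_mat n A)) l * walk_vec n A l i) = (0 :: int)"
proof -
  let ?\<chi> = "coeff (char_poly (array_mat n A))"
  have "mat_app n A (\<lambda>l. coeff (resolvent_poly n A l) 0) i
      = mat_app n A (\<lambda>i. \<Sum>l<n. ?\<chi> (Suc l) * walk_vec n A l i) i"
    by (rule fun_cong[OF mat_app_cong]) (simp add: resolvent_coeff_walk)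
  also have "\<dots> = (\<Sum>l<n. ?\<chi> (Suc l) * walk_vec n A (Suc l) i)"
    by (simp add: mat_app_sum walk_vec_Suc)
  finally show ?thesis
    using resolvent_coeff(2)[OF assms, of A]
    by (simp add: sum.lessThan_Suc_shift lessThan_Suc_atMost[symmetric] del: sum.lessThan_Suc)
qed

section \<open>Walk counts of generalized cospectral graphs and the integral relation\<close>

lemma char_poly_walk_shift:
  assumes "i < n"
  shows "(\<Sum>l\<le>n. coeff (char_poly (array_mat n A)) l * walk_vec n A (l + k) i) = (0 :: int)"
  using assms
proof (induction k arbitrary: i)
  case 0
  then show ?case by (simp add: char_poly_walk)
next
  case (Suc k)
  have "(\<Sum>l\<le>n. coeff (char_poly (array_mat n A)) l * walk_vec n A (l + Suc k) i)
      = mat_app n A (\<lambda>i. \<Sum>l\<le>n. coeff (char_poly (array_mat n A)) l * walk_vec n A (l + k) i) i"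
    by (simp add: mat_app_sum walk_vec_Suc)
  also have "\<dots> = mat_app n A (\<lambda>_. 0) i"
    by (rule fun_cong[OF mat_app_cong]) (rule Suc.IH)
  finally show ?case by (simp add: mat_app_def)
qed

lemma char_poly_add_ones:
  "det (char_poly_matrix (array_mat n A) + mat n n (\<lambda>_. 1)) = char_poly (array_mat n A) + (\<Sum>i<n. resolvent_poly n A i)"
proof -
  let ?C = "char_poly_matrix (array_mat n A)"
  define u :: "int poly mat" where "u = mat n 1 (\<lambda>_. 1)"
  define v :: "int poly mat" where "v = mat 1 n (\<lambda>_. 1)"
  have C: "?C \<in> carrier_mat n n" by simp
  have uv: "u * v = mat n n (\<lambda>_. 1)"
    by (rule eq_matI) (simp_all add: u_def v_def scalar_prod_def)
  have "det ?C \<noteq> 0"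
    using char_poly_array_mat(2)[of n A] unfolding char_poly_def[symmetric] by auto
  from det_add_rank_one[OF C _ _ this, of u v]
  have "det (?C + mat n n (\<lambda>_. 1)) = char_poly (array_mat n A) + (v * (adj_mat ?C * u)) $$ (0, 0)"
    by (simp add: uv char_poly_def) (simp add: u_def v_def)
  also have "(v * (adj_mat ?C * u)) $$ (0, 0) = (\<Sum>i<n. resolvent_poly n A i)"
    using adj_mat(1)[OF C]
    by (simp add: u_def v_def scalar_prod_def resolvent_poly_def lessThan_atLeast0)
  finally show ?thesis .
qed

definition complement_array :: "(nat \<Rightarrow> nat \<Rightarrow> int) \<Rightarrow> nat \<Rightarrow> nat \<Rightarrow> int" where
  "complement_array A i j = (if i = j then 0 else 1 - A i j)"

text \<open>
  The complement has the matrix \<open>J - I - A\<close>, and \<open>(- 1 - t) I - (J - I - A)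
  = - (t I - A + J)\<close>.
\<close>

lemma char_poly_complement:
  assumes "\<And>i. i < n \<Longrightarrow> A i i = 0"
  shows "poly (det (char_poly_matrix (array_mat n A) + mat n n (\<lambda>_. 1))) t
    = (-1) ^ n * poly (char_poly (array_mat n (complement_array A))) (- 1 - t)"
proof -
  define T where "T = mat n n (\<lambda>(i, j). (if i = j then t else 0) - A i j + 1)"
  have "poly (det (char_poly_matrix (array_mat n A) + mat n n (\<lambda>_. 1))) t = det T"
    by (rule poly_det_cong[of _ n]) (auto simp: T_def char_poly_matrix_def array_mat_def)
  moreover have "poly (char_poly (array_mat n (complement_array A))) (- 1 - t) = det ((-1) \<cdot>\<^sub>m T)"
    unfolding char_poly_def
    by (rule poly_det_cong[of _ n]) (auto simp: T_def char_poly_matrix_def array_mat_def complement_array_def assms)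
  ultimately show ?thesis
    by (simp add: T_def mult.assoc[symmetric] power_mult_distrib[symmetric])
qed

text \<open>
  The two spectra determine \<open>e\<^sup>T adj(x I - A) e\<close>. Its coefficients are
  triangular combinations of the walk counts of lengths below \<open>n\<close>, with leading
  coefficient \<open>1\<close>; all further walk counts follow from the recursion given by the
  characteristic polynomial.
\<close>

lemma walks_determined:
  fixes A A' :: "nat \<Rightarrow> nat \<Rightarrow> int"
  assumes A: "\<And>i. i < n \<Longrightarrow> A i i = 0" and A': "\<And>i. i < n \<Longrightarrow> A' i i = 0"
    and eq: "char_poly (array_mat n A) = char_poly (array_mat n A')"
    and eq_c: "char_poly (array_mat n (complement_array A)) = char_poly (array_mat n (complement_array A'))"
  shows "dot n (\<lambda>_. 1) (walk_vec n A k) = dot n (\<lambda>_. 1) (walk_vec n A' k)"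
proof (induction k rule: less_induct)
  case (less k)
  let ?\<chi> = "coeff (char_poly (array_mat n A'))"
  let ?a = "\<lambda>A k. dot n (\<lambda>_. 1) (walk_vec n A k)"
  have "det (char_poly_matrix (array_mat n A) + mat n n (\<lambda>_. 1)) = det (char_poly_matrix (array_mat n A') + mat n n (\<lambda>_. 1))"
    using char_poly_complement[where A = A and n = n, OF A] char_poly_complement[where A = A' and n = n, OF A']
    by (simp add: poly_eq_poly_eq_iff[symmetric] fun_eq_iff eq_c)
  then have res: "(\<Sum>i<n. resolvent_poly n A i) = (\<Sum>i<n. resolvent_poly n A' i)"
    by (simp add: char_poly_add_ones eq)
  have coeff: "coeff (\<Sum>i<n. resolvent_poly n B i) j = (\<Sum>l<n-j. ?\<chi> (Suc j + l) * ?a B l)"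
    if "char_poly (array_mat n B) = char_poly (array_mat n A')" for B j
  proof -
    have "coeff (\<Sum>i<n. resolvent_poly n B i) j = (\<Sum>i<n. \<Sum>l<n-j. ?\<chi> (Suc j + l) * walk_vec n B l i)"
      by (simp add: coeff_sum resolvent_coeff_walk that)
    also have "\<dots> = (\<Sum>l<n-j. \<Sum>i<n. ?\<chi> (Suc j + l) * walk_vec n B l i)"
      by (rule sum.swap)
    finally show ?thesis
      by (simp add: dot_def sum_distrib_left)
  qed
  show ?case
  proof (cases "k < n")
    case True
    define j where "j = n - Suc k"
    have j: "n - j = Suc k" "Suc j + k = n" using True by (auto simp: j_def)
    have *: "coeff (\<Sum>i<n. resolvent_poly n B i) j = (\<Sum>l<k. ?\<chi> (Suc j + l) * ?a B l) + ?a B k"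
      if "char_poly (array_mat n B) = char_poly (array_mat n A')" for B
      using coeff[OF that, of j] char_poly_array_mat(2)[of n A'] unfolding j(1) sum.lessThan_Suc j(2) by simp
    from *[OF eq] *[OF refl] less.IH show ?thesis
      by (simp add: res)
  next
    case False
    define r where "r = k - n"
    have k: "k = n + r" using False by (simp add: r_def)
    have *: "?a B k = - (\<Sum>l<n. ?\<chi> l * ?a B (l + r))" if "char_poly (array_mat n B) = char_poly (array_mat n A')" for B
    proof -
      have "(\<Sum>l\<le>n. ?\<chi> l * ?a B (l + r)) = dot n (\<lambda>_. 1) (\<lambda>i. \<Sum>l\<le>n. ?\<chi> l * walk_vec n B (l + r) i)"
        by (simp add: dot_sum)
      also have "\<dots> = dot n (\<lambda>_. 1) (\<lambda>_. 0)"
        using char_poly_walk_shift[of _ n B r] that by (intro dot_cong) auto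
      finally show ?thesis
        using char_poly_array_mat(2)[of n A'] by (simp add: k lessThan_Suc_atMost[symmetric])
    qed
    from *[OF eq] *[OF refl] show ?thesis
      using less.IH by (simp add: k)
  qed
qed

lemma char_poly_root_eigenvector:
  fixes A :: "nat \<Rightarrow> nat \<Rightarrow> int"
  assumes ev: "\<And>i. i < n \<Longrightarrow> mat_app n A y i = t * y i" and i: "i < n" "y i \<noteq> 0"
  shows "poly (char_poly (array_mat n A)) t = 0"
proof -
  define T where "T = mat n n (\<lambda>(i, j). (if i = j then t else 0) - A i j)"
  have T: "T \<in> carrier_mat n n" by (simp add: T_def)
  have "poly (char_poly (array_mat n A)) t = det T"
    unfolding char_poly_def
    by (rule poly_det_cong[of _ n]) (auto simp: T_def char_poly_matrix_def array_mat_def)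
  also have "det T = 0"
  proof (subst det_0_iff_vec_prod_zero[OF T])
    have "T *\<^sub>v vec n y = 0\<^sub>v n"
    proof (rule eq_vecI)
      fix j assume "j < dim_vec (0\<^sub>v n :: int vec)"
      then have j: "j < n" by simp
      have "(T *\<^sub>v vec n y) $ j = (\<Sum>i<n. (if j = i then t else 0) * y i) - mat_app n A y j"
        using j by (simp add: T_def scalar_prod_def lessThan_atLeast0 left_diff_distrib sum_subtractf mat_app_def)
      also have "(\<Sum>i<n. (if j = i then t else 0) * y i) = t * y j"
        using j by (subst sum.remove[of _ j]) auto
      finally show "(T *\<^sub>v vec n y) $ j = (0\<^sub>v n) $ j"
        using j ev by simp
    qed (simp add: T_def)
    moreover have "vec n y \<noteq> 0\<^sub>v n" using i by (auto simp: vec_eq_iff)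
    ultimately show "\<exists>v. v \<in> carrier_vec n \<and> v \<noteq> 0\<^sub>v n \<and> T *\<^sub>v v = 0\<^sub>v n"
      by (intro exI[of _ "vec n y"]) simp
  qed
  finally show ?thesis .
qed

text \<open>
  The characteristic polynomial of \<open>A\<close> gives a relation of degree
  \<open>n\<close>, from which the factor that belongs to \<open>\<xi>\<close> has to be
  removed. To this end the eigenvalue of \<open>\<xi>\<close> is moved to an integer
  \<open>t\<close> that is not an eigenvalue of \<open>A\<close>, by a matrix \<open>B\<close>
  that agrees with \<open>A\<close> on the orthogonal complement of \<open>\<xi>\<close>. If
  \<open>(x - t) * \<mu>\<close> is the characteristic polynomial of \<open>B\<close>, then
  \<open>(A - t) \<mu>(A) e = 0\<close>, and so \<open>\<mu>(A) e = 0\<close>. Dividing by the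
  monic \<open>x - t\<close> keeps all coefficients integral.
\<close>

lemma monic_relation:
  fixes A :: "nat \<Rightarrow> nat \<Rightarrow> int"
  assumes sym: "\<And>i j. i < n \<Longrightarrow> j < n \<Longrightarrow> A i j = A j i"
    and xi: "\<And>i. i < n \<Longrightarrow> mat_app n A \<xi> i = \<theta> * \<xi> i" and xi_one: "dot n (\<lambda>_. 1) \<xi> = 0"
    and tau: "\<tau> < n" "\<xi> \<tau> = 1"
  obtains m where "\<And>i. i < n \<Longrightarrow> walk_vec n A (n - 1) i = (\<Sum>k<n-1. m k * walk_vec n A k i)"
proof -
  interpret symmetric_array n A by unfold_locales (rule sym)
  note xi_w = eigenvector_orth_walk[OF xi xi_one]
  have n: "0 < n" using tau(1) by simp
  obtain t where t: "poly (char_poly (array_mat n A)) t \<noteq> 0"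
    using char_poly_array_mat(2)[of n A] poly_all_0_iff_0[of "char_poly (array_mat n A)"] by auto
  \<comment> \<open>The vector \<open>\<xi>\<close> is a left eigenvector of \<open>B\<close> for \<open>t\<close>, because \<open>\<xi> \<tau> = 1\<close>.\<close>
  define B where "B i j = A i j + (t - \<theta>) * ((if i = \<tau> then 1 else 0) * \<xi> j)" for i j
  have B_app: "mat_app n B x i = mat_app n A x i + (t - \<theta>) * (if i = \<tau> then 1 else 0) * dot n \<xi> x" for x i
    by (simp add: mat_app_def B_def dot_def distrib_right sum.distrib sum_distrib_left mult.assoc)
  have w_B: "walk_vec n B k = w k" for k
  proof (induction k)
    case (Suc k)
    have "mat_app n B (w k) = mat_app n A (w k)"
      by (rule ext) (simp add: B_app dot_commute[of n \<xi>] xi_w)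
    then show ?case
      by (simp add: walk_vec_Suc Suc)
  qed simp
  have "poly (char_poly (array_mat n (\<lambda>i j. B j i))) t = 0"
  proof (rule char_poly_root_eigenvector[OF _ tau(1), of _ \<xi>])
    fix j assume j: "j < n"
    have "mat_app n (\<lambda>i j. B j i) \<xi> j
        = (\<Sum>i<n. A i j * \<xi> i) + (t - \<theta>) * \<xi> j * (\<Sum>i<n. (if i = \<tau> then 1 else 0) * \<xi> i)"
      by (simp only: mat_app_def B_def distrib_right sum.distrib sum_distrib_left) (simp only: ac_simps)
    also have "(\<Sum>i<n. (if i = \<tau> then 1 else 0) * \<xi> i) = 1"
      using tau by (subst sum.remove[of _ \<tau>]) auto
    also have "(\<Sum>i<n. A i j * \<xi> i) = mat_app n A \<xi> j"
      unfolding mat_app_def using j by (intro sum.cong) (auto simp: sym)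
    finally show "mat_app n (\<lambda>i j. B j i) \<xi> j = t * \<xi> j"
      using xi[OF j] by (simp add: algebra_simps)
  qed (simp add: tau(2))
  also have "array_mat n (\<lambda>i j. B j i) = transpose_mat (array_mat n B)"
    by (rule eq_matI) (simp_all add: array_mat_def)
  finally have "poly (char_poly (array_mat n B)) t = 0"
    by (simp add: char_poly_transpose_mat[OF array_mat_carrier])
  then obtain \<mu> where \<mu>: "char_poly (array_mat n B) = [:- t, 1:] * \<mu>"
    by (auto simp: poly_eq_0_iff_dvd dvd_def)
  have "\<mu> \<noteq> 0" using char_poly_array_mat(2)[of n B] \<mu> by auto
  then have deg: "degree \<mu> = n - 1"
    using char_poly_array_mat(1)[of n B] unfolding \<mu> by (subst (asm) degree_mult_eq) auto
  have lead: "coeff \<mu> (n - 1) = 1"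
  proof -
    have "lead_coeff (char_poly (array_mat n B)) = 1"
      using char_poly_array_mat[of n B] by simp
    then show ?thesis
      unfolding \<mu> lead_coeff_mult deg by simp
  qed
  define y where "y i = (\<Sum>k<n. coeff \<mu> k * w k i)" for i
  have ev: "mat_app n A y i = t * y i" if i: "i < n" for i
  proof -
    have "0 = (\<Sum>l\<le>n. coeff ([:- t, 1:] * \<mu>) l * w l i)"
      using char_poly_walk[OF i, of B] by (simp add: w_B \<mu>)
    also have "\<dots> = (\<Sum>l\<le>n. coeff (pCons 0 \<mu>) l * w l i) - t * (\<Sum>l\<le>n. coeff \<mu> l * w l i)"
      by (simp add: left_diff_distrib sum_subtractf sum_distrib_left mult.assoc)
    also have "(\<Sum>l\<le>n. coeff (pCons 0 \<mu>) l * w l i) = (\<Sum>l<n. coeff \<mu> l * w (Suc l) i)"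
      by (simp add: lessThan_Suc_atMost[symmetric] sum.lessThan_Suc_shift del: sum.lessThan_Suc)
    also have "\<dots> = mat_app n A y i"
      by (simp add: y_def[abs_def] mat_app_sum walk_vec_Suc)
    also have "(\<Sum>l\<le>n. coeff \<mu> l * w l i) = y i"
      using deg n by (simp add: y_def lessThan_Suc_atMost[symmetric] coeff_eq_0)
    finally show ?thesis by simp
  qed
  have "y i = 0" if "i < n" for i
    using char_poly_root_eigenvector[of n A y t, OF ev that] t by blast
  then have "w (n - 1) i = (\<Sum>k<n-1. (- coeff \<mu> k) * w k i)" if "i < n" for i
    using lead n that by (cases n) (simp_all add: y_def sum_negf eq_neg_iff_add_eq_0 add.commute)
  then show ?thesis by (rule that)
qed

section \<open>The rational orthogonal matrix\<close>

lemma walk_vec_of_int: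
  "walk_vec n (\<lambda>i j. of_int (A i j)) k i = (of_int (walk_vec n A k i) :: 'a :: comm_ring_1)"
proof (induction k arbitrary: i)
  case (Suc k)
  then show ?case by (simp add: walk_vec_Suc mat_app_def)
qed simp

lemma dot_self_eq_0:
  fixes x :: "nat \<Rightarrow> 'a :: linordered_idom"
  assumes "dot n x x = 0" "i < n"
  shows "x i = 0"
proof -
  have "\<forall>i\<in>{..<n}. x i * x i = 0"
    using assms(1) unfolding dot_def by (subst (asm) sum_nonneg_eq_0_iff) auto
  then show ?thesis using assms(2) by auto
qed

text \<open>
  The Gram matrix of a frame depends only on the walk counts and on the norm of the last
  vector.
\<close>

lemma transpose_frame_times_frame:
  assumes "symmetric_array n A" and n: "0 < n" and x: "\<And>k. k < n - 1 \<Longrightarrow> dot n (walk_vec n A k) x = 0"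
  shows "transpose_mat (frame_mat n A x) * frame_mat n A x
    = mat n n (\<lambda>(i, j). if i < n - 1 \<and> j < n - 1 then dot n (\<lambda>_. 1) (walk_vec n A (i + j)) else if i = j then dot n x x else 0)"
proof (rule eq_matI)
  interpret symmetric_array n A by fact
  fix i j
  let ?G = "mat n n (\<lambda>(i, j). if i < n - 1 \<and> j < n - 1 then dot n (\<lambda>_. 1) (walk_vec n A (i + j)) else if i = j then dot n x x else 0)"
  assume "i < dim_row ?G" "j < dim_col ?G"
  then have ij: "i < n" "j < n" by simp_all
  have "(transpose_mat (frame_mat n A x) * frame_mat n A x) $$ (i, j)
    = dot n (\<lambda>l. if i < n - 1 then w i l else x l) (\<lambda>l. if j < n - 1 then w j l else x l)"
    using ij by (simp add: frame_mat_def scalar_prod_def dot_def lessThan_atLeast0)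
  also have "\<dots> = ?G $$ (i, j)"
  proof (cases "i < n - 1 \<and> j < n - 1")
    case True
    then show ?thesis using ij by (simp add: dot_walk_vec walks_def)
  next
    case False
    have "i = j" if "\<not> i < n - 1" "\<not> j < n - 1" using ij that by linarith
    with False show ?thesis
      using ij x[of i] x[of j] dot_commute[of n x "w j"] by (cases "i < n - 1"; cases "j < n - 1") auto
  qed
  finally show "(transpose_mat (frame_mat n A x) * frame_mat n A x) $$ (i, j) = ?G $$ (i, j)" .
qed (simp_all add: frame_mat_def)

text \<open>
  Both sides are the determinant of the matrix with last diagonal entry \<open>a * c\<close>.
\<close>

lemma det_gram_scale:
  fixes F :: "nat \<Rightarrow> nat \<Rightarrow> 'a :: idom"
  assumes n: "0 < n"
  shows "det (mat n n (\<lambda>(i, j). if i < n - 1 \<and> j < n - 1 then F i j else if i = j then a else 0)) * c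
       = det (mat n n (\<lambda>(i, j). if i < n - 1 \<and> j < n - 1 then F i j else if i = j then c else 0)) * a"
proof -
  define G where "G a = mat n n (\<lambda>(i, j). if i < n - 1 \<and> j < n - 1 then F i j else if i = j then a else 0)" for a
  define D where "D c = mat n n (\<lambda>(i, j). if i = j then if i = n - 1 then c else 1 else 0)" for c :: 'a
  have det_D: "det (D c) = c" for c
  proof -
    have "det (D c) = prod_list (diag_mat (D c))"
      by (rule det_upper_triangular[of _ n]) (auto simp: D_def upper_triangular_def)
    also have "\<dots> = (\<Prod>i<n. if i = n - 1 then c else 1)"
      by (simp add: prod_list_diag_prod D_def lessThan_atLeast0)
    also have "\<dots> = c"
      using n by (subst prod.remove[of _ "n - 1"]) auto
    finally show ?thesis .
  qed
  have GD: "G a * D c = mat n n (\<lambda>(i, j). if i < n - 1 \<and> j < n - 1 then F i j else if i = j then a * c else 0)" for a c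
  proof (rule eq_matI)
    fix i j
    assume "i < dim_row (mat n n (\<lambda>(i, j). if i < n - 1 \<and> j < n - 1 then F i j else if i = j then a * c else 0))"
      "j < dim_col (mat n n (\<lambda>(i, j). if i < n - 1 \<and> j < n - 1 then F i j else if i = j then a * c else 0))"
    then have ij: "i < n" "j < n" by simp_all
    have "(G a * D c) $$ (i, j) = (\<Sum>l<n. G a $$ (i, l) * (if l = j then if l = n - 1 then c else 1 else 0))"
      using ij by (simp add: G_def D_def scalar_prod_def lessThan_atLeast0)
    also have "\<dots> = G a $$ (i, j) * (if j = n - 1 then c else 1)"
      using ij by (subst sum.remove[of _ j]) auto
    finally show "(G a * D c) $$ (i, j)
      = mat n n (\<lambda>(i, j). if i < n - 1 \<and> j < n - 1 then F i j else if i = j then a * c else 0) $$ (i, j)"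
      using ij by (auto simp: G_def)
  qed (simp_all add: G_def D_def)
  have "det (G a * D c) = det (G c * D a)"
    by (simp only: GD mult.commute[of c a])
  moreover have "det (G a * D c) = det (G a) * det (D c)" for a c
    by (rule det_mult[of _ n]) (simp_all add: G_def D_def)
  ultimately show ?thesis
    by (simp add: det_D) (simp add: G_def)
qed

context walk_lattice begin

text \<open>
  Let \<open>S\<close> be the frame of \<open>A\<close> and \<open>\<xi>\<close>, and
  \<open>S'\<close> the frame of \<open>A'\<close> and a rational vector \<open>x'\<close>
  that is orthogonal to the walk vectors of \<open>A'\<close>. If \<open>x'\<close> has norm
  \<open>2\<close> as well, the two Gram matrices agree, and if the eigenvalues agree, so do
  the matrices of \<open>A\<close> and \<open>A'\<close> with respect to these bases. Then
  \<open>Q = S S'\<^sup>-\<^sup>1\<close> has the required properties.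
\<close>

lemma rational_orthogonal_transfer:
  fixes A' :: "nat \<Rightarrow> nat \<Rightarrow> int"
  assumes sym': "symmetric_array n A'" and loop_free': "\<And>i. i < n \<Longrightarrow> A' i i = 0"
    and walks': "\<And>k. dot n (\<lambda>_. 1) (walk_vec n A' k) = walks k"
  obtains Q :: "rat mat" where "Q \<in> carrier_mat n n" "transpose_mat Q * Q = 1\<^sub>m n"
    "mat n n (\<lambda>(i, j). of_int (A i j)) * Q = Q * mat n n (\<lambda>(i, j). of_int (A' i j))"
    "Q *\<^sub>v vec n (\<lambda>_. 1) = vec n (\<lambda>_. 1)"
proof -
  interpret H: symmetric_array n A' by (fact sym')
  have n: "2 \<le> n" "0 < n" using n_ge_4 by simp_all
  have walks_H: "H.walks = walks"
    by (simp add: fun_eq_iff H.walks_def walks')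
  define W where "W = mat n n (\<lambda>(i, j). w j i)"
  define W' where "W' = mat n n (\<lambda>(i, j). H.w j i)"
  have carr: "W \<in> carrier_mat n n" "W' \<in> carrier_mat n n" by (simp_all add: W_def W'_def)
  have "transpose_mat W * W = transpose_mat W' * W'"
  proof (rule eq_matI)
    fix i j assume "i < dim_row (transpose_mat W' * W')" "j < dim_col (transpose_mat W' * W')"
    then have ij: "i < n" "j < n" by (simp_all add: W'_def)
    have "(transpose_mat W * W) $$ (i, j) = dot n (w i) (w j)"
      "(transpose_mat W' * W') $$ (i, j) = dot n (H.w i) (H.w j)"
      using ij by (simp_all add: W_def W'_def scalar_prod_def dot_def lessThan_atLeast0)
    then show "(transpose_mat W * W) $$ (i, j) = (transpose_mat W' * W') $$ (i, j)"
      by (simp add: dot_walk_vec H.dot_walk_vec walks_H)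
  qed (simp_all add: W_def W'_def)
  then have "det W * det W = det W' * det W'"
    using det_mult[of "transpose_mat W" n W] det_mult[of "transpose_mat W'" n W'] carr
    by (simp add: det_transpose)
  moreover have "det (transpose_mat W) = 0"
  proof (subst det_0_iff_vec_prod_zero)
    have "transpose_mat W *\<^sub>v vec n \<xi> = 0\<^sub>v n"
    proof (rule eq_vecI)
      fix k assume "k < dim_vec (0\<^sub>v n :: int vec)"
      then have k: "k < n" by simp
      then have "(transpose_mat W *\<^sub>v vec n \<xi>) $ k = dot n (w k) \<xi>"
        by (simp add: W_def scalar_prod_def dot_def lessThan_atLeast0)
      then show "(transpose_mat W *\<^sub>v vec n \<xi>) $ k = (0\<^sub>v n) $ k" using k by (simp add: xi_walk)
    qed (simp add: W_def)
    moreover have "vec n \<xi> \<noteq> 0\<^sub>v n" using xi_tau by (auto simp: vec_eq_iff)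
    ultimately show "\<exists>v. v \<in> carrier_vec n \<and> v \<noteq> 0\<^sub>v n \<and> transpose_mat W *\<^sub>v v = 0\<^sub>v n"
      by (intro exI[of _ "vec n \<xi>"]) simp
  qed (use carr in simp)
  ultimately have "det (transpose_mat W') = 0"
    using carr by (simp add: det_transpose)
  then obtain v where v: "v \<in> carrier_vec n" "v \<noteq> 0\<^sub>v n" "transpose_mat W' *\<^sub>v v = 0\<^sub>v n"
    using det_0_iff_vec_prod_zero[of "transpose_mat W'" n] carr by auto
  define \<xi>' where "\<xi>' i = v $ i" for i
  have xi'_walk: "dot n (H.w k) \<xi>' = 0" if "k < n" for k
  proof -
    have "dot n (H.w k) \<xi>' = (transpose_mat W' *\<^sub>v v) $ k"
      using that v(1) by (simp add: W'_def scalar_prod_def dot_def \<xi>'_def lessThan_atLeast0)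
    then show ?thesis using that by (simp add: v(3))
  qed
  define c where "c = dot n \<xi>' \<xi>'"
  have "c \<noteq> 0"
  proof
    assume "c = 0"
    then have "\<xi>' i = 0" if "i < n" for i
      using dot_self_eq_0[of n \<xi>'] that by (simp add: c_def)
    then show False using v(1,2) by (auto simp: \<xi>'_def vec_eq_iff)
  qed
  \<comment> \<open>The norm of the difference of the two sides is the same expression in walk counts as for \<open>A\<close>.\<close>
  have relation': "H.w (n - 1) i = (\<Sum>k<n-1. m k * H.w k i)" if "i < n" for i
  proof -
    define e where "e k = (if k < n - 1 then - m k else 1)" for k
    have split: "(\<Sum>k<n. e k * x k) = x (n - 1) - (\<Sum>k<n-1. m k * x k)" for x :: "nat \<Rightarrow> int"
      unfolding sum_split_last by (simp add: e_def sum_negf)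
    have gram: "dot n (\<lambda>i. \<Sum>k<n. e k * walk_vec n B k i) (\<lambda>i. \<Sum>k<n. e k * walk_vec n B k i)
        = (\<Sum>k<n. \<Sum>l<n. e k * (e l * walks (k + l)))"
      if "\<And>k l. dot n (walk_vec n B k) (walk_vec n B l) = walks (k + l)" for B
      by (simp add: dot_sum that sum_distrib_left)
    have "dot n (\<lambda>i. \<Sum>k<n. e k * w k i) (\<lambda>i. \<Sum>k<n. e k * w k i) = dot n (\<lambda>_. 0) (\<lambda>_. 0)"
      by (rule dot_cong) (simp_all add: split relation)
    then have "dot n (\<lambda>i. \<Sum>k<n. e k * H.w k i) (\<lambda>i. \<Sum>k<n. e k * H.w k i) = 0"
      using gram[of A] gram[of A'] by (simp add: dot_walk_vec H.dot_walk_vec walks_H)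
    from dot_self_eq_0[OF this that] show ?thesis by (simp add: split)
  qed
  define F where "F i j = walks (i + j)" for i j
  define \<Gamma> where "\<Gamma> a = mat n n (\<lambda>(i, j). if i < n - 1 \<and> j < n - 1 then F i j else if i = j then a else 0)" for a
  have gram: "transpose_mat (frame_mat n A \<xi>) * frame_mat n A \<xi> = \<Gamma> 2"
    using transpose_frame_times_frame[OF symmetric_array_axioms n(2), of \<xi>]
    by (simp add: xi_walk xi_norm \<Gamma>_def F_def walks_def cong: if_cong)
  have gram': "transpose_mat (frame_mat n A' \<xi>') * frame_mat n A' \<xi>' = \<Gamma> c"
    using transpose_frame_times_frame[OF sym' n(2), of \<xi>']
    by (simp add: xi'_walk c_def \<Gamma>_def F_def walks' cong: if_cong)
  have "det (frame_mat n A \<xi>) * det (frame_mat n A \<xi>) = det (\<Gamma> 2)"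
    "det (frame_mat n A' \<xi>') * det (frame_mat n A' \<xi>') = det (\<Gamma> c)"
    using det_mult[of "transpose_mat (frame_mat n A \<xi>)" n "frame_mat n A \<xi>"]
      det_mult[of "transpose_mat (frame_mat n A' \<xi>')" n "frame_mat n A' \<xi>'"]
    by (simp_all add: gram gram' det_transpose[OF frame_mat_carrier])
  then have det_sq: "det (frame_mat n A \<xi>) * det (frame_mat n A \<xi>) * c
      = det (frame_mat n A' \<xi>') * det (frame_mat n A' \<xi>') * 2"
    using det_gram_scale[OF n(2), of F 2 c] by (simp add: \<Gamma>_def)
  \<comment> \<open>The square of \<open>\<kappa>\<close> is \<open>c / 2\<close>, so \<open>\<xi>' / \<kappa>\<close> has norm \<open>2\<close>.\<close>
  define \<kappa> :: rat where "\<kappa> = of_int (det (frame_mat n A' \<xi>')) / of_int (det (frame_mat n A \<xi>))"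
  have \<kappa>: "\<kappa> * \<kappa> * 2 = of_int c"
  proof -
    have "rat_of_int (det (frame_mat n A \<xi>) * det (frame_mat n A \<xi>) * c)
      = rat_of_int (det (frame_mat n A' \<xi>') * det (frame_mat n A' \<xi>') * 2)"
      by (simp only: det_sq)
    then show ?thesis using det_frame by (simp add: \<kappa>_def field_simps)
  qed
  then have \<kappa>0: "\<kappa> \<noteq> 0" using \<open>c \<noteq> 0\<close> by auto
  define x' where "x' i = of_int (\<xi>' i) / \<kappa>" for i
  define Ar where "Ar i j = rat_of_int (A i j)" for i j
  define Ar' where "Ar' i j = rat_of_int (A' i j)" for i j
  have w_r: "walk_vec n Ar k i = of_int (w k i)" "walk_vec n Ar' k i = of_int (H.w k i)" for k i
    unfolding Ar_def Ar'_def by (rule walk_vec_of_int)+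
  interpret R: symmetric_array n Ar
    by unfold_locales (simp add: Ar_def sym)
  interpret R': symmetric_array n Ar'
    by unfold_locales (simp add: Ar'_def H.sym)
  have dot_r: "dot n (\<lambda>i. rat_of_int (x i)) (\<lambda>i. rat_of_int (y i)) = of_int (dot n x y)" for x y
    by (simp add: dot_def)
  have x'_walk: "dot n (R'.w k) x' = 0" if "k < n" for k
  proof -
    have "dot n (R'.w k) x' = dot n (\<lambda>i. of_int (H.w k i)) (\<lambda>i. (1 / \<kappa>) * of_int (\<xi>' i))"
      by (rule dot_cong) (simp_all add: w_r x'_def)
    then show ?thesis using xi'_walk[OF that] unfolding dot_linear dot_r by simp
  qed
  have x'_norm: "dot n x' x' = 2"
  proof -
    have "dot n x' x' = dot n (\<lambda>i. (1 / \<kappa>) * of_int (\<xi>' i)) (\<lambda>i. (1 / \<kappa>) * of_int (\<xi>' i))"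
      by (rule dot_cong) (simp_all add: x'_def)
    also have "\<dots> = of_int c / (\<kappa> * \<kappa>)"
      unfolding dot_linear dot_r c_def by simp
    finally show ?thesis using \<kappa>0 by (simp add: \<kappa>[symmetric])
  qed
  define xr where "xr i = rat_of_int (\<xi> i)" for i
  define S where "S = frame_mat n Ar xr"
  define S' where "S' = frame_mat n Ar' x'"
  have carr: "S \<in> carrier_mat n n" "S' \<in> carrier_mat n n" by (simp_all add: S_def S'_def)
  have xr_walk: "dot n (R.w k) xr = 0" for k
  proof -
    have "dot n (R.w k) xr = dot n (\<lambda>i. of_int (w k i)) (\<lambda>i. of_int (\<xi> i))"
      by (rule dot_cong) (simp_all add: w_r xr_def)
    then show ?thesis by (simp add: dot_r xi_walk)
  qed
  have xr_norm: "dot n xr xr = 2"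
    using dot_r[of \<xi> \<xi>] by (simp add: xr_def[abs_def] xi_norm)
  have walks_r: "R.walks k = of_int (walks k)" "R'.walks k = of_int (walks k)" for k
  proof -
    have "R.walks k = dot n (\<lambda>i. of_int 1) (\<lambda>i. of_int (w k i))"
      unfolding R.walks_def by (rule dot_cong) (simp_all add: w_r)
    then show "R.walks k = of_int (walks k)" unfolding dot_r by (simp add: walks_def)
    have "R'.walks k = dot n (\<lambda>i. of_int 1) (\<lambda>i. of_int (H.w k i))"
      unfolding R'.walks_def by (rule dot_cong) (simp_all add: w_r)
    then show "R'.walks k = of_int (walks k)" unfolding dot_r by (simp add: walks')
  qed
  have gram_r: "transpose_mat S * S = transpose_mat S' * S'"
    using transpose_frame_times_frame[OF R.symmetric_array_axioms n(2), of xr]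
      transpose_frame_times_frame[OF R'.symmetric_array_axioms n(2), of x']
    by (simp add: S_def S'_def xr_walk x'_walk xr_norm x'_norm walks_r R.walks_def[symmetric] R'.walks_def[symmetric] cong: if_cong)
  have det_S: "det S \<noteq> 0"
  proof -
    have "S = map_mat rat_of_int (frame_mat n A \<xi>)"
      by (rule eq_matI) (simp_all add: S_def frame_mat_def w_r xr_def)
    then show ?thesis
      using det_frame by (simp add: of_int_hom.hom_det)
  qed
  have det_S': "det S' \<noteq> 0"
  proof -
    have "det S * det S = det S' * det S'"
      using det_mult[of "transpose_mat S" n S] det_mult[of "transpose_mat S'" n S'] carr
      by (simp add: gram_r det_transpose)
    then show ?thesis using det_S by auto
  qed
  \<comment> \<open>Only the multiples of \<open>x'\<close> are orthogonal to the walk vectors, so \<open>x'\<close> is an eigenvector.\<close>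
  define \<mu> where "\<mu> = dot n x' (mat_app n Ar' x') / 2"
  have x'_eigen: "mat_app n Ar' x' i = \<mu> * x' i" if "i < n" for i
  proof (rule ccontr)
    assume neq: "mat_app n Ar' x' i \<noteq> \<mu> * x' i"
    define z where "z = vec n (\<lambda>i. mat_app n Ar' x' i - \<mu> * x' i)"
    have "transpose_mat S' *\<^sub>v z = 0\<^sub>v n"
    proof (rule eq_vecI)
      fix k assume "k < dim_vec (0\<^sub>v n :: rat vec)"
      then have k: "k < n" by simp
      have "(transpose_mat S' *\<^sub>v z) $ k
          = dot n (if k < n - 1 then R'.w k else x') (\<lambda>i. mat_app n Ar' x' i - \<mu> * x' i)"
        using k by (auto simp: S'_def z_def frame_mat_def scalar_prod_def dot_def lessThan_atLeast0 simp del: dot_linear)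
      also have "\<dots> = 0"
      proof (cases "k < n - 1")
        case True
        then have "dot n (R'.w k) (mat_app n Ar' x') = 0"
          using x'_walk[of "Suc k"] by (simp add: R'.dot_walk_vec_Suc)
        then show ?thesis using True x'_walk[OF k] by simp
      next
        case False
        then show ?thesis
          by (simp only: if_False dot_linear x'_norm) (simp add: \<mu>_def)
      qed
      finally show "(transpose_mat S' *\<^sub>v z) $ k = (0\<^sub>v n) $ k" using k by simp
    qed (simp add: S'_def frame_mat_def)
    moreover have "z \<noteq> 0\<^sub>v n" "z \<in> carrier_vec n" using neq that by (auto simp: z_def vec_eq_iff)
    moreover have "det (transpose_mat S') \<noteq> 0" using det_S' carr by (simp add: det_transpose)
    ultimately show False
      using det_0_iff_vec_prod_zero[of "transpose_mat S'" n] carr by auto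
  qed
  define mr where "mr k = rat_of_int (m k)" for k
  have rel: "R.w (n - 1) i = (\<Sum>k<n-1. mr k * R.w k i)" if "i < n" for i
    using arg_cong[OF relation[OF that], of rat_of_int] by (simp add: w_r mr_def)
  have rel': "R'.w (n - 1) i = (\<Sum>k<n-1. mr k * R'.w k i)" if "i < n" for i
    using arg_cong[OF relation'[OF that], of rat_of_int] by (simp add: w_r mr_def)
  have xr_eigen: "mat_app n Ar xr i = of_int \<theta> * xr i" if "i < n" for i
    using arg_cong[OF xi_eigen[OF that], of rat_of_int] by (simp add: mat_app_def Ar_def xr_def)
  define M where "M = mat n n (\<lambda>(i, j). Ar i j)"
  define M' where "M' = mat n n (\<lambda>(i, j). Ar' i j)"
  have M: "M \<in> carrier_mat n n" "M' \<in> carrier_mat n n" by (simp_all add: M_def M'_def)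
  have MS': "M' * S' = S' * companion_mat n mr \<mu>"
    unfolding M'_def S'_def by (rule mat_times_frame[OF n(1) x'_eigen rel'])
  have "(\<Sum>i<n. M' $$ (i, i)) = (\<Sum>i<n. companion_mat n mr \<mu> $$ (i, i))"
    by (rule trace_intertwined[OF M(2) carr(2) _ MS' det_S']) simp
  then have "mr (n - 2) + \<mu> = 0"
    using loop_free' by (simp add: trace_companion[OF n(1)] M'_def Ar'_def)
  then have "\<mu> = of_int \<theta>"
    by (simp add: mr_def m_top)
  define B where "B = companion_mat n mr (of_int \<theta>)"
  have B: "B \<in> carrier_mat n n" by (simp add: B_def)
  have MS: "M * S = S * B"
    unfolding M_def S_def B_def by (rule mat_times_frame[OF n(1) xr_eigen rel])
  have MS': "M' * S' = S' * B"
    using MS' by (simp add: B_def \<open>\<mu> = of_int \<theta>\<close>)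
  define T where "T = (1 / det S') \<cdot>\<^sub>m adj_mat S'"
  have one: "(1 / det S') \<cdot>\<^sub>m (det S' \<cdot>\<^sub>m 1\<^sub>m n) = 1\<^sub>m n"
    by (rule eq_matI) (use det_S' in auto)
  have T: "T \<in> carrier_mat n n" "S' * T = 1\<^sub>m n" "T * S' = 1\<^sub>m n"
    using adj_mat[OF carr(2)] carr one
    by (simp_all add: T_def mult_smult_distrib[OF carr(2) adj_mat(1)[OF carr(2)]]
        mult_smult_assoc_mat[OF adj_mat(1)[OF carr(2)] carr(2)])
  show ?thesis
  proof (rule that[of "S * T"])
    show "S * T \<in> carrier_mat n n" using carr T by simp
    have "transpose_mat (S * T) * (S * T) = transpose_mat T * (transpose_mat S * S) * T"
      using carr T by (simp add: transpose_mult[of S n n T n] assoc_mult_mat[of _ n n _ n _ n])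
    also have "\<dots> = (transpose_mat T * transpose_mat S') * (S' * T)"
      using carr T unfolding gram_r by (simp add: assoc_mult_mat[of _ n n _ n _ n])
    also have "transpose_mat T * transpose_mat S' = 1\<^sub>m n"
      using transpose_mult[of S' n n T n] carr T by simp
    finally show "transpose_mat (S * T) * (S * T) = 1\<^sub>m n"
      using T by simp
    have TM: "T * M' = B * T"
    proof -
      have "T * M' = T * (M' * (S' * T))" using M T by simp
      also have "\<dots> = T * ((M' * S') * T)" using M T carr by (simp add: assoc_mult_mat[of _ n n _ n _ n])
      also have "\<dots> = (T * S') * (B * T)" unfolding MS'
        using B T carr assoc_mult_mat[OF T(1) carr(2), of "B * T" n] by (simp add: assoc_mult_mat[of _ n n _ n _ n])
      finally show ?thesis using B T by simp
    qed
    have "M * (S * T) = (M * S) * T" using M T carr by (simp add: assoc_mult_mat[of _ n n _ n _ n])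
    also have "\<dots> = S * (B * T)" unfolding MS using B T carr by (simp add: assoc_mult_mat[of _ n n _ n _ n])
    also have "\<dots> = (S * T) * M'" unfolding TM[symmetric] using M T carr by (simp add: assoc_mult_mat[of _ n n _ n _ n])
    finally show "mat n n (\<lambda>(i, j). of_int (A i j)) * (S * T) = S * T * mat n n (\<lambda>(i, j). of_int (A' i j))"
      by (simp add: M_def M'_def Ar_def Ar'_def)
    have col: "col S 0 = vec n (\<lambda>_. 1)" "col S' 0 = vec n (\<lambda>_. 1)"
      using n by (auto simp: S_def S'_def frame_mat_def)
    have "(S * T) *\<^sub>v col S' 0 = col ((S * T) * S') 0"
      using n carr T by (intro col_mult2[of _ n n _ n, symmetric]) auto
    also have "(S * T) * S' = S"
      using carr T by (simp add: assoc_mult_mat[of _ n n _ n _ n])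
    finally show "(S * T) *\<^sub>v vec n (\<lambda>_. 1) = vec n (\<lambda>_. 1)"
      by (simp add: col)
  qed
qed

end

section \<open>From rational to integral: permutations\<close>

lemma common_denominator:
  assumes "finite S"
  shows "\<exists>l::nat. 0 < l \<and> (\<forall>x\<in>S. of_nat l * (x :: rat) \<in> \<int>)"
  using assms
proof (induction S)
  case empty
  show ?case by (intro exI[of _ 1]) simp
next
  case (insert x S)
  then obtain l :: nat where l: "0 < l" "\<forall>y\<in>S. of_nat l * y \<in> \<int>" by blast
  obtain a b :: int where ab: "x = of_int a / of_int b" "0 < b"
    by (cases x rule: Rat_cases) (simp add: Fract_of_int_quotient)
  have "of_nat (l * nat b) * y \<in> \<int>" if "y \<in> insert x S" for y
  proof (cases "y = x")
    case True
    have "of_nat (l * nat b) * x = of_int (int l * a)"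
      using ab by simp
    then show ?thesis using True Ints_of_int by metis
  next
    case False
    then have "of_nat l * y \<in> \<int>" using l that by simp
    moreover have "of_nat (l * nat b) * y = of_nat (nat b) * (of_nat l * y)" by simp
    ultimately show ?thesis by (metis Ints_mult Ints_of_nat)
  qed
  then show ?case using l ab by (intro exI[of _ "l * nat b"]) auto
qed

text \<open>
  A column of integers with square sum \<open>1\<close> and sum \<open>1\<close> is a unit
  vector.
\<close>

lemma integral_isometry_permutes:
  fixes Z :: "nat \<Rightarrow> nat \<Rightarrow> int"
  assumes orth: "\<And>i j. i < n \<Longrightarrow> j < n \<Longrightarrow> (\<Sum>l<n. Z l i * Z l j) = (if i = j then 1 else 0)"
    and ones: "\<And>j. j < n \<Longrightarrow> (\<Sum>i<n. Z i j) = 1"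
  shows "\<exists>f. f permutes {0..<n} \<and> (\<forall>i<n. \<forall>j<n. Z i j = (if i = f j then 1 else 0))"
proof -
  have "\<exists>r<n. \<forall>i<n. Z i j = (if i = r then 1 else 0)" if j: "j < n" for j
  proof -
    have "\<exists>r<n. Z r j \<noteq> 0"
    proof (rule ccontr)
      assume "\<not> (\<exists>r<n. Z r j \<noteq> 0)"
      then have "(\<Sum>i<n. Z i j) = 0" by simp
      then show False using ones[OF j] by simp
    qed
    then obtain r where r: "r < n" "Z r j \<noteq> 0" by blast
    have "(\<Sum>l<n. Z l j * Z l j) = Z r j * Z r j + (\<Sum>l\<in>{..<n} - {r}. Z l j * Z l j)"
      using r by (subst sum.remove[of _ r]) auto
    moreover have "1 \<le> Z r j * Z r j"
      using r(2) by (metis mult_eq_0_iff zero_le_square zero_less_iff_neq_zero int_one_le_iff_zero_less order_le_less)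
    moreover have "0 \<le> (\<Sum>l\<in>{..<n} - {r}. Z l j * Z l j)"
      by (intro sum_nonneg) simp
    ultimately have "(\<Sum>l\<in>{..<n} - {r}. Z l j * Z l j) = 0"
      using orth[OF j j] by simp
    then have "\<forall>l\<in>{..<n} - {r}. Z l j * Z l j = 0"
      by (subst (asm) sum_nonneg_eq_0_iff) auto
    then have zero: "Z l j = 0" if "l < n" "l \<noteq> r" for l
      using that by auto
    have "(\<Sum>i<n. Z i j) = Z r j"
      using r zero by (subst sum.remove[of _ r]) auto
    then show ?thesis using ones[OF j] zero r by auto
  qed
  then obtain f where f: "\<And>j. j < n \<Longrightarrow> f j < n" "\<And>i j. i < n \<Longrightarrow> j < n \<Longrightarrow> Z i j = (if i = f j then 1 else 0)"
    by metis
  define h where "h j = (if j < n then f j else j)" for j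
  have "inj_on h {0..<n}"
  proof (rule inj_onI)
    fix i j assume "i \<in> {0..<n}" "j \<in> {0..<n}" "h i = h j"
    then have ij: "i < n" "j < n" "f i = f j" by (auto simp: h_def)
    have "(\<Sum>l<n. Z l i * Z l j) = (\<Sum>l<n. if l = f j then 1 else 0)"
      using ij by (intro sum.cong) (auto simp: f(2))
    also have "\<dots> = 1" using f(1)[OF ij(2)] by simp
    finally show "i = j" using orth[OF ij(1,2)] by (auto split: if_splits)
  qed
  moreover have "h ` {0..<n} \<subseteq> {0..<n}" using f(1) by (auto simp: h_def)
  ultimately have "bij_betw h {0..<n} {0..<n}"
    by (simp add: bij_betw_def endo_inj_surj)
  then have "h permutes {0..<n}"
    by (rule bij_imp_permutes) (simp add: h_def)
  moreover have "Z i j = (if i = h j then 1 else 0)" if "i < n" "j < n" for i j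
    using f(2) that by (simp add: h_def)
  ultimately show ?thesis by blast
qed

text \<open>
  With \<open>L\<close> the least common denominator, \<open>Z = L Q\<close> satisfies
  \<open>Z\<^sup>T Z = L\<^sup>2 I\<close>, \<open>A Z = Z A'\<close> and \<open>Z\<^sup>T w k
  = L w' k\<close>. For a prime factor \<open>p\<close> of \<open>L\<close> the assumption
  \<open>null\<close> applies to all columns of \<open>Z\<close>, and \<open>L div p\<close>
  would be a smaller denominator.
\<close>

lemma rational_transfer_permutation:
  fixes A A' :: "nat \<Rightarrow> nat \<Rightarrow> int" and Q :: "rat mat"
  assumes sym: "symmetric_array n A" and sym': "symmetric_array n A'"
    and Q: "Q \<in> carrier_mat n n" "transpose_mat Q * Q = 1\<^sub>m n"
      "mat n n (\<lambda>(i, j). of_int (A i j)) * Q = Q * mat n n (\<lambda>(i, j). of_int (A' i j))"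
      "Q *\<^sub>v vec n (\<lambda>_. 1) = vec n (\<lambda>_. 1)"
    and null: "\<And>p z i. prime p \<Longrightarrow> (\<And>k. int p dvd dot n (walk_vec n A k) z) \<Longrightarrow>
      (\<And>k. (int p)\<^sup>2 dvd dot n z ((mat_app n A ^^ k) z)) \<Longrightarrow> i < n \<Longrightarrow> int p dvd z i"
  shows "\<exists>f. f permutes {0..<n} \<and> (\<forall>i<n. \<forall>j<n. A' i j = A (f i) (f j))"
proof -
  interpret G: symmetric_array n A by (fact sym)
  interpret H: symmetric_array n A' by (fact sym')
  define q where "q i j = Q $$ (i, j)" for i j
  have orth: "(\<Sum>l<n. q l i * q l j) = (if i = j then 1 else 0)" if "i < n" "j < n" for i j
  proof -
    have "(transpose_mat Q * Q) $$ (i, j) = (\<Sum>l<n. q l i * q l j)"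
      using that Q(1) by (simp add: scalar_prod_def q_def lessThan_atLeast0)
    then show ?thesis using that by (simp add: Q(2))
  qed
  have comm: "(\<Sum>l<n. of_int (A i l) * q l j) = (\<Sum>l<n. q i l * of_int (A' l j))" if "i < n" "j < n" for i j
    using arg_cong[OF Q(3), of "\<lambda>X. X $$ (i, j)"] that Q(1)
    by (simp add: scalar_prod_def q_def lessThan_atLeast0)
  have row: "(\<Sum>j<n. q i j) = 1" if "i < n" for i
    using arg_cong[OF Q(4), of "\<lambda>X. X $ i"] that Q(1)
    by (simp add: scalar_prod_def q_def lessThan_atLeast0)
  have col: "(\<Sum>i<n. q i j) = 1" if j: "j < n" for j
  proof -
    have "(\<Sum>i<n. q i j) = (\<Sum>i<n. q i j * (\<Sum>l<n. q i l))"
      by (rule sum.cong) (simp_all add: row)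
    also have "\<dots> = (\<Sum>l<n. \<Sum>i<n. q i j * q i l)"
      unfolding sum_distrib_left by (rule sum.swap)
    also have "\<dots> = (\<Sum>l<n. if j = l then 1 else 0)"
      by (rule sum.cong) (simp_all add: orth j)
    finally show ?thesis using j by simp
  qed
  define P where "P l \<longleftrightarrow> 0 < l \<and> (\<forall>i<n. \<forall>j<n. of_nat l * q i j \<in> \<int>)" for l :: nat
  have "\<exists>l. P l"
  proof -
    have "finite ((\<lambda>(i, j). q i j) ` ({..<n} \<times> {..<n}))" by simp
    from common_denominator[OF this] obtain l :: nat where
      "0 < l" "\<forall>x\<in>(\<lambda>(i, j). q i j) ` ({..<n} \<times> {..<n}). of_nat l * x \<in> \<int>" by blast
    then show ?thesis unfolding P_def by (intro exI[of _ l]) auto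
  qed
  define L where "L = (LEAST l. P l)"
  have PL: "P L" unfolding L_def using \<open>\<exists>l. P l\<close> by (rule LeastI_ex)
  define Z where "Z i j = \<lfloor>of_nat L * q i j\<rfloor>" for i j
  have Z: "rat_of_int (Z i j) = of_nat L * q i j" if "i < n" "j < n" for i j
    using PL that unfolding P_def Z_def by (metis floor_of_int Ints_cases)
  have Z_orth: "(\<Sum>l<n. Z l i * Z l j) = (if i = j then (int L)\<^sup>2 else 0)" if "i < n" "j < n" for i j
  proof -
    have "rat_of_int (\<Sum>l<n. Z l i * Z l j) = (\<Sum>l<n. (of_nat L)\<^sup>2 * (q l i * q l j))"
      unfolding of_int_sum by (rule sum.cong) (use that in \<open>simp_all add: Z power2_eq_square\<close>)
    also have "\<dots> = rat_of_int (if i = j then (int L)\<^sup>2 else 0)"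
      using that by (simp add: sum_distrib_left[symmetric] orth)
    finally show ?thesis by (simp only: of_int_eq_iff)
  qed
  have Z_comm: "(\<Sum>l<n. A i l * Z l j) = (\<Sum>l<n. Z i l * A' l j)" if "i < n" "j < n" for i j
  proof -
    have "rat_of_int (\<Sum>l<n. A i l * Z l j) = of_nat L * (\<Sum>l<n. of_int (A i l) * q l j)"
      unfolding of_int_sum sum_distrib_left by (rule sum.cong) (use that in \<open>simp_all add: Z\<close>)
    also have "\<dots> = rat_of_int (\<Sum>l<n. Z i l * A' l j)"
      unfolding comm[OF that] of_int_sum sum_distrib_left by (rule sum.cong) (use that in \<open>simp_all add: Z\<close>)
    finally show ?thesis by (simp only: of_int_eq_iff)
  qed
  have Z_col: "(\<Sum>i<n. Z i j) = int L" if "j < n" for j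
  proof -
    have "rat_of_int (\<Sum>i<n. Z i j) = of_nat L * (\<Sum>i<n. q i j)"
      unfolding of_int_sum sum_distrib_left by (rule sum.cong) (use that in \<open>simp_all add: Z\<close>)
    then have "rat_of_int (\<Sum>i<n. Z i j) = rat_of_int (int L)" using that by (simp add: col)
    then show ?thesis by (simp only: of_int_eq_iff)
  qed
  have A_Z: "mat_app n A (\<lambda>i. \<Sum>l<n. Z i l * x l) i = (\<Sum>l<n. Z i l * mat_app n A' x l)" if "i < n" for x i
  proof -
    have "mat_app n A (\<lambda>i. \<Sum>l<n. Z i l * x l) i = (\<Sum>h<n. \<Sum>l<n. A i h * Z h l * x l)"
      by (simp add: mat_app_def sum_distrib_left mult.assoc)
    also have "\<dots> = (\<Sum>l<n. (\<Sum>h<n. A i h * Z h l) * x l)"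
      unfolding sum_distrib_right by (rule sum.swap)
    also have "\<dots> = (\<Sum>l<n. (\<Sum>h<n. Z i h * A' h l) * x l)"
      using that by (intro sum.cong) (simp_all add: Z_comm)
    also have "\<dots> = (\<Sum>h<n. \<Sum>l<n. Z i h * A' h l * x l)"
      unfolding sum_distrib_right by (rule sum.swap)
    finally show ?thesis by (simp add: mat_app_def sum_distrib_left mult.assoc)
  qed
  \<comment> \<open>The powers of \<open>A\<close> act on column \<open>j\<close> of \<open>Z\<close> as the powers of \<open>A'\<close> act on the unit vector \<open>\<delta> j\<close>.\<close>
  define \<delta> where "\<delta> j l = (if l = j then 1 else 0 :: int)" for j l :: nat
  have Z_\<delta>: "(\<Sum>l<n. Z i l * \<delta> j l) = Z i j" if "j < n" for i j
    using that by (subst sum.remove[of _ j]) (auto simp: \<delta>_def)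
  have power: "(mat_app n A ^^ k) (\<lambda>i. Z i j) i = (\<Sum>l<n. Z i l * (mat_app n A' ^^ k) (\<delta> j) l)"
    if "i < n" "j < n" for i j k
    using that(1)
  proof (induction k arbitrary: i)
    case 0
    then show ?case by (simp add: Z_\<delta> that(2))
  next
    case (Suc k)
    have "(mat_app n A ^^ Suc k) (\<lambda>i. Z i j) i
        = mat_app n A (\<lambda>i. \<Sum>l<n. Z i l * (mat_app n A' ^^ k) (\<delta> j) l) i"
      by (simp, rule fun_cong[OF mat_app_cong]) (rule Suc.IH)
    then show ?case using A_Z[OF Suc.prems] by simp
  qed
  have isotropic: "(int L)\<^sup>2 dvd dot n (\<lambda>i. Z i j) ((mat_app n A ^^ k) (\<lambda>i. Z i j))" if j: "j < n" for j k
  proof -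
    have "dot n (\<lambda>i. Z i j) ((mat_app n A ^^ k) (\<lambda>i. Z i j))
        = dot n (\<lambda>i. Z i j) (\<lambda>i. \<Sum>l<n. Z i l * (mat_app n A' ^^ k) (\<delta> j) l)"
      by (rule dot_cong) (simp_all add: power j)
    also have "\<dots> = (\<Sum>l<n. (\<Sum>i<n. Z i j * Z i l) * (mat_app n A' ^^ k) (\<delta> j) l)"
      by (simp add: dot_sum) (simp add: dot_def sum_distrib_right mult.assoc)
    also have "\<dots> = (\<Sum>l<n. (if j = l then (int L)\<^sup>2 else 0) * (mat_app n A' ^^ k) (\<delta> j) l)"
      by (rule sum.cong) (simp_all add: Z_orth j)
    also have "(int L)\<^sup>2 dvd \<dots>" by (intro dvd_sum) simp
    finally show ?thesis .
  qed
  have walk: "dot n (G.w k) (\<lambda>i. Z i j) = int L * H.w k j" if "j < n" for j k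
    using that
  proof (induction k arbitrary: j)
    case 0
    then show ?case by (simp add: dot_def Z_col)
  next
    case (Suc k)
    have "mat_app n A (\<lambda>i. Z i j) i = (\<Sum>l<n. A' l j * Z i l)" if "i < n" for i
      using Z_comm[OF that Suc.prems] by (simp add: mat_app_def mult.commute)
    then have "dot n (G.w (Suc k)) (\<lambda>i. Z i j) = dot n (G.w k) (\<lambda>i. \<Sum>l<n. A' l j * Z i l)"
      unfolding G.dot_walk_vec_Suc by (intro dot_cong) simp_all
    also have "\<dots> = (\<Sum>l<n. A' l j * (int L * H.w k l))"
      by (simp add: dot_sum Suc.IH)
    also have "\<dots> = int L * (\<Sum>l<n. A' j l * H.w k l)"
      unfolding sum_distrib_left using Suc.prems by (intro sum.cong) (simp_all add: H.sym[of _ j])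
    also have "(\<Sum>l<n. A' j l * H.w k l) = H.w (Suc k) j"
      by (simp add: walk_vec_Suc mat_app_def)
    finally show ?case .
  qed
  have "L = 1"
  proof (rule ccontr)
    assume "L \<noteq> 1"
    then obtain p where p: "prime p" "p dvd L" using prime_factor_nat by blast
    then obtain L' where L': "L = p * L'" by blast
    have "int p dvd Z i j" if "i < n" "j < n" for i j
    proof (rule null[OF p(1) _ _ that(1), of "\<lambda>i. Z i j"])
      show "int p dvd dot n (G.w k) (\<lambda>i. Z i j)" for k
        using walk[OF that(2), of k] p(2) by simp
      have "(int p)\<^sup>2 dvd (int L)\<^sup>2" using p(2) by simp
      then show "(int p)\<^sup>2 dvd dot n (\<lambda>i. Z i j) ((mat_app n A ^^ k) (\<lambda>i. Z i j))" for k
        using isotropic[OF that(2)] by (rule dvd_trans)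
    qed
    have "P L'"
    proof -
      have "of_nat L' * q i j \<in> \<int>" if ij: "i < n" "j < n" for i j
      proof -
        obtain y where "Z i j = int p * y" using \<open>\<And>i j. i < n \<Longrightarrow> j < n \<Longrightarrow> int p dvd Z i j\<close>[OF ij] by blast
        then have "of_nat p * (of_nat L' * q i j) = of_nat p * rat_of_int y"
          using Z[OF ij] by (auto simp: L' mult.assoc)
        moreover have "rat_of_nat p \<noteq> 0" using prime_gt_0_nat[OF p(1)] by simp
        ultimately have "of_nat L' * q i j = rat_of_int y" by (metis mult_cancel_left)
        then show ?thesis by simp
      qed
      moreover have "0 < L'" using PL L' by (auto simp: P_def)
      ultimately show ?thesis by (simp add: P_def)
    qed
    then have "L \<le> L'" unfolding L_def by (rule Least_le)
    then show False using PL L' prime_gt_1_nat[OF p(1)] by (auto simp: P_def)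
  qed
  then have "(\<Sum>l<n. Z l i * Z l j) = (if i = j then 1 else 0)" "(\<Sum>i<n. Z i j) = 1" if "i < n" "j < n" for i j
    using Z_orth Z_col that by auto
  then have "\<exists>f. f permutes {0..<n} \<and> (\<forall>i<n. \<forall>j<n. Z i j = (if i = f j then 1 else 0))"
    by (intro integral_isometry_permutes) auto
  then obtain f where f: "f permutes {0..<n}" "\<forall>i<n. \<forall>j<n. Z i j = (if i = f j then 1 else 0)"
    by blast
  have fn: "f j < n" if "j < n" for j
    using permutes_in_image[OF f(1), of j] that by simp
  have "A' i j = A (f i) (f j)" if ij: "i < n" "j < n" for i j
  proof -
    have "(\<Sum>l<n. A (f i) l * Z l j) = A (f i) (f j)"
      using fn[OF ij(2)] f(2) ij by (subst sum.remove[of _ "f j"]) auto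
    moreover have "(\<Sum>l<n. Z (f i) l * A' l j) = A' i j"
      using fn[OF ij(1)] f(2) ij permutes_inj[OF f(1)]
      by (subst sum.remove[of _ i]) (auto simp: inj_eq)
    ultimately show ?thesis using Z_comm[OF fn[OF ij(1)] ij(2)] by simp
  qed
  then show ?thesis using f(1) by blast
qed

section \<open>Smith normal forms as pairs of dual bases\<close>

lemma unimodular_inverse:
  assumes "unimodular n U"
  obtains U' where "U' \<in> carrier_mat n n" "U * U' = 1\<^sub>m n" "U' * U = 1\<^sub>m n"
proof -
  have U: "U \<in> carrier_mat n n" and "\<bar>det U\<bar> = 1" using assms by (auto simp: unimodular_def)
  then have sq: "det U * det U = 1" by (simp add: abs_if split: if_splits)
  note adj = adj_mat[OF U]
  have one: "det U \<cdot>\<^sub>m (det U \<cdot>\<^sub>m 1\<^sub>m n) = 1\<^sub>m n"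
    by (rule eq_matI) (use sq in auto)
  show ?thesis
  proof (rule that[of "det U \<cdot>\<^sub>m adj_mat U"])
    show "U * (det U \<cdot>\<^sub>m adj_mat U) = 1\<^sub>m n"
      by (simp add: mult_smult_distrib[OF U adj(1)] adj(2) one)
    show "det U \<cdot>\<^sub>m adj_mat U * U = 1\<^sub>m n"
      by (simp add: mult_smult_assoc_mat[OF adj(1) U] adj(3) one)
  qed (use adj(1) in simp)
qed

lemma SNF_basis:
  assumes "is_SNF n M D"
  obtains f g V V' where "snf_basis n (\<lambda>k i. M $$ (i, k)) (\<lambda>j. D $$ (j, j)) f g V V'"
proof -
  from assms obtain U Vm where U: "unimodular n U" and V: "unimodular n Vm" and D_eq: "D = U * M * Vm"
    and carr: "M \<in> carrier_mat n n" "D \<in> carrier_mat n n" and diag: "diagonal_mat D"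
    by (auto simp: is_SNF_def)
  from unimodular_inverse[OF U] obtain U' where U': "U' \<in> carrier_mat n n" "U * U' = 1\<^sub>m n" "U' * U = 1\<^sub>m n" .
  from unimodular_inverse[OF V] obtain V' where V': "V' \<in> carrier_mat n n" "Vm * V' = 1\<^sub>m n" "V' * Vm = 1\<^sub>m n" .
  have UV: "U \<in> carrier_mat n n" "Vm \<in> carrier_mat n n" using U V by (auto simp: unimodular_def)
  have U'D: "U' * D = M * Vm"
  proof -
    have "U' * D = U' * (U * (M * Vm))"
      unfolding D_eq using UV carr by (simp add: assoc_mult_mat[of _ n n _ n _ n])
    also have "\<dots> = (U' * U) * (M * Vm)"
      using U'(1) UV carr by (intro assoc_mult_mat[symmetric]) auto
    finally show ?thesis using U'(3) UV carr by simp
  qed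
  have M_eq: "M = U' * D * V'"
    unfolding U'D using UV carr V' by (simp add: assoc_mult_mat[of _ n n _ n _ n])
  have D_entry: "D $$ (i, j) = 0" if "i < n" "j < n" "i \<noteq> j" for i j
    using diag carr that by (auto simp: diagonal_mat_def)
  have UU: "(\<Sum>k<n. U $$ (i, k) * U' $$ (k, j)) = (if i = j then 1 else 0)" if "i < n" "j < n" for i j
    using arg_cong[OF U'(2), of "\<lambda>X. X $$ (i, j)"] that UV U'(1)
    by (simp add: scalar_prod_def lessThan_atLeast0)
  have U'U: "(\<Sum>k<n. U' $$ (i, k) * U $$ (k, j)) = (if i = j then 1 else 0)" if "i < n" "j < n" for i j
    using arg_cong[OF U'(3), of "\<lambda>X. X $$ (i, j)"] that UV U'(1)
    by (simp add: scalar_prod_def lessThan_atLeast0)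
  have U'D_entry: "(U' * D) $$ (i, j) = U' $$ (i, j) * D $$ (j, j)" if "i < n" "j < n" for i j
  proof -
    have "(U' * D) $$ (i, j) = (\<Sum>k<n. U' $$ (i, k) * D $$ (k, j))"
      using that U'(1) carr by (simp add: scalar_prod_def lessThan_atLeast0)
    also have "\<dots> = U' $$ (i, j) * D $$ (j, j)"
      using that by (subst sum.remove[of _ j]) (auto simp: D_entry)
    finally show ?thesis .
  qed
  show ?thesis
  proof (rule that[of "\<lambda>j i. U $$ (j, i)" "\<lambda>j i. U' $$ (i, j)" "\<lambda>k j. Vm $$ (k, j)" "\<lambda>k j. V' $$ (j, k)"], unfold_locales)
    fix x :: "nat \<Rightarrow> int" and i assume i: "i < n"
    have "(\<Sum>j<n. dot n x (\<lambda>i. U' $$ (i, j)) * U $$ (j, i)) = (\<Sum>j<n. \<Sum>k<n. x k * (U' $$ (k, j) * U $$ (j, i)))"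
      by (simp add: dot_def sum_distrib_right mult.assoc)
    also have "\<dots> = (\<Sum>k<n. x k * (\<Sum>j<n. U' $$ (k, j) * U $$ (j, i)))"
      unfolding sum_distrib_left by (rule sum.swap)
    also have "\<dots> = (\<Sum>k<n. x k * (if k = i then 1 else 0))"
      by (rule sum.cong) (simp_all add: U'U i)
    also have "\<dots> = x i" using i by (subst sum.remove[of _ i]) auto
    finally show "x i = (\<Sum>j<n. dot n x (\<lambda>i. U' $$ (i, j)) * U $$ (j, i))" by simp
    have "(\<Sum>j<n. dot n x (\<lambda>i. U $$ (j, i)) * U' $$ (i, j)) = (\<Sum>j<n. \<Sum>k<n. x k * (U' $$ (i, j) * U $$ (j, k)))"
      unfolding dot_def sum_distrib_right by (intro sum.cong refl) (simp only: ac_simps)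
    also have "\<dots> = (\<Sum>k<n. x k * (\<Sum>j<n. U' $$ (i, j) * U $$ (j, k)))"
      unfolding sum_distrib_left by (rule sum.swap)
    also have "\<dots> = (\<Sum>k<n. x k * (if i = k then 1 else 0))"
      by (rule sum.cong) (simp_all add: U'U i)
    also have "\<dots> = x i" using i by (subst sum.remove[of _ i]) auto
    finally show "x i = (\<Sum>j<n. dot n x (\<lambda>i. U $$ (j, i)) * U' $$ (i, j))" by simp
  next
    fix i j assume "i < n" "j < n"
    then show "dot n (\<lambda>k. U $$ (i, k)) (\<lambda>i. U' $$ (i, j)) = (if i = j then 1 else 0)"
      by (simp add: dot_def UU)
  next
    fix j i assume ij: "j < n" "i < n"
    have "(M * Vm) $$ (i, j) = (\<Sum>k<n. Vm $$ (k, j) * M $$ (i, k))"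
      using ij carr UV by (simp add: scalar_prod_def lessThan_atLeast0 mult.commute)
    then show "D $$ (j, j) * U' $$ (i, j) = (\<Sum>k<n. Vm $$ (k, j) * M $$ (i, k))"
      using U'D_entry[OF ij(2,1)] by (simp add: U'D mult.commute)
  next
    fix k i assume ki: "k < n" "i < n"
    have "(X * V') $$ (i, k) = (\<Sum>j<n. X $$ (i, j) * V' $$ (j, k))" if "X \<in> carrier_mat n n" for X
      using ki that V'(1) by (simp add: scalar_prod_def lessThan_atLeast0)
    from this[OF mult_carrier_mat[OF U'(1) carr(2)]]
    have "(U' * D * V') $$ (i, k) = (\<Sum>j<n. (U' * D) $$ (i, j) * V' $$ (j, k))" .
    then show "M $$ (i, k) = (\<Sum>j<n. D $$ (j, j) * V' $$ (j, k) * U' $$ (i, j))"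
      using ki by (simp add: M_eq[symmetric] U'D_entry ac_simps)
  qed
qed

text \<open>
  If \<open>p\<close> does not divide \<open>d' (n - 2)\<close>, it divides none of the
  preceding \<open>d' j\<close> either, and the second basis shows that the null space modulo
  \<open>p\<close> is at most a line; but \<open>f (n - 2)\<close> and \<open>f (n -
  1)\<close> are null and independent modulo \<open>p\<close>. This comparison of two diagonal
  forms of the same matrix takes the place of uniqueness of the Smith normal form.
\<close>

lemma prime_dvd_penultimate_invariant:
  assumes 1: "snf_basis n M d f g V V'" and 2: "snf_basis n M d' f' g' Y Y'"
    and n: "2 \<le> n" and p: "prime (p :: int)" and d: "p dvd d (n - 2)" "p dvd d (n - 1)"
    and chain: "\<And>j. j < n - 1 \<Longrightarrow> d' j dvd d' (n - 2)"
  shows "p dvd d' (n - 2)"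
proof (rule ccontr)
  assume not: "\<not> p dvd d' (n - 2)"
  interpret B: snf_basis n M d f g V V' by (fact 1)
  interpret C: snf_basis n M d' f' g' Y Y' by (fact 2)
  define F where "F = f' (n - 1)"
  have null: "p dvd dot n (M k) (f l)" if "l < n" "p dvd d l" "k < n" for k l
  proof (rule B.dvd_walk[OF _ that(3)])
    show "p dvd d j * dot n (g j) (f l)" if "j < n" for j
      using that \<open>l < n\<close> \<open>p dvd d l\<close> by (cases "j = l") (simp_all add: dot_commute[of n "g j"] B.dual)
  qed
  have mult: "p dvd dot n x y - dot n x (g' (n - 1)) * dot n F y" if x: "\<And>k. k < n \<Longrightarrow> p dvd dot n (M k) x" for x y
  proof -
    have "p dvd dot n x (g' j)" if j: "j < n - 1" for j
    proof -
      have "p dvd d' j * dot n (g' j) x" using x j by (intro C.dvd_g) auto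
      moreover have "\<not> p dvd d' j" using chain[OF j] not dvd_trans by blast
      ultimately show ?thesis using p by (auto simp: prime_dvd_mult_iff dot_commute)
    qed
    then have "p dvd (\<Sum>j<n-1. dot n x (g' j) * dot n (f' j) y)"
      by (intro dvd_sum) simp
    moreover have "dot n x y = (\<Sum>j<n. dot n x (g' j) * dot n (f' j) y)"
    proof -
      have "dot n x y = dot n (\<lambda>i. \<Sum>j<n. dot n x (g' j) * f' j i) y"
        by (rule dot_cong) (rule C.expand_f, auto)
      then show ?thesis by (simp add: dot_sum)
    qed
    moreover have "(\<Sum>j<n. h j) = (\<Sum>j<n-1. h j) + h (n - 1)" for h :: "nat \<Rightarrow> int"
      using n by (cases n) simp_all
    ultimately show ?thesis by (simp add: F_def)
  qed
  have n': "n - 2 < n" "n - 1 < n" "n - 1 \<noteq> n - 2" "n - 2 \<noteq> n - 1" using n by auto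
  define a where "a = dot n (f (n - 2)) (g' (n - 1))"
  define c where "c = dot n (f (n - 1)) (g' (n - 1))"
  have "p dvd 1 - a * dot n F (g (n - 2))"
    using mult[of "f (n - 2)" "g (n - 2)"] null[OF n'(1) d(1)] n' by (simp add: B.dual a_def)
  moreover have "p dvd 0 - c * dot n F (g (n - 2))" "p dvd 1 - c * dot n F (g (n - 1))"
    using mult[of "f (n - 1)" "g (n - 2)"] mult[of "f (n - 1)" "g (n - 1)"] null[OF n'(2) d(2)] n'
    by (simp_all add: B.dual c_def)
  moreover have not1: "\<not> p dvd 1" using p not_prime_unit by blast
  ultimately have "\<not> p dvd c" "\<not> p dvd dot n F (g (n - 2))" "p dvd c * dot n F (g (n - 2))"
    by (auto simp: dvd_diff_left_iff dvd_diff_right_iff)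
  then show False using p by (simp add: prime_dvd_mult_iff)
qed

section \<open>Graphs as symmetric arrays\<close>

definition adj_entry :: "nat set set \<Rightarrow> nat \<Rightarrow> nat \<Rightarrow> int" where
  "adj_entry E i j = (if {i, j} \<in> E then 1 else 0)"

lemma adjacency_mat_eq: "adjacency_mat n E = array_mat n (adj_entry E)"
  by (simp add: adjacency_mat_def array_mat_def adj_entry_def)

lemma adj_sym: "adj_entry E i j = adj_entry E j i"
  by (simp add: adj_entry_def insert_commute)

lemma adj_symmetric_array: "symmetric_array n (adj_entry E)"
  by unfold_locales (rule adj_sym)

lemma simple_graph_loop_free: "simple_graph n E \<Longrightarrow> {i} \<notin> E"
  by (auto simp: simple_graph_def all_edges_def doubleton_eq_iff)

lemma adj_loop_free: "simple_graph n E \<Longrightarrow> adj_entry E i i = 0"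
  by (simp add: adj_entry_def simple_graph_loop_free)

lemma array_mat_power_mult_vec: "(array_mat n A ^\<^sub>m k) *\<^sub>v vec n x = vec n ((mat_app n A ^^ k) x)"
  for A :: "nat \<Rightarrow> nat \<Rightarrow> 'a :: comm_ring_1"
proof (induction k arbitrary: x)
  case 0
  then show ?case by (simp add: array_mat_def)
next
  case (Suc k)
  have "array_mat n A *\<^sub>v vec n x = vec n (mat_app n A x)"
    by (rule eq_vecI) (simp_all add: array_mat_def mat_app_def scalar_prod_def lessThan_atLeast0)
  moreover have "(array_mat n A ^\<^sub>m k * array_mat n A) *\<^sub>v vec n x = array_mat n A ^\<^sub>m k *\<^sub>v (array_mat n A *\<^sub>v vec n x)"
    by (rule assoc_mult_mat_vec[of _ n n _ n]) (simp_all add: pow_carrier_mat)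
  ultimately show ?case
    by (simp add: Suc funpow_swap1)
qed

lemma walk_mat_entry: "i < n \<Longrightarrow> k < n \<Longrightarrow> walk_mat n E $$ (i, k) = walk_vec n (adj_entry E) k i"
  by (simp add: walk_mat_def mat_of_cols_index all_ones_def adjacency_mat_eq array_mat_power_mult_vec walk_vec_def)

lemma walk_mat_carrier: "walk_mat n E \<in> carrier_mat n n"
  unfolding walk_mat_def by (rule carrier_matI) simp_all

lemma complement_adjacency:
  "simple_graph n E \<Longrightarrow> adjacency_mat n (complement_graph n E) = array_mat n (complement_array (adj_entry E))"
  unfolding adjacency_mat_def array_mat_def
  by (rule cong_mat) (auto simp: complement_graph_def complement_array_def adj_entry_def all_edges_def doubleton_eq_iff)

lemma spectrum_determines_char_poly:
  assumes "A \<in> carrier_mat n n" "B \<in> carrier_mat n n" and eq: "spectrum_mset A = spectrum_mset B"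
  shows "char_poly A = char_poly B"
proof -
  have "lead_coeff (char_poly (map_mat of_int M :: complex mat)) = 1" if "M \<in> carrier_mat n n" for M
    using degree_monic_char_poly[of "map_mat of_int M :: complex mat" n] that by simp
  then have dec: "char_poly (map_mat of_int M) = (\<Prod>x\<in>#spectrum_mset M. [:- x, 1:])" if "M \<in> carrier_mat n n" for M
    using complex_poly_decompose_multiset[of "char_poly (map_mat of_int M :: complex mat)"] that
    by (simp add: spectrum_mset_def)
  have "map_poly of_int (char_poly A) = (map_poly of_int (char_poly B) :: complex poly)"
    using dec assms by (simp flip: of_int_hom.char_poly_hom[of _ n])
  then show ?thesis
    by (metis of_int_poly_hom.injectivity)
qed

lemma gen_cospectral_walks:
  assumes "simple_graph n E" "simple_graph n E'" "gen_cospectral n E' E"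
  shows "dot n (\<lambda>_. 1) (walk_vec n (adj_entry E') k) = dot n (\<lambda>_. 1) (walk_vec n (adj_entry E) k)"
proof (rule walks_determined)
  show "char_poly (array_mat n (adj_entry E')) = char_poly (array_mat n (adj_entry E))"
    using assms(3) by (intro spectrum_determines_char_poly[of _ n]) (simp_all add: gen_cospectral_def adjacency_mat_eq)
  show "char_poly (array_mat n (complement_array (adj_entry E'))) = char_poly (array_mat n (complement_array (adj_entry E)))"
    using assms by (intro spectrum_determines_char_poly[of _ n])
      (simp_all add: gen_cospectral_def complement_adjacency)
qed (use assms in \<open>auto intro: adj_loop_free\<close>)

section \<open>Orbits and twins\<close>

lemma automorphisms_iff:
  "f \<in> automorphisms n E
    \<longleftrightarrow> f permutes {0..<n} \<and> (\<forall>u<n. \<forall>v<n. {u, v} \<in> E \<longleftrightarrow> {f u, f v} \<in> E)"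
  unfolding automorphisms_def is_graph_iso_def mem_Collect_eq ..

lemma automorphisms_id: "id \<in> automorphisms n E"
  by (simp add: automorphisms_iff permutes_id)

lemma automorphisms_comp:
  assumes "f \<in> automorphisms n E" "h \<in> automorphisms n E"
  shows "f \<circ> h \<in> automorphisms n E"
proof -
  from assms have f: "f permutes {0..<n}" "\<And>u v. u < n \<Longrightarrow> v < n \<Longrightarrow> {u, v} \<in> E \<longleftrightarrow> {f u, f v} \<in> E"
    and h: "h permutes {0..<n}" "\<And>u v. u < n \<Longrightarrow> v < n \<Longrightarrow> {u, v} \<in> E \<longleftrightarrow> {h u, h v} \<in> E"
    unfolding automorphisms_iff by blast+
  have "h u < n" if "u < n" for u
    using permutes_in_image[OF h(1), of u] that by simp
  then have "{u, v} \<in> E \<longleftrightarrow> {(f \<circ> h) u, (f \<circ> h) v} \<in> E" if "u < n" "v < n" for u v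
    unfolding o_apply using h(2)[OF that] f(2)[of "h u" "h v"] that by blast
  then show ?thesis
    unfolding automorphisms_iff using permutes_compose[OF h(1) f(1)] by blast
qed

lemma automorphisms_inv:
  assumes "f \<in> automorphisms n E"
  shows "inv_into UNIV f \<in> automorphisms n E"
proof -
  from assms have f: "f permutes {0..<n}" "\<And>u v. u < n \<Longrightarrow> v < n \<Longrightarrow> {u, v} \<in> E \<longleftrightarrow> {f u, f v} \<in> E"
    unfolding automorphisms_iff by blast+
  have "inv_into UNIV f u < n" if "u < n" for u
    using permutes_in_image[OF permutes_inv[OF f(1)], of u] that by simp
  then have "{u, v} \<in> E \<longleftrightarrow> {inv_into UNIV f u, inv_into UNIV f v} \<in> E" if "u < n" "v < n" for u v
    using f(2)[of "inv_into UNIV f u" "inv_into UNIV f v"] that by (simp add: permutes_inverses(1)[OF f(1)])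
  then show ?thesis
    unfolding automorphisms_iff using permutes_inv[OF f(1)] by blast
qed

definition orbit :: "nat \<Rightarrow> nat set set \<Rightarrow> nat \<Rightarrow> nat set" where
  "orbit n E v = (\<lambda>f. f v) ` automorphisms n E"

lemma orbit_self: "v \<in> orbit n E v"
  unfolding orbit_def using automorphisms_id[of n E] by (metis id_apply imageI)

lemma orbit_bound: "v < n \<Longrightarrow> x \<in> orbit n E v \<Longrightarrow> x < n"
  unfolding orbit_def automorphisms_def is_graph_iso_def
  using permutes_in_image[of _ "{0..<n}" v] by auto

lemma orbit_eq:
  assumes "x \<in> orbit n E v"
  shows "orbit n E x = orbit n E v"
proof -
  have sub: "orbit n E (f v) \<subseteq> orbit n E v" if "f \<in> automorphisms n E" for f v
  proof
    fix y assume "y \<in> orbit n E (f v)"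
    then obtain h where "h \<in> automorphisms n E" "y = (h \<circ> f) v" by (auto simp: orbit_def)
    then show "y \<in> orbit n E v"
      unfolding orbit_def using automorphisms_comp that by blast
  qed
  from assms obtain f where f: "f \<in> automorphisms n E" "x = f v" by (auto simp: orbit_def)
  then have "f permutes {0..<n}" unfolding automorphisms_iff by blast
  then have "v = inv_into UNIV f x" using f(2) by (simp add: permutes_inverses(2))
  then have "orbit n E v \<subseteq> orbit n E x"
    using sub[OF automorphisms_inv[OF f(1)], of x] by simp
  then show ?thesis using sub[OF f(1), of v] f(2) by blast
qed

text \<open>
  With one orbit fewer than vertices, two vertices \<open>u\<close> and \<open>v\<close> share
  an orbit and there is no other coincidence. An automorphism that maps \<open>u\<close> to
  \<open>v\<close> fixes all other vertices, so it exchanges the two.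
\<close>

lemma almost_all_orbits_trivial:
  assumes card: "int (card (orbits n E)) = int n - 1"
  obtains \<tau> \<tau>' where "\<tau> < n" "\<tau>' < n" "\<tau> \<noteq> \<tau>'" "is_graph_iso n E E (Transposition.transpose \<tau> \<tau>')"
    "\<And>t t'. twins n E t t' \<longleftrightarrow> {t, t'} = {\<tau>, \<tau>'}"
proof -
  let ?O = "orbit n E"
  have orbits: "orbits n E = ?O ` {0..<n}"
    by (simp add: orbits_def orbit_def)
  have "\<not> inj_on ?O {0..<n}"
  proof
    assume "inj_on ?O {0..<n}"
    then have "card (orbits n E) = n" by (simp add: orbits card_image)
    then show False using card by simp
  qed
  then obtain u v where uv: "u < n" "v < n" "u \<noteq> v" "?O u = ?O v"
    by (auto simp: inj_on_def)
  have "?O ` ({0..<n} - {v}) = ?O ` {0..<n}"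
  proof
    show "?O ` {0..<n} \<subseteq> ?O ` ({0..<n} - {v})"
    proof
      fix X assume "X \<in> ?O ` {0..<n}"
      then obtain x where x: "x < n" "X = ?O x" by auto
      show "X \<in> ?O ` ({0..<n} - {v})"
      proof (cases "x = v")
        case True
        then have "X = ?O u" using x uv(4) by simp
        then show ?thesis using uv by (intro image_eqI[of _ _ u]) auto
      next
        case False
        then show ?thesis using x by (intro image_eqI[of _ _ x]) auto
      qed
    qed
  qed auto
  then have "card (?O ` ({0..<n} - {v})) = card ({0..<n} - {v})"
    using card uv(2) by (simp add: orbits)
  then have inj: "inj_on ?O ({0..<n} - {v})"
    by (intro eq_card_imp_inj_on) auto
  have eq: "x = y" if "x < n" "y < n" "x \<noteq> v" "y \<noteq> v" "?O x = ?O y" for x y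
    using inj_onD[OF inj that(5)] that(1-4) by simp
  have "v \<in> ?O u" using orbit_self[of v n E] uv(4) by simp
  then obtain f where f: "f \<in> automorphisms n E" "f u = v" by (auto simp: orbit_def)
  then have fp: "f permutes {0..<n}" unfolding automorphisms_iff by blast
  have f_bound: "f x < n" if "x < n" for x
    using permutes_in_image[OF fp, of x] that by simp
  have f_fix: "f w = w" if "w < n" "w \<noteq> u" "w \<noteq> v" for w
  proof -
    have "?O (f w) = ?O w" by (rule orbit_eq) (use f(1) in \<open>auto simp: orbit_def\<close>)
    moreover have "f w \<noteq> v" using permutes_inj[OF fp] f(2) that(2) by (auto simp: inj_eq)
    ultimately show ?thesis using eq[OF f_bound[OF that(1)] that(1)] that(3) by simp
  qed
  have "f v = u"
  proof (rule ccontr)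
    assume "f v \<noteq> u"
    moreover have "f v \<noteq> v" using permutes_inj[OF fp] f(2) uv(3) by (metis injD)
    ultimately have "f (f v) = f v" using f_fix[OF f_bound[OF uv(2)]] by simp
    then have "f v = v" using permutes_inj[OF fp] by (metis injD)
    then show False using \<open>f v \<noteq> v\<close> by simp
  qed
  then have "f = Transposition.transpose u v"
    using f_fix f(2) permutes_not_in[OF fp] uv by (auto simp: fun_eq_iff Transposition.transpose_def)
  then have iso: "is_graph_iso n E E (Transposition.transpose u v)"
    using f(1) by (simp add: automorphisms_def)
  have "twins n E t t' \<longleftrightarrow> {t, t'} = {u, v}" for t t'
  proof
    assume "twins n E t t'"
    then obtain w where w: "t \<noteq> t'" "w < n" "{t, t'} = ?O w"
      by (auto simp: twins_def orbits)
    then have mem: "t \<in> ?O w" "t' \<in> ?O w" by auto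
    have bound: "t < n" "t' < n" using orbit_bound[OF w(2)] mem by auto
    have O: "?O t = ?O t'" using orbit_eq[OF mem(1)] orbit_eq[OF mem(2)] by simp
    consider "t = v" | "t' = v" using eq[OF bound _ _ O] w(1) by blast
    then show "{t, t'} = {u, v}"
    proof cases
      case 1
      then have "t' = u" using eq[OF bound(2) uv(1)] O uv w(1) by auto
      then show ?thesis using 1 by auto
    next
      case 2
      then have "t = u" using eq[OF bound(1) uv(1)] O uv w(1) by auto
      then show ?thesis using 2 by auto
    qed
  next
    assume tt: "{t, t'} = {u, v}"
    have "?O u = {u, v}"
    proof
      show "{u, v} \<subseteq> ?O u" using \<open>v \<in> ?O u\<close> orbit_self by auto
      show "?O u \<subseteq> {u, v}"
      proof
        fix x assume x: "x \<in> ?O u"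
        then show "x \<in> {u, v}"
          using eq[OF orbit_bound[OF uv(1) x] uv(1)] orbit_eq[OF x] uv(3) by auto
      qed
    qed
    then show "twins n E t t'"
      using tt uv by (auto simp: twins_def orbits doubleton_eq_iff)
  qed
  then show ?thesis using that uv(1-3) iso by blast
qed

lemma twin_eigenvector:
  fixes \<tau> \<tau>' :: nat
  defines "\<xi> \<equiv> \<lambda>j. (if j = \<tau> then 1 else 0) - (if j = \<tau>' then 1 else 0 :: int)"
  assumes E: "simple_graph n E" and \<tau>: "\<tau> < n" "\<tau>' < n" "\<tau> \<noteq> \<tau>'"
    and iso: "is_graph_iso n E E (Transposition.transpose \<tau> \<tau>')"
  shows "\<And>i. i < n \<Longrightarrow> mat_app n (adj_entry E) \<xi> i = - adj_entry E \<tau> \<tau>' * \<xi> i"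
    and "dot n \<xi> \<xi> = 2" "dot n (\<lambda>_. 1) \<xi> = 0" "\<xi> \<tau> = 1"
proof -
  have dot_xi: "(\<Sum>j<n. c j * \<xi> j) = c \<tau> - c \<tau>'" for c
  proof -
    have "(\<Sum>j<n. c j * (if j = t then 1 else 0)) = c t" if "t < n" for t
      using that by (subst sum.remove[of _ t]) auto
    then show ?thesis using \<tau> by (simp only: \<xi>_def right_diff_distrib sum_subtractf)
  qed
  show "dot n \<xi> \<xi> = 2" "dot n (\<lambda>_. 1) \<xi> = 0" "\<xi> \<tau> = 1"
    using \<tau> dot_xi[of \<xi>] dot_xi[of "\<lambda>_. 1"] by (simp_all add: dot_def) (simp_all add: \<xi>_def)
  fix i assume i: "i < n"
  have "mat_app n (adj_entry E) \<xi> i = adj_entry E i \<tau> - adj_entry E i \<tau>'"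
    by (simp add: mat_app_def dot_xi)
  also have "\<dots> = - adj_entry E \<tau> \<tau>' * \<xi> i"
  proof -
    consider "i = \<tau>" | "i = \<tau>'" | "i \<noteq> \<tau>" "i \<noteq> \<tau>'" by blast
    then show ?thesis
    proof cases
      case 1
      then show ?thesis using \<tau>(3) by (simp add: \<xi>_def adj_loop_free[OF E])
    next
      case 2
      then show ?thesis using \<tau>(3) by (simp add: \<xi>_def adj_loop_free[OF E] adj_sym[of E \<tau>'])
    next
      case 3
      have "{i, \<tau>} \<in> E \<longleftrightarrow> {Transposition.transpose \<tau> \<tau>' i, Transposition.transpose \<tau> \<tau>' \<tau>} \<in> E"
        using iso i \<tau>(1) unfolding is_graph_iso_def by blast
      then show ?thesis using 3 by (simp add: \<xi>_def adj_entry_def)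
    qed
  qed
  finally show "mat_app n (adj_entry E) \<xi> i = - adj_entry E \<tau> \<tau>' * \<xi> i" .
qed

lemma lambda1_eq:
  assumes "\<And>t t'. twins n E t t' \<longleftrightarrow> {t, t'} = {\<tau>, \<tau>'}"
  shows "lambda1 n E = - adj_entry E \<tau> \<tau>'"
proof -
  have "(\<exists>t t'. twins n E t t' \<and> {t, t'} \<in> E) \<longleftrightarrow> {\<tau>, \<tau>'} \<in> E"
    unfolding assms by metis
  then show ?thesis by (simp add: lambda1_def adj_entry_def)
qed

lemma SNF_shape_entry:
  assumes "4 \<le> n" "j < n"
  shows "SNF_shape n b $$ (j, j)
    = (if j < (n + 1) div 2 then 1 else if j < n - 2 then 2 else if j = n - 2 then 2 * b else 0)"
proof -
  have len: "(n + 1) div 2 + (n div 2 - 2) = n - 2" using assms(1) by linarith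
  have k: "(n + 1) div 2 \<le> n - 2" using len by linarith
  have "SNF_shape n b $$ (j, j) = (replicate ((n + 1) div 2) 1 @ replicate (n div 2 - 2) 2 @ [2 * b, 0]) ! j"
    using assms(2) by (simp add: SNF_shape_def mat_diag_def)
  also have "\<dots> = (if j < (n + 1) div 2 then 1 else if j < n - 2 then 2 else [2 * b, 0] ! (j - (n - 2)))"
  proof -
    have "j - (n + 1) div 2 < n div 2 - 2 \<longleftrightarrow> j < n - 2" if "\<not> j < (n + 1) div 2"
      using len that by linarith
    moreover have "j - (n + 1) div 2 - (n div 2 - 2) = j - (n - 2)"
      using len by linarith
    ultimately show ?thesis by (simp add: nth_append)
  qed
  also have "\<dots> = (if j < (n + 1) div 2 then 1 else if j < n - 2 then 2 else if j = n - 2 then 2 * b else 0)"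
  proof (cases "j < n - 2")
    case False
    then consider "j = n - 2" | "j = n - 1" using assms by linarith
    then show ?thesis
    proof cases
      case 1
      then show ?thesis using k by simp
    next
      case 2
      then have "j - (n - 2) = 1" "j \<noteq> n - 2" using assms(1) by linarith+
      then show ?thesis using k False by simp
    qed
  qed simp
  finally show ?thesis .
qed

section \<open>The criterion\<close>

lemma snf_basis_cong:
  assumes "snf_basis n M d f g V V'"
    and M: "\<And>k i. k < n \<Longrightarrow> i < n \<Longrightarrow> M k i = M' k i" and d: "\<And>j. j < n \<Longrightarrow> d j = d' j"
  shows "snf_basis n M' d' f g V V'"
proof -
  interpret snf_basis n M d f g V V' by fact
  show ?thesis
  proof unfold_locales
    show "d' j * g j i = (\<Sum>k<n. V k j * M' k i)" if "j < n" "i < n" for j i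
      using g_walk[OF that] that by (simp add: M d)
    show "M' k i = (\<Sum>j<n. d' j * V' k j * g j i)" if "k < n" "i < n" for k i
      using walk_g[OF that] that by (simp add: M d)
  qed (fact expand_f expand_g dual)+
qed

lemma walk_mat_SNF_basis:
  assumes "is_SNF n (walk_mat n E) D"
  obtains f g V V' where "snf_basis n (walk_vec n (adj_entry E)) (\<lambda>j. D $$ (j, j)) f g V V'"
proof -
  from SNF_basis[OF assms] obtain f g V V'
    where B: "snf_basis n (\<lambda>k i. walk_mat n E $$ (i, k)) (\<lambda>j. D $$ (j, j)) f g V V'" .
  have "snf_basis n (walk_vec n (adj_entry E)) (\<lambda>j. D $$ (j, j)) f g V V'"
    by (rule snf_basis_cong[OF B]) (simp_all add: walk_mat_entry)
  then show ?thesis by (rule that)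
qed

text \<open>
  The diagonal of \<^const>\<open>SNF_shape\<close>, without the detour through lists.
\<close>

definition shape_factor :: "nat \<Rightarrow> int \<Rightarrow> nat \<Rightarrow> int" where
  "shape_factor n b j = (if j < (n + 1) div 2 then 1 else if j < n - 2 then 2 else if j = n - 2 then 2 * b else 0)"

lemma family_walk_lattice:
  assumes E: "E \<in> family_Hs n" and n: "4 \<le> n"
    and snf: "is_SNF n (walk_mat n E) (SNF_shape n b)" and b: "odd b"
  obtains f g V V' \<xi> \<tau> m
  where "halved_walk_lattice n (adj_entry E) (shape_factor n b) f g V V' \<xi> (lambda1 n E) \<tau> m b"
proof -
  have simple: "simple_graph n E" and card: "int (card (orbits n E)) = int n - 1"
    using E by (auto simp: family_Hs_def family_H_def)
  from almost_all_orbits_trivial[OF card] obtain \<tau> \<tau>' where \<tau>: "\<tau> < n" "\<tau>' < n" "\<tau> \<noteq> \<tau>'"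
    and iso: "is_graph_iso n E E (Transposition.transpose \<tau> \<tau>')"
    and twins: "\<And>t t'. twins n E t t' \<longleftrightarrow> {t, t'} = {\<tau>, \<tau>'}" by metis
  define \<xi> where "\<xi> j = (if j = \<tau> then 1 else 0) - (if j = \<tau>' then 1 else 0 :: int)" for j
  note \<xi> = twin_eigenvector[OF simple \<tau> iso, folded \<xi>_def lambda1_eq[OF twins]]
  from monic_relation[OF adj_sym \<xi>(1) \<xi>(3) \<tau>(1) \<xi>(4)] obtain m
    where m: "\<And>i. i < n \<Longrightarrow> walk_vec n (adj_entry E) (n - 1) i = (\<Sum>k<n-1. m k * walk_vec n (adj_entry E) k i)" by metis
  from walk_mat_SNF_basis[OF snf] obtain f g V V'
    where "snf_basis n (walk_vec n (adj_entry E)) (\<lambda>j. SNF_shape n b $$ (j, j)) f g V V'" .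
  then have basis: "snf_basis n (walk_vec n (adj_entry E)) (shape_factor n b) f g V V'"
    by (rule snf_basis_cong) (simp_all add: SNF_shape_entry[OF n] shape_factor_def)
  interpret symmetric_array n "adj_entry E" by (rule adj_symmetric_array)
  interpret snf_basis n "walk_vec n (adj_entry E)" "shape_factor n b" f g V V' by (rule basis)
  have "halved_walk_lattice n (adj_entry E) (shape_factor n b) f g V V' \<xi> (lambda1 n E) \<tau> m b"
  proof unfold_locales
    show "shape_factor n b (n - 1) = 0" using n by (auto simp: shape_factor_def)
    show "shape_factor n b j \<noteq> 0" if "j < n - 1" for j
      using that b n by (auto simp: shape_factor_def)
    show "\<exists>c. odd c \<and> c dvd b \<and> shape_factor n b j = 2 * c" if "(n + 1) div 2 \<le> j" "j < n - 1" for j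
    proof (cases "j < n - 2")
      case True
      then show ?thesis using that by (intro exI[of _ 1]) (simp add: shape_factor_def)
    next
      case False
      then have "j = n - 2" using that by linarith
      then show ?thesis using that b by (intro exI[of _ b]) (simp add: shape_factor_def)
    qed
    show "lambda1 n E = 0 \<or> lambda1 n E = - 1" by (simp add: lambda1_def)
  qed (use n b \<xi> m \<tau>(1) adj_loop_free[OF simple] in \<open>simp_all add: shape_factor_def\<close>)
  then show ?thesis by (rule that)
qed

lemma nullspace_mod_not_subset:
  assumes "\<not> nullspace_mod p (transpose_mat (walk_mat n E)) \<subseteq> nullspace_mod p (adjacency_mat n E - c \<cdot>\<^sub>m 1\<^sub>m n)"
  shows "\<exists>y. (\<forall>k<n. p dvd dot n (walk_vec n (adj_entry E) k) y)
    \<and> (\<exists>i<n. \<not> p dvd mat_app n (adj_entry E) y i - c * y i)"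
proof -
  from assms obtain v where v: "v \<in> nullspace_mod p (transpose_mat (walk_mat n E))"
    and v': "v \<notin> nullspace_mod p (adjacency_mat n E - c \<cdot>\<^sub>m 1\<^sub>m n)" by blast
  define y where "y i = v $ i" for i
  note W = walk_mat_carrier[of n E]
  have carr: "v \<in> carrier_vec n" and range: "\<forall>i<n. v $ i \<in> {0..<p}"
    and null: "\<forall>k<n. [(transpose_mat (walk_mat n E) *\<^sub>v v) $ k = 0] (mod p)"
    using v W by (auto simp: nullspace_mod_def)
  have "p dvd dot n (walk_vec n (adj_entry E) k) y" if k: "k < n" for k
  proof -
    have "(transpose_mat (walk_mat n E) *\<^sub>v v) $ k = dot n (walk_vec n (adj_entry E) k) y"
      using k W carr by (simp add: scalar_prod_def dot_def y_def lessThan_atLeast0 walk_mat_entry)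
    moreover have "p dvd (transpose_mat (walk_mat n E) *\<^sub>v v) $ k"
      using null k by (simp add: cong_0_iff)
    ultimately show ?thesis by (simp only:)
  qed
  moreover have "\<exists>i<n. \<not> p dvd mat_app n (adj_entry E) y i - c * y i"
  proof (rule ccontr)
    assume all: "\<not> (\<exists>i<n. \<not> p dvd mat_app n (adj_entry E) y i - c * y i)"
    have "[((adjacency_mat n E - c \<cdot>\<^sub>m 1\<^sub>m n) *\<^sub>v v) $ i = 0] (mod p)" if i: "i < n" for i
    proof -
      have "((adjacency_mat n E - c \<cdot>\<^sub>m 1\<^sub>m n) *\<^sub>v v) $ i
          = (\<Sum>j<n. (adj_entry E i j - c * (if i = j then 1 else 0)) * y j)"
        using i carr by (simp add: adjacency_mat_eq array_mat_def scalar_prod_def y_def lessThan_atLeast0)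
      also have "\<dots> = mat_app n (adj_entry E) y i - (\<Sum>j<n. c * (if i = j then 1 else 0) * y j)"
        by (simp only: left_diff_distrib sum_subtractf mat_app_def)
      also have "(\<Sum>j<n. c * (if i = j then 1 else 0) * y j) = c * y i"
        using i by (subst sum.remove[of _ i]) auto
      finally show ?thesis using all i by (simp add: cong_0_iff)
    qed
    then have "v \<in> nullspace_mod p (adjacency_mat n E - c \<cdot>\<^sub>m 1\<^sub>m n)"
      using carr range by (simp add: nullspace_mod_def adjacency_mat_eq array_mat_def)
    then show False using v' by blast
  qed
  ultimately show ?thesis by (intro exI[of _ y]) simp
qed

text \<open>
  The three cases of the null vector argument, and their combination with the rational
  orthogonal matrix.
\<close>

lemma DGS_criterion:
  assumes E: "E \<in> family_Hs n" and n: "4 \<le> n"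
    and snf: "is_SNF n (walk_mat n E) (SNF_shape n b)" and b: "odd b" "squarefree b"
    and hyp: "\<And>p :: int. prime p \<Longrightarrow> odd p \<Longrightarrow> p dvd b \<Longrightarrow>
      \<not> nullspace_mod p (transpose_mat (walk_mat n E))
          \<subseteq> nullspace_mod p (adjacency_mat n E - lambda1 n E \<cdot>\<^sub>m 1\<^sub>m n)"
  shows "DGS n E"
  unfolding DGS_def
proof (intro allI impI, elim conjE)
  fix E' assume E': "simple_graph n E'" and cospectral: "gen_cospectral n E' E"
  have simple: "simple_graph n E" using E by (simp add: family_Hs_def family_H_def)
  from family_walk_lattice[OF E n snf b(1)] obtain f g V V' \<xi> \<tau> m
    where L: "halved_walk_lattice n (adj_entry E) (shape_factor n b) f g V V' \<xi> (lambda1 n E) \<tau> m b" .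
  interpret L: halved_walk_lattice n "adj_entry E" "shape_factor n b" f g V V' \<xi> "lambda1 n E" \<tau> m b by (rule L)
  have null: "int p dvd z i"
    if p: "prime p" and z: "\<And>k. int p dvd dot n (L.w k) z"
      and zz: "\<And>k. (int p)\<^sup>2 dvd dot n z ((mat_app n (adj_entry E) ^^ k) z)" and i: "i < n" for p z i
  proof -
    have prime: "prime (int p)" using p by simp
    have iso: "int p dvd dot n z z"
      using zz[of 0] by (auto simp: power2_eq_square intro: dvd_mult_left)
    have "p = 2 \<or> odd p"
      using prime_odd_nat[OF p] prime_ge_2_nat[OF p] by (cases "p = 2") auto
    then consider "p = 2" | "odd p" "\<not> int p dvd b" | "odd p" "int p dvd b"
      by blast
    then show ?thesis
    proof cases
      case 1
      then show ?thesis using L.null_mod_2[of z i] z zz i by simp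
    next
      case 2
      then have odd: "odd (int p)" by simp
      have "\<not> int p dvd shape_factor n b j" if "j < n - 1" for j
        using that 2 prime odd_prime_not_dvd_2[OF prime odd] n
        by (auto simp: shape_factor_def prime_dvd_mult_iff not_prime_unit)
      then obtain c \<beta> where "\<And>i. i < n \<Longrightarrow> z i = c * \<xi> i + int p * \<beta> i"
        using L.null_mod_coprime[OF prime _ z] by metis
      then show ?thesis using L.xi_multiple_isotropic[OF prime odd _ iso i] by blast
    next
      case 3
      then have odd: "odd (int p)" by simp
      obtain b' where b': "b = int p * b'" using 3 by blast
      have nb': "\<not> int p dvd b'"
      proof
        assume "int p dvd b'"
        then have "(int p)\<^sup>2 dvd b" by (simp add: b' power2_eq_square)
        then show False using b(2) prime squarefreeD not_prime_unit by blast
      qed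
      from nullspace_mod_not_subset[OF hyp[OF prime odd 3(2)]] obtain y i0
        where y0: "\<forall>k<n. int p dvd dot n (L.w k) y"
          and y: "i0 < n" "\<not> int p dvd mat_app n (adj_entry E) y i0 - lambda1 n E * y i0"
        by (elim exE conjE)
      show ?thesis
      proof (rule L.null_mod_ramified[OF prime odd _ nb' _ L.null_all[OF y0[rule_format]] y z _ _ _ i])
        show "shape_factor n b (n - 2) = 2 * (int p * b')"
          using n by (auto simp: shape_factor_def b')
        show "shape_factor n b j = 1 \<or> shape_factor n b j = 2" if "j < n - 2" for j
          using that by (simp add: shape_factor_def)
        show "(int p)\<^sup>2 dvd dot n z z" "(int p)\<^sup>2 dvd dot n z (mat_app n (adj_entry E) z)"
          using zz[of 0] zz[of 1] by (simp_all add: One_nat_def)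
        have "(int p)\<^sup>2 dvd dot n (mat_app n (adj_entry E) z) (mat_app n (adj_entry E) z)"
          using zz[of 2] by (simp add: L.dot_mat_app numeral_2_eq_2)
        then show "int p dvd dot n (mat_app n (adj_entry E) z) (mat_app n (adj_entry E) z)"
          by (auto simp: power2_eq_square intro: dvd_mult_left)
      qed
    qed
  qed
  have walks: "dot n (\<lambda>_. 1) (walk_vec n (adj_entry E') k) = L.walks k" for k
    unfolding L.walks_def by (rule gen_cospectral_walks[OF simple E' cospectral])
  obtain Q :: "rat mat" where Q: "Q \<in> carrier_mat n n" "transpose_mat Q * Q = 1\<^sub>m n"
    "mat n n (\<lambda>(i, j). of_int (adj_entry E i j)) * Q = Q * mat n n (\<lambda>(i, j). of_int (adj_entry E' i j))"
    "Q *\<^sub>v vec n (\<lambda>_. 1) = vec n (\<lambda>_. 1)"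
    by (rule L.rational_orthogonal_transfer[of "adj_entry E'", OF adj_symmetric_array adj_loop_free[OF E'] walks])
  have "\<exists>h. h permutes {0..<n} \<and> (\<forall>i<n. \<forall>j<n. adj_entry E' i j = adj_entry E (h i) (h j))"
    by (rule rational_transfer_permutation[OF adj_symmetric_array[of n E] adj_symmetric_array[of n E'] Q]) (rule null)
  then obtain h where h: "h permutes {0..<n}" "\<forall>i<n. \<forall>j<n. adj_entry E' i j = adj_entry E (h i) (h j)" by blast
  have "is_graph_iso n E' E h"
    using h by (auto simp: is_graph_iso_def adj_entry_def split: if_splits)
  then show "isomorphic n E' E" by (auto simp: isomorphic_def)
qed

theorem theorem5:
  fixes n :: nat
  shows
    "(\<forall>(E :: nat set set) (b :: int).
        E \<in> family_F n \<longrightarrow>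
        is_invariant_factor n (walk_mat n E) (n - 1) (2 * b) \<longrightarrow>
        (\<forall>p :: int. prime p \<and> odd p \<and> p dvd b \<longrightarrow>
           \<not> nullspace_mod p (transpose_mat (walk_mat n E))
               \<subseteq> nullspace_mod p (adjacency_mat n E - lambda1 n E \<cdot>\<^sub>m 1\<^sub>m n)) \<longrightarrow>
        DGS n E) \<and>
     (\<forall>E \<in> family_F_star n. DGS n E)"
proof (intro conjI allI impI ballI)
  fix E :: "nat set set" and b :: int
  assume E: "E \<in> family_F n" and inv: "is_invariant_factor n (walk_mat n E) (n - 1) (2 * b)"
    and hyp: "\<forall>p :: int. prime p \<and> odd p \<and> p dvd b \<longrightarrow>
      \<not> nullspace_mod p (transpose_mat (walk_mat n E))
          \<subseteq> nullspace_mod p (adjacency_mat n E - lambda1 n E \<cdot>\<^sub>m 1\<^sub>m n)"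
  from E obtain c where E: "E \<in> family_Hs n" "4 \<le> n" and c: "odd c" "squarefree c"
    and snf: "is_SNF n (walk_mat n E) (SNF_shape n c)" by (auto simp: family_F_def)
  from inv obtain D where D: "is_SNF n (walk_mat n E) D" "2 * b = D $$ (n - 2, n - 2)"
    by (auto simp: is_invariant_factor_def numeral_2_eq_2)
  \<comment> \<open>The number \<open>c\<close> comes from the defining Smith normal form, \<open>b\<close> from an arbitrary one.\<close>
  have "p dvd b" if p: "prime p" "odd p" "p dvd c" for p :: int
  proof -
    from walk_mat_SNF_basis[OF snf] obtain f g V V'
      where 1: "snf_basis n (walk_vec n (adj_entry E)) (\<lambda>j. SNF_shape n c $$ (j, j)) f g V V'" .
    from walk_mat_SNF_basis[OF D(1)] obtain f' g' Y Y'
      where 2: "snf_basis n (walk_vec n (adj_entry E)) (\<lambda>j. D $$ (j, j)) f' g' Y Y'" .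
    have chain: "D $$ (j, j) dvd D $$ (n - 2, n - 2)" if "j < n - 1" for j
    proof -
      have "j \<le> n - 2" using that by linarith
      then show ?thesis
      proof (induction rule: inc_induct)
        case (step k)
        then have "D $$ (k, k) dvd D $$ (Suc k, Suc k)"
          using D(1) by (auto simp: is_SNF_def)
        then show ?case using step.IH by (rule dvd_trans)
      qed simp
    qed
    have "p dvd D $$ (n - 2, n - 2)"
      by (rule prime_dvd_penultimate_invariant[OF 1 2 _ p(1) _ _ chain])
        (use E(2) p(3) in \<open>auto simp: SNF_shape_entry[OF E(2)]\<close>)
    then have "p dvd 2 * b" by (simp add: D(2))
    then show ?thesis using p odd_prime_not_dvd_2[OF p(1,2)] by (simp add: prime_dvd_mult_iff)
  qed
  then show "DGS n E"
    using hyp by (intro DGS_criterion[OF E snf c]) blast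
next
  fix E assume "E \<in> family_F_star n"
  then have "E \<in> family_Hs n" "4 \<le> n" "is_SNF n (walk_mat n E) (SNF_shape n 1)"
    by (auto simp: family_F_star_def)
  then show "DGS n E"
    by (rule DGS_criterion) (auto simp: not_prime_unit)
qed

end
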